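(* For every $V > 0$, every $\omega\in\mathbb{T}$, and every $$\alpha < \frac{2 \log \left( 1 + \frac{1}{(2+2V)^2} \right)}{\log \left( 1 + \frac{1}{(2+2V)^2} \right) + 16 \cdot \log \left( \frac{\sqrt{5} + 1}{2} \right) + 16 \log [(5 + 2V)^{1/2}(3+V) a_V]},$$ we have that $\mu_\psi(S) = 0$ for every $\psi \in \ell^2(\mathbb{Z})$ and every Borel set $S$ with $h^\alpha(S) = 0$.
   Context: Let $\alpha_0 = \frac{\sqrt{5}-1}{2}$. For $V>0$ and $\omega \in \mathbb{T} = \mathbb{R}/\mathbb{Z}$, the Fibonacci Hamiltonian is the bounded self-adjoint operator on $\ell^2(\mathbb{Z})$ given by $$[H_{V,\omega} \psi](n) = \psi(n+1) + \psi(n-1) + V \chi_{[1-\alpha_0,1)}(n\alpha_0 + \omega \bmod 1)\, \psi(n).$$ For $\psi\in\ell^2(\mathbb{Z})$, $\mu_\psi$ is the spectral measure of $H_{V,\omega}$ and $\psi$, i.e. the Borel measure with $\langle \psi, g(H_{V,\omega})\psi\rangle = \int g(E)\,d\mu_\psi(E)$ for every bounded measurable function $g$ on the spectrum of $H_{V,\omega}$. $a_V$ denotes the largest root of the polynomial $x^3-(2+V)x-1$. $h^\alpha$ denotes $\alpha$-dimensional Hausdorff measure on $\mathbb{R}$ (for $\alpha\ge0$). *)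

theory Defs
  imports "HOL-Analysis.Analysis"
begin

text \<open>
  Operators on the complex Hilbert space of square-summable functions on the integers are
  represented as total functions on \<^typ>\<open>int \<Rightarrow> complex\<close>; only their values on the carrier
  \<open>ell2\<close> are ever constrained.
\<close>

definition ell2 :: "(int \<Rightarrow> complex) set" where
  "ell2 = {\<psi>. (\<lambda>n. (cmod (\<psi> n))\<^sup>2) summable_on UNIV}"

definition ell2_inner :: "(int \<Rightarrow> complex) \<Rightarrow> (int \<Rightarrow> complex) \<Rightarrow> complex" where
  "ell2_inner \<phi> \<psi> = (\<Sum>\<^sub>\<infinity>n. cnj (\<phi> n) * \<psi> n)"

definition ell2_norm :: "(int \<Rightarrow> complex) \<Rightarrow> real" where
  "ell2_norm \<psi> = sqrt (\<Sum>\<^sub>\<infinity>n. (cmod (\<psi> n))\<^sup>2)"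

definition bounded_op :: "((int \<Rightarrow> complex) \<Rightarrow> (int \<Rightarrow> complex)) \<Rightarrow> bool" where
  "bounded_op T \<longleftrightarrow>
     (\<forall>\<psi>\<in>ell2. T \<psi> \<in> ell2) \<and>
     (\<forall>\<phi>\<in>ell2. \<forall>\<psi>\<in>ell2. T (\<lambda>n. \<phi> n + \<psi> n) = (\<lambda>n. T \<phi> n + T \<psi> n)) \<and>
     (\<forall>c. \<forall>\<psi>\<in>ell2. T (\<lambda>n. c * \<psi> n) = (\<lambda>n. c * T \<psi> n)) \<and>
     (\<exists>C. \<forall>\<psi>\<in>ell2. ell2_norm (T \<psi>) \<le> C * ell2_norm \<psi>)"

definition op_resolvent_set :: "((int \<Rightarrow> complex) \<Rightarrow> (int \<Rightarrow> complex)) \<Rightarrow> complex set" where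
  "op_resolvent_set T = {z. \<exists>R. bounded_op R \<and>
     (\<forall>\<psi>\<in>ell2. R (\<lambda>n. T \<psi> n - z * \<psi> n) = \<psi> \<and> (\<lambda>n. T (R \<psi>) n - z * R \<psi> n) = \<psi>)}"

definition op_spectrum :: "((int \<Rightarrow> complex) \<Rightarrow> (int \<Rightarrow> complex)) \<Rightarrow> complex set" where
  "op_spectrum T = - op_resolvent_set T"

text \<open>For self-adjoint \<open>T\<close> this is the whole spectrum, viewed as a set of reals.\<close>

definition real_spectrum :: "((int \<Rightarrow> complex) \<Rightarrow> (int \<Rightarrow> complex)) \<Rightarrow> real set" where
  "real_spectrum T = {x. complex_of_real x \<in> op_spectrum T}"

definition bounded_borel_on :: "real set \<Rightarrow> (real \<Rightarrow> complex) set" where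
  "bounded_borel_on K = {g. g \<in> borel_measurable (restrict_space borel K) \<and> bounded (g ` K)}"

text \<open>
  \<open>borel_functional_calculus T \<Phi>\<close>: the map \<open>\<Phi>\<close> is the bounded Borel functional calculus
  \<open>g \<mapsto> g(T)\<close> of the bounded self-adjoint operator \<open>T\<close>, i.e. the unique norm-decreasing unital
  *-homomorphism on the bounded Borel functions on the spectrum that sends the identity
  function to \<open>T\<close> and turns bounded pointwise convergence into strong convergence. Values of
  \<open>g\<close> off the spectrum are irrelevant by the norm bound.
\<close>

definition borel_functional_calculus ::
  "((int \<Rightarrow> complex) \<Rightarrow> (int \<Rightarrow> complex)) \<Rightarrow>
   ((real \<Rightarrow> complex) \<Rightarrow> (int \<Rightarrow> complex) \<Rightarrow> (int \<Rightarrow> complex)) \<Rightarrow> bool" where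
  "borel_functional_calculus T \<Phi> \<longleftrightarrow>
    (let K = real_spectrum T; B = bounded_borel_on K in
     (\<forall>g\<in>B. bounded_op (\<Phi> g)) \<and>
     (\<forall>f\<in>B. \<forall>g\<in>B. \<forall>\<psi>\<in>ell2. \<Phi> (\<lambda>x. f x + g x) \<psi> = (\<lambda>n. \<Phi> f \<psi> n + \<Phi> g \<psi> n)) \<and>
     (\<forall>c. \<forall>g\<in>B. \<forall>\<psi>\<in>ell2. \<Phi> (\<lambda>x. c * g x) \<psi> = (\<lambda>n. c * \<Phi> g \<psi> n)) \<and>
     (\<forall>f\<in>B. \<forall>g\<in>B. \<forall>\<psi>\<in>ell2. \<Phi> (\<lambda>x. f x * g x) \<psi> = \<Phi> f (\<Phi> g \<psi>)) \<and>
     (\<forall>g\<in>B. \<forall>\<phi>\<in>ell2. \<forall>\<psi>\<in>ell2.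
        ell2_inner \<phi> (\<Phi> (\<lambda>x. cnj (g x)) \<psi>) = ell2_inner (\<Phi> g \<phi>) \<psi>) \<and>
     (\<forall>\<psi>\<in>ell2. \<Phi> (\<lambda>x. 1) \<psi> = \<psi>) \<and>
     (\<forall>\<psi>\<in>ell2. \<Phi> complex_of_real \<psi> = T \<psi>) \<and>
     (\<forall>g\<in>B. \<forall>\<psi>\<in>ell2. ell2_norm (\<Phi> g \<psi>) \<le> (SUP x\<in>K. cmod (g x)) * ell2_norm \<psi>) \<and>
     (\<forall>gs g. (\<forall>k. gs k \<in> B) \<longrightarrow> g \<in> B \<longrightarrow> (\<exists>C. \<forall>k. \<forall>x\<in>K. cmod (gs k x) \<le> C) \<longrightarrow>
        (\<forall>x\<in>K. (\<lambda>k. gs k x) \<longlonglongrightarrow> g x) \<longrightarrow>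
        (\<forall>\<psi>\<in>ell2. (\<lambda>k. ell2_norm (\<lambda>n. \<Phi> (gs k) \<psi> n - \<Phi> g \<psi> n)) \<longlonglongrightarrow> 0)))"

text \<open>
  The spectral measure is a Borel measure on the spectrum, regarded here as a Borel measure on
  the reals vanishing off it. Finiteness is needed because the Bochner integral of a
  non-integrable function is 0, so that for \<open>\<psi> = 0\<close> the integral identity alone would also
  admit infinite measures.
\<close>

definition is_spectral_measure ::
  "((int \<Rightarrow> complex) \<Rightarrow> (int \<Rightarrow> complex)) \<Rightarrow> (int \<Rightarrow> complex) \<Rightarrow> real measure \<Rightarrow> bool" where
  "is_spectral_measure T \<psi> \<mu> \<longleftrightarrow>
     sets \<mu> = sets borel \<and> finite_measure \<mu> \<and> emeasure \<mu> (- real_spectrum T) = 0 \<and>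
     (\<exists>\<Phi>. borel_functional_calculus T \<Phi> \<and>
       (\<forall>g\<in>bounded_borel_on (real_spectrum T).
          ell2_inner \<psi> (\<Phi> g \<psi>) = (LINT E:real_spectrum T|\<mu>. g E)))"

definition alpha0 :: real where
  "alpha0 = (sqrt 5 - 1) / 2"

text \<open>
  The phase ranges over the circle; it enters only through \<^const>\<open>frac\<close>, so it is represented
  by an arbitrary real number.
\<close>

definition fib_hamiltonian :: "real \<Rightarrow> real \<Rightarrow> (int \<Rightarrow> complex) \<Rightarrow> (int \<Rightarrow> complex)" where
  "fib_hamiltonian V \<omega> \<psi> = (\<lambda>n. \<psi> (n + 1) + \<psi> (n - 1) +
     complex_of_real (V * indicator {1 - alpha0..<1} (frac (of_int n * alpha0 + \<omega>))) * \<psi> n)"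

definition a_root :: "real \<Rightarrow> real" where
  "a_root V = Max {x. x ^ 3 - (2 + V) * x - 1 = 0}"

text \<open>
  The gauge for \<open>\<alpha> = 0\<close> is 1 on nonempty sets (counting measure); \<^term>\<open>0 powr 0 = (0::real)\<close>
  would give the wrong value on singletons.
\<close>

definition hausdorff_gauge :: "real \<Rightarrow> 'a::metric_space set \<Rightarrow> real" where
  "hausdorff_gauge \<alpha> A = (if A = {} then 0 else if \<alpha> = 0 then 1 else diameter A powr \<alpha>)"

text \<open>Boundedness is explicit because \<^const>\<open>diameter\<close> is unspecified on unbounded sets.\<close>

definition hausdorff_premeasure :: "real \<Rightarrow> real \<Rightarrow> 'a::metric_space set \<Rightarrow> ennreal" where
  "hausdorff_premeasure \<alpha> \<delta> S =
     (INF C\<in>{C :: nat \<Rightarrow> 'a set. S \<subseteq> (\<Union>i. C i) \<and> (\<forall>i. bounded (C i) \<and> diameter (C i) \<le> \<delta>)}.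
        \<Sum>i. ennreal (hausdorff_gauge \<alpha> (C i)))"

definition hausdorff_measure :: "real \<Rightarrow> 'a::metric_space set \<Rightarrow> ennreal" where
  "hausdorff_measure \<alpha> S = (SUP \<delta>\<in>{0<..}. hausdorff_premeasure \<alpha> \<delta> S)"

end

theory Submission
  imports Defs "HOL-Number_Theory.Fib"
begin

text \<open>
  The substitution \<open>1 \<mapsto> 10\<close>, \<open>0 \<mapsto> 1\<close> maps Sturmian sequences of slope \<open>alpha0\<close> onto Sturmian
  sequences of the same slope, so for every phase the potential is, at each level \<open>i\<close>, a
  concatenation of two Fibonacci words whose transfer matrices \<open>M\<^sub>i\<close> satisfy
  \<open>M\<^sub>i\<^sub>+\<^sub>2 = M\<^sub>i M\<^sub>i\<^sub>+\<^sub>1\<close>. By the trace map, either all traces are bounded by \<open>2 + V\<close> or they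
  tend to infinity. Let \<open>\<phi> = \<chi>\<^sub>I(H) \<delta>\<^sub>m\<close> for an interval \<open>I\<close> of radius \<open>\<epsilon>\<close> around \<open>E\<close>, so that
  \<open>(H - E) \<phi>\<close> has norm at most \<open>\<epsilon>\<close> times that of \<open>\<phi>\<close>.

  If the traces at \<open>E\<close> escape, every site is (up to one step) the centre of a square of a word
  with huge trace \<open>x\<close>; there \<open>x \<phi>(n)\<close> is nearly \<open>\<phi>(n + q) + \<phi>(n - q)\<close>, and summing over \<open>n\<close> gives
  \<open>\<phi> = 0\<close> for small \<open>\<epsilon>\<close>. So such energies form a null set.

  If they are bounded, Cayley-Hamilton makes the transfer matrices grow at most like
  \<open>C G\<^sup>k\<close> over words of length at most the Fibonacci number \<open>F\<^sub>k\<close>, whereas squares starting at every site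
  force the mass of a solution on \<open>[m, m + F\<^sub>k)\<close> to grow at least like \<open>\<Lambda>\<^sup>k\<close>. Comparing \<open>\<phi>\<close> with the
  exact solution that has the same data at \<open>m\<close> yields \<open>\<mu>(I) = O(\<epsilon>\<^sup>\<beta>)\<close> with
  \<open>\<beta> = ln \<Lambda> / ln (((sqrt 5 + 1) / 2) G)\<close>, uniformly in \<open>E\<close>, and \<open>\<beta>\<close> is at least the claimed exponent.
\<close>

subsection \<open>Two-by-two matrices\<close>

text \<open>The Hoelder bound turns on one identity: the value of \<phi> at \<open>m\<close> is a
  diagonal entry of a projection, hence equals N, the squared norm of \<phi>, which is also the mass
  of I under the spectral measure of the unit vector at \<open>m\<close>. Growth of the exact
  solution bounds \<Lambda>^k N^2 by a constant times N as long as the accumulated error, of order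
  G^k F_k \<epsilon>, stays bounded; so k is taken as large as the error permits and one factor N is
  cancelled. The obstacle is uniformity in the site \<open>m\<close>, the phase and E. Windows start
  at arbitrary sites, so incomplete blocks at both ends must be controlled on every level. Norms
  multiplied level by level would bring in the norms of all the matrices M_i; instead products are
  rewritten over the two lowest matrices, with coefficients governed by the traces alone. Unit
  vectors suffice: a projection that kills all of them is zero, and this settles every other vector
  at once.\<close>

datatype m2 = M2 (e11: real) (e12: real) (e21: real) (e22: real)

instantiation m2 :: real_algebra_1
begin
definition "0 = M2 0 0 0 0"
definition "1 = M2 1 0 0 1"
definition "X + Y = M2 (e11 X + e11 Y) (e12 X + e12 Y) (e21 X + e21 Y) (e22 X + e22 Y)"
definition "X - Y = M2 (e11 X - e11 Y) (e12 X - e12 Y) (e21 X - e21 Y) (e22 X - e22 Y)"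
definition "- X = M2 (- e11 X) (- e12 X) (- e21 X) (- e22 X)"
definition "X * Y = M2 (e11 X * e11 Y + e12 X * e21 Y) (e11 X * e12 Y + e12 X * e22 Y)
  (e21 X * e11 Y + e22 X * e21 Y) (e21 X * e12 Y + e22 X * e22 Y)"
definition "c *\<^sub>R X = M2 (c * e11 X) (c * e12 X) (c * e21 X) (c * e22 X)"
instance
  by standard
    (auto simp: zero_m2_def one_m2_def plus_m2_def minus_m2_def uminus_m2_def times_m2_def
       scaleR_m2_def algebra_simps)
end

lemmas m2_defs = zero_m2_def one_m2_def plus_m2_def minus_m2_def uminus_m2_def times_m2_def scaleR_m2_def

definition tr :: "m2 \<Rightarrow> real" where "tr X = e11 X + e22 X"
definition dt :: "m2 \<Rightarrow> real" where "dt X = e11 X * e22 X - e12 X * e21 X"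
definition ns :: "m2 \<Rightarrow> real" where "ns X = \<bar>e11 X\<bar> + \<bar>e12 X\<bar> + \<bar>e21 X\<bar> + \<bar>e22 X\<bar>"
text \<open>On determinant one this is the inverse, and by \<open>adj_eq\<close> it stays in the
  span of 1 and the matrix.\<close>

definition adj :: "m2 \<Rightarrow> m2" where "adj X = M2 (e22 X) (- e12 X) (- e21 X) (e11 X)"

definition act :: "m2 \<Rightarrow> complex \<times> complex \<Rightarrow> complex \<times> complex" where
  "act X p = (of_real (e11 X) * fst p + of_real (e12 X) * snd p,
     of_real (e21 X) * fst p + of_real (e22 X) * snd p)"

lemma dt_mult: "dt (X * Y) = dt X * dt Y"
  by (simp add: dt_def times_m2_def algebra_simps)

lemma dt_one [simp]: "dt 1 = 1" and tr_one [simp]: "tr 1 = 2"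
  by (simp_all add: dt_def tr_def one_m2_def)

lemma tr_mult_commute: "tr (X * Y) = tr (Y * X)"
  by (simp add: tr_def times_m2_def algebra_simps)

lemma cayley_hamilton: "dt X = 1 \<Longrightarrow> X * X = tr X *\<^sub>R X - 1"
  by (cases X) (simp add: dt_def tr_def m2_defs algebra_simps)

lemma adj_eq: "adj X = tr X *\<^sub>R 1 - X"
  by (simp add: adj_def tr_def m2_defs)

lemma adj_mult: "adj X * X = dt X *\<^sub>R 1" "X * adj X = dt X *\<^sub>R 1"
  by (simp_all add: adj_def dt_def m2_defs algebra_simps)

text \<open>Cayley-Hamilton for \<open>X * Y\<close>, multiplied on the right by the inverse
  \<open>adj Y\<close>, gives tr(XY) X - adj Y; \<open>adj_eq\<close> then expands the last
  term.\<close>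

lemma sandwich:
  assumes "dt X = 1" "dt Y = 1"
  shows "X * Y * X = tr (X * Y) *\<^sub>R X - tr Y *\<^sub>R 1 + Y"
  using assms
proof (cases X, cases Y)
  fix a b c d e f g h
  assume *: "X = M2 a b c d" "Y = M2 e f g h"
  have 1: "a * d - b * c = 1" "e * h - f * g = 1" using assms * by (auto simp: dt_def)
  show ?thesis unfolding * using 1
    by (simp add: m2_defs tr_def; intro conjI; algebra)
qed

lemma ns_nonneg: "0 \<le> ns X"
  by (simp add: ns_def)

lemma ns_one [simp]: "ns 1 = 2"
  by (simp add: ns_def one_m2_def)

lemma ns_adj [simp]: "ns (adj X) = ns X"
  by (simp add: ns_def adj_def)

lemma ns_scaleR: "ns (c *\<^sub>R X) = \<bar>c\<bar> * ns X"
  by (simp add: ns_def scaleR_m2_def abs_mult algebra_simps)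

lemma ns_add: "ns (X + Y) \<le> ns X + ns Y"
  unfolding ns_def plus_m2_def m2.sel
  using abs_triangle_ineq[of "e11 X" "e11 Y"] abs_triangle_ineq[of "e12 X" "e12 Y"]
    abs_triangle_ineq[of "e21 X" "e21 Y"] abs_triangle_ineq[of "e22 X" "e22 Y"] by linarith

lemma ns_mult: "ns (X * Y) \<le> ns X * ns Y"
proof -
  have "\<bar>a * b + c * d\<bar> \<le> \<bar>a\<bar> * \<bar>b\<bar> + \<bar>c\<bar> * \<bar>d\<bar>" for a b c d :: real
    by (metis abs_mult abs_triangle_ineq)
  then have "ns (X * Y) \<le> \<bar>e11 X\<bar> * \<bar>e11 Y\<bar> + \<bar>e12 X\<bar> * \<bar>e21 Y\<bar> + (\<bar>e11 X\<bar> * \<bar>e12 Y\<bar> + \<bar>e12 X\<bar> * \<bar>e22 Y\<bar>)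
    + (\<bar>e21 X\<bar> * \<bar>e11 Y\<bar> + \<bar>e22 X\<bar> * \<bar>e21 Y\<bar>) + (\<bar>e21 X\<bar> * \<bar>e12 Y\<bar> + \<bar>e22 X\<bar> * \<bar>e22 Y\<bar>)"
    unfolding ns_def times_m2_def by (simp add: add_mono)
  also have "\<dots> \<le> ns X * ns Y"
    by (simp add: ns_def algebra_simps)
  finally show ?thesis .
qed

lemma act_one [simp]: "act 1 p = p"
  by (simp add: act_def one_m2_def)

lemma act_mult: "act (X * Y) p = act X (act Y p)"
  by (simp add: act_def times_m2_def algebra_simps)

lemma act_add: "act X (p + q) = act X p + act X q"
  and act_diff: "act X (p - q) = act X p - act X q"
  and act_zero [simp]: "act X 0 = 0"
  by (simp_all add: act_def algebra_simps zero_prod_def prod_eq_iff)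

lemma act_sum: "act X (\<Sum>i\<in>A. f i) = (\<Sum>i\<in>A. act X (f i))"
  by (induction A rule: infinite_finite_induct) (auto simp: act_add)

lemma act_minus: "act (X - Y) p = act X p - act Y p"
  and act_scaleR: "act (c *\<^sub>R X) p = c *\<^sub>R act X p"
  by (simp_all add: act_def m2_defs algebra_simps prod_eq_iff scaleR_conv_of_real)

lemma norm_act: "norm (act X p) \<le> ns X * norm p"
proof -
  have f: "norm (fst p) \<le> norm p" and s: "norm (snd p) \<le> norm p"
    by (metis norm_fst_le prod.collapse, metis norm_snd_le prod.collapse)
  have "norm (act X p) \<le> norm (fst (act X p)) + norm (snd (act X p))"
    by (metis norm_Pair_le prod.collapse)
  also have "\<dots> \<le> (\<bar>e11 X\<bar> * norm (fst p) + \<bar>e12 X\<bar> * norm (snd p)) + (\<bar>e21 X\<bar> * norm (fst p) + \<bar>e22 X\<bar> * norm (snd p))"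
    unfolding act_def fst_conv snd_conv
    by (intro add_mono order.trans[OF norm_triangle_ineq]) (simp_all add: norm_mult)
  also have "\<dots> \<le> (\<bar>e11 X\<bar> * norm p + \<bar>e12 X\<bar> * norm p) + (\<bar>e21 X\<bar> * norm p + \<bar>e22 X\<bar> * norm p)"
    using f s by (intro add_mono mult_left_mono) auto
  also have "\<dots> = ns X * norm p" by (simp add: ns_def algebra_simps)
  finally show ?thesis .
qed

section \<open>Ordered products over an interval of sites, later sites acting on the left\<close>

fun fprod :: "(int \<Rightarrow> m2) \<Rightarrow> int \<Rightarrow> nat \<Rightarrow> m2" where
  "fprod X m 0 = 1"
| "fprod X m (Suc l) = X (m + int l) * fprod X m l"

lemma fprod_add: "fprod X m (k + l) = fprod X (m + int k) l * fprod X m k"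
  by (induction l) (auto simp: algebra_simps)

lemma fprod_cong: "(\<And>k. k < l \<Longrightarrow> X (m + int k) = Y (n + int k)) \<Longrightarrow> fprod X m l = fprod Y n l"
  by (induction l) auto

lemma dt_fprod: "(\<And>n. dt (X n) = 1) \<Longrightarrow> dt (fprod X m l) = 1"
  by (induction l) (auto simp: dt_mult)

text \<open>Moving a window of length \<open>l\<close> along a stretch of period \<open>l\<close> conjugates the product.\<close>

lemma tr_fprod_shift:
  assumes "\<And>n. dt (X n) = 1" "\<And>k. k < d \<Longrightarrow> X (m + int k) = X (m + int k + int l)"
  shows "tr (fprod X (m + int d) l) = tr (fprod X m l)"
  using assms(2)
proof (induction d)
  case (Suc d)
  have 1: "fprod X (m + int d) (Suc l) = X (m + int d + int l) * fprod X (m + int d) l" by simp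
  have 2: "fprod X (m + int d) (1 + l) = fprod X (m + int (Suc d)) l * X (m + int d)"
    unfolding fprod_add by (simp add: algebra_simps)
  let ?Z = "X (m + int d)"
  have e: "?Z * fprod X (m + int d) l = fprod X (m + int (Suc d)) l * ?Z"
    using 1 2 Suc.prems[of d] by simp
  have "fprod X (m + int (Suc d)) l = (fprod X (m + int (Suc d)) l * ?Z) * adj ?Z"
    by (simp add: mult.assoc adj_mult assms(1))
  also have "\<dots> = ?Z * (fprod X (m + int d) l * adj ?Z)" using e by (metis mult.assoc)
  finally have "tr (fprod X (m + int (Suc d)) l) = tr ((fprod X (m + int d) l * adj ?Z) * ?Z)"
    by (simp add: tr_mult_commute)
  also have "\<dots> = tr (fprod X (m + int d) l)"
    by (simp add: mult.assoc adj_mult assms(1))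
  finally show ?case using Suc by simp
qed simp

text \<open>The matrices of the Fibonacci words, where the word of index \<open>i + 2\<close> is the one of index
  \<open>i + 1\<close> followed by the one of index \<open>i\<close>.\<close>

fun fibmat :: "m2 \<Rightarrow> m2 \<Rightarrow> nat \<Rightarrow> m2" where
  "fibmat A B 0 = A"
| "fibmat A B (Suc 0) = B"
| "fibmat A B (Suc (Suc i)) = fibmat A B i * fibmat A B (Suc i)"

lemma dt_fibmat: "dt A = 1 \<Longrightarrow> dt B = 1 \<Longrightarrow> dt (fibmat A B i) = 1"
  by (induction A B i rule: fibmat.induct) (auto simp: dt_mult)

text \<open>The Fibonacci trace map: for consecutive matrices a, b the matrix three levels above a
  is b a b, whose trace is read off from \<open>sandwich\<close>.\<close>

lemma tr_fibmat_rec: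
  assumes "dt A = 1" "dt B = 1"
  shows "tr (fibmat A B (i + 3)) = tr (fibmat A B (i + 2)) * tr (fibmat A B (i + 1)) - tr (fibmat A B i)"
proof -
  let ?a = "fibmat A B i" and ?b = "fibmat A B (Suc i)"
  have d: "dt ?a = 1" "dt ?b = 1" using assms dt_fibmat by auto
  have "fibmat A B (i + 3) = ?b * ?a * ?b" by (simp add: numeral_3_eq_3 mult.assoc)
  also have "\<dots> = tr (?b * ?a) *\<^sub>R ?b - tr ?a *\<^sub>R 1 + ?a" by (rule sandwich[OF d(2,1)])
  finally have "tr (fibmat A B (i + 3)) = tr (?a * ?b) * tr ?b - tr ?a"
    by (simp add: tr_mult_commute[of ?b ?a]) (simp add: tr_def m2_defs algebra_simps)
  then show ?thesis by simp
qed

text \<open>Products \<open>M\<^sub>i\<^sup>e M\<^sub>i\<^sub>+\<^sub>1\<^sup>e' \<dots>\<close> with exponents 0 or 1, no two consecutive ones being 1.\<close>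

inductive incp :: "(nat \<Rightarrow> m2) \<Rightarrow> nat \<Rightarrow> nat \<Rightarrow> m2 \<Rightarrow> bool" for M where
  nil: "incp M i 0 1"
| one: "incp M i 1 (M i)"
| skip: "incp M (Suc i) n X \<Longrightarrow> incp M i (Suc n) X"
| take: "incp M (Suc (Suc i)) n X \<Longrightarrow> incp M i (Suc (Suc n)) (M i * X)"

text \<open>Indices decrease from left to right and consecutive factors are allowed. Such products
  arise at the left end of a window of sites, the increasing ones at its right end.\<close>

inductive decp :: "(nat \<Rightarrow> m2) \<Rightarrow> nat \<Rightarrow> nat \<Rightarrow> m2 \<Rightarrow> bool" for M where
  nil: "decp M i 0 1"
| skip: "decp M (Suc i) n X \<Longrightarrow> decp M i (Suc n) X"
| take: "decp M (Suc i) n X \<Longrightarrow> decp M i (Suc n) (X * M i)"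

lemma incp_extend_skip: "incp M i n X \<Longrightarrow> incp M i (Suc n) X"
proof (induction rule: incp.induct)
  case (nil i) then show ?case by (intro incp.skip incp.nil)
next
  case (one i) then show ?case
    using incp.take[OF incp.nil[of M], of i] by simp
qed (auto intro: incp.intros)

text \<open>The inductive rules grow a product at its lowest index, whereas stripping a window level
  by level supplies the highest one. Index \<open>i + n\<close> is left empty, so the new factor has
  no neighbour and uses up two levels.\<close>

lemma incp_extend_take: "incp M i n X \<Longrightarrow> incp M i (Suc (Suc n)) (X * M (Suc (i + n)))"
proof (induction rule: incp.induct)
  case (nil i) then show ?case using incp.skip[OF incp.one[of M "Suc i"]] by simp
next
  case (one i)
  have "incp M (i+2) 1 (M (i+2))" by (rule incp.one)
  then show ?case using incp.take[of M i 1 "M (i+2)"] by (simp add: eval_nat_numeral)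
next
  case (skip i n X) then show ?case using incp.skip[of M i] by simp
next
  case (take i n X) then show ?case using incp.take[of M i] by (simp add: mult.assoc)
qed

lemma decp_extend:
  "decp M i n X \<Longrightarrow> decp M i (Suc n) X"
  "decp M i n X \<Longrightarrow> decp M i (Suc n) (M (i + n) * X)"
proof (induction rule: decp.induct)
  case (nil i)
  { case 1 show ?case by (intro decp.intros) }
  { case 2 show ?case using decp.take[OF decp.nil[of M], of i] by simp }
next
  case (skip i n X)
  { case 1 show ?case by (intro decp.intros skip.IH) }
  { case 2 show ?case using decp.skip[OF skip.IH(2)] by simp }
next
  case (take i n X)
  { case 1 show ?case by (intro decp.intros take.IH) }
  { case 2 show ?case using decp.take[OF take.IH(2)] by (simp add: mult.assoc) }
qed

section \<open>Matrix products when all traces are bounded\<close>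

locale bounded_traces =
  fixes M :: "nat \<Rightarrow> m2" and t :: real
  assumes M_rec: "M (Suc (Suc i)) = M i * M (Suc i)"
    and det: "dt (M i) = 1"
    and trace: "\<bar>tr (M i)\<bar> \<le> t"
    and t2: "2 \<le> t"
begin

lemma basis_down:
  fixes i
  defines "a \<equiv> M i" and "b \<equiv> M (Suc i)"
  shows "M (Suc (Suc i)) = a * b"
    "M (Suc i) * M (Suc (Suc i)) = tr (M (Suc (Suc i))) *\<^sub>R b - tr a *\<^sub>R 1 + a"
    "M (Suc (Suc i)) * M (Suc i) = tr b *\<^sub>R (a * b) - a"
    "a * a = tr a *\<^sub>R a - 1"
    "a * b * a = tr (M (Suc (Suc i))) *\<^sub>R a - tr b *\<^sub>R 1 + b"
proof -
  have d: "dt a = 1" "dt b = 1" using det by (auto simp: a_def b_def)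
  have r: "M (Suc (Suc i)) = a * b" using M_rec by (simp add: a_def b_def)
  show "M (Suc (Suc i)) = a * b" by fact
  have "M (Suc i) * M (Suc (Suc i)) = b * a * b" by (simp add: r b_def mult.assoc)
  then show "M (Suc i) * M (Suc (Suc i)) = tr (M (Suc (Suc i))) *\<^sub>R b - tr a *\<^sub>R 1 + a"
    using sandwich[OF d(2,1)] by (simp add: r tr_mult_commute[of b a])
  have "M (Suc (Suc i)) * M (Suc i) = a * (b * b)" by (simp add: r b_def mult.assoc)
  then show "M (Suc (Suc i)) * M (Suc i) = tr b *\<^sub>R (a * b) - a"
    by (simp add: cayley_hamilton[OF d(2)] algebra_simps)
  show "a * a = tr a *\<^sub>R a - 1" by (rule cayley_hamilton[OF d(1)])
  show "a * b * a = tr (M (Suc (Suc i))) *\<^sub>R a - tr b *\<^sub>R 1 + b"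
    using sandwich[OF d] r by simp
qed

text \<open>Only the coefficients are tracked, never the size of the matrices. Norms enter once, in
  \<open>ns_incp\<close>, when the product has been brought down to its lowest index.\<close>

definition coords4 :: "nat \<Rightarrow> real \<Rightarrow> m2 \<Rightarrow> bool" where
  "coords4 i r X \<longleftrightarrow> (\<exists>c0 c1 c2 c3. X = c0 *\<^sub>R 1 + c1 *\<^sub>R M i + c2 *\<^sub>R M (Suc i) + c3 *\<^sub>R (M i * M (Suc i))
     \<and> \<bar>c0\<bar> \<le> r \<and> \<bar>c1\<bar> \<le> r \<and> \<bar>c2\<bar> \<le> r \<and> \<bar>c3\<bar> \<le> r)"

lemma coords4I:
  assumes "X = c0 *\<^sub>R 1 + c1 *\<^sub>R M i + c2 *\<^sub>R M (Suc i) + c3 *\<^sub>R (M i * M (Suc i))"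
    "\<bar>c0\<bar> \<le> r" "\<bar>c1\<bar> \<le> r" "\<bar>c2\<bar> \<le> r" "\<bar>c3\<bar> \<le> r"
  shows "coords4 i r X"
  unfolding coords4_def using assms by blast

lemma abs_tr_mult: "\<bar>c\<bar> \<le> r \<Longrightarrow> \<bar>tr (M i) * c\<bar> \<le> t * r"
  using trace[of i] by (simp add: abs_mult mult_mono')

lemma coords4_down:
  assumes "coords4 (Suc i) r X"
  shows "coords4 i ((1 + t) * r) X"
proof -
  obtain c0 c1 c2 c3 where X: "X = c0 *\<^sub>R 1 + c1 *\<^sub>R M (Suc i) + c2 *\<^sub>R M (Suc (Suc i)) + c3 *\<^sub>R (M (Suc i) * M (Suc (Suc i)))"
    and c: "\<bar>c0\<bar> \<le> r" "\<bar>c1\<bar> \<le> r" "\<bar>c2\<bar> \<le> r" "\<bar>c3\<bar> \<le> r"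
    using assms unfolding coords4_def by auto
  have "0 \<le> r" using c by linarith
  then have "r \<le> (1 + t) * r" using t2 by (simp add: algebra_simps)
  have X': "X = (c0 - tr (M i) * c3) *\<^sub>R 1 + c3 *\<^sub>R M i + (c1 + tr (M (Suc (Suc i))) * c3) *\<^sub>R M (Suc i)
     + c2 *\<^sub>R (M i * M (Suc i))"
    unfolding X basis_down(2) unfolding basis_down(1) by (simp add: algebra_simps)
  show ?thesis
    by (rule coords4I[OF X'])
      (use c \<open>r \<le> (1 + t) * r\<close> abs_tr_mult[OF c(4), of i] abs_tr_mult[OF c(4), of "Suc (Suc i)"]
       in \<open>simp_all add: abs_le_iff algebra_simps\<close>)
qed

text \<open>Multiplication by \<open>M i\<close> costs no more than descending the two levels it
  occupies. This is the gain from forbidding consecutive factors: the rate stays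
  \<open>1 + t\<close> per level.\<close>

lemma coords4_take:
  assumes "coords4 (Suc (Suc i)) r X"
  shows "coords4 i ((1 + t)\<^sup>2 * r) (M i * X)"
proof -
  obtain c0 c1 c2 c3 where X: "X = c0 *\<^sub>R 1 + c1 *\<^sub>R M (Suc (Suc i)) + c2 *\<^sub>R M (Suc (Suc (Suc i)))
      + c3 *\<^sub>R (M (Suc (Suc i)) * M (Suc (Suc (Suc i))))"
    and c: "\<bar>c0\<bar> \<le> r" "\<bar>c1\<bar> \<le> r" "\<bar>c2\<bar> \<le> r" "\<bar>c3\<bar> \<le> r"
    using assms unfolding coords4_def by auto
  define x y z u where "x = tr (M i)" "y = tr (M (Suc i))" "z = tr (M (Suc (Suc i)))" "u = tr (M (Suc (Suc (Suc i))))"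
  note xyz = this
  let ?a = "M i" and ?b = "M (Suc i)"
  have 1: "M (Suc (Suc i)) * M (Suc (Suc (Suc i))) = u *\<^sub>R M (Suc (Suc i)) - y *\<^sub>R 1 + ?b"
    using basis_down(2)[of "Suc i"] by (simp add: xyz)
  have 2: "M (Suc (Suc (Suc i))) = z *\<^sub>R ?b - x *\<^sub>R 1 + ?a"
    using basis_down(1)[of "Suc i"] basis_down(2)[of i] by (simp add: xyz)
  have X': "X = (c0 - y * c3) *\<^sub>R 1 + c3 *\<^sub>R ?b + (c1 + u * c3) *\<^sub>R (?a * ?b) + c2 *\<^sub>R (z *\<^sub>R ?b - x *\<^sub>R 1 + ?a)"
    unfolding X 1 unfolding 2 unfolding basis_down(1)[of i] by (simp add: algebra_simps)
  have aab: "?a * (?a * ?b) = x *\<^sub>R (?a * ?b) - ?b"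
    by (simp add: mult.assoc[symmetric] basis_down(4) xyz algebra_simps)
  have aX: "?a * X = (- c2) *\<^sub>R 1 + (c0 - y * c3) *\<^sub>R ?a
      + (- (c1 + u * c3)) *\<^sub>R ?b + (c3 + z * c2 + x * (c1 + u * c3)) *\<^sub>R (?a * ?b)"
    unfolding X' by (simp add: distrib_left right_diff_distrib basis_down(4) aab)
      (simp add: xyz algebra_simps)
  have r: "0 \<le> r" using c by auto
  then have r2: "0 \<le> t * r" "0 \<le> t * (t * r)" using t2 by auto
  have "\<bar>y * c3\<bar> \<le> t * r" "\<bar>u * c3\<bar> \<le> t * r" "\<bar>z * c2\<bar> \<le> t * r" "\<bar>x * c1\<bar> \<le> t * r"
    "\<bar>x * (u * c3)\<bar> \<le> t * (t * r)"
    unfolding xyz by (rule abs_tr_mult c)+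
  then show ?thesis
    by (intro coords4I[OF aX]) (use c r r2 in \<open>simp_all add: abs_le_iff power2_eq_square algebra_simps\<close>)
qed

lemma coords4_incp: "incp M i n X \<Longrightarrow> coords4 i ((1 + t) ^ n) X"
proof (induction rule: incp.induct)
  case (nil i)
  have "(1::m2) = 1 *\<^sub>R 1 + 0 *\<^sub>R M i + 0 *\<^sub>R M (Suc i) + 0 *\<^sub>R (M i * M (Suc i))" by simp
  then show ?case by (rule coords4I) auto
next
  case (one i)
  have "M i = 0 *\<^sub>R 1 + 1 *\<^sub>R M i + 0 *\<^sub>R M (Suc i) + 0 *\<^sub>R (M i * M (Suc i))" by simp
  then show ?case by (rule coords4I) (use t2 in auto)
next
  case (skip i n X)
  then show ?case using coords4_down by simp
next
  case (take i n X)
  then show ?case using coords4_take[of i "(1 + t)^n" X] by (simp add: power2_eq_square mult.assoc)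
qed

text \<open>The fifth matrix is linearly dependent on the others, but right multiplication by
  \<open>M i\<close> produces it with small coefficients. The weights reproduce themselves up to the
  factor \<open>3 / 2 * (t + 1)\<close>: this is exact for \<open>c2\<close> and \<open>c3\<close>
  when a level is skipped and for \<open>c4\<close> when a factor is taken, and the other bounds
  have slack because \<open>t\<close> is at least 2.\<close>

definition coords5 :: "nat \<Rightarrow> real \<Rightarrow> m2 \<Rightarrow> bool" where
  "coords5 i r X \<longleftrightarrow> (\<exists>c0 c1 c2 c3 c4. X = c0 *\<^sub>R 1 + c1 *\<^sub>R M i + c2 *\<^sub>R M (Suc i)
       + c3 *\<^sub>R (M i * M (Suc i)) + c4 *\<^sub>R (M (Suc i) * M i)
     \<and> \<bar>c0\<bar> \<le> (t + 1) * r \<and> \<bar>c1\<bar> \<le> (5 * t + 9) / 4 * r \<and> \<bar>c2\<bar> \<le> 3 / 2 * r \<and> \<bar>c3\<bar> \<le> r \<and> \<bar>c4\<bar> \<le> 3 / 2 * r)"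

lemma coords5I:
  assumes "X = c0 *\<^sub>R 1 + c1 *\<^sub>R M i + c2 *\<^sub>R M (Suc i) + c3 *\<^sub>R (M i * M (Suc i)) + c4 *\<^sub>R (M (Suc i) * M i)"
    "\<bar>c0\<bar> \<le> (t + 1) * r" "\<bar>c1\<bar> \<le> (5 * t + 9) / 4 * r" "\<bar>c2\<bar> \<le> 3 / 2 * r" "\<bar>c3\<bar> \<le> r" "\<bar>c4\<bar> \<le> 3 / 2 * r"
  shows "coords5 i r X"
  unfolding coords5_def using assms by blast

lemma coords5_step:
  assumes "coords5 (Suc i) r X"
  shows "coords5 i (3 / 2 * (t + 1) * r) X" "coords5 i (3 / 2 * (t + 1) * r) (X * M i)"
proof -
  obtain c0 c1 c2 c3 c4 where X: "X = c0 *\<^sub>R 1 + c1 *\<^sub>R M (Suc i) + c2 *\<^sub>R M (Suc (Suc i))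
       + c3 *\<^sub>R (M (Suc i) * M (Suc (Suc i))) + c4 *\<^sub>R (M (Suc (Suc i)) * M (Suc i))"
    and c: "\<bar>c0\<bar> \<le> (t + 1) * r" "\<bar>c1\<bar> \<le> (5 * t + 9) / 4 * r" "\<bar>c2\<bar> \<le> 3 / 2 * r" "\<bar>c3\<bar> \<le> r" "\<bar>c4\<bar> \<le> 3 / 2 * r"
    using assms unfolding coords5_def by auto
  define x y z where "x = tr (M i)" "y = tr (M (Suc i))" "z = tr (M (Suc (Suc i)))"
  note xyz = this
  let ?a = "M i" and ?b = "M (Suc i)"
  have X': "X = (c0 - x * c3) *\<^sub>R 1 + (c3 - c4) *\<^sub>R ?a + (c1 + z * c3) *\<^sub>R ?b + (c2 + y * c4) *\<^sub>R (?a * ?b) + 0 *\<^sub>R (?b * ?a)"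
    unfolding X basis_down(2,3) unfolding basis_down(1) xyz by (simp add: algebra_simps)
  have X'': "X * ?a = (- (c3 - c4) - y * (c2 + y * c4)) *\<^sub>R 1
      + (c0 - x * c3 + x * (c3 - c4) + z * (c2 + y * c4)) *\<^sub>R ?a
      + (c2 + y * c4) *\<^sub>R ?b + 0 *\<^sub>R (?a * ?b) + (c1 + z * c3) *\<^sub>R (?b * ?a)"
    unfolding X' by (simp add: distrib_right left_diff_distrib basis_down(4,5))
      (simp add: xyz algebra_simps)
  \<comment> \<open>With \<open>t * r\<close> and \<open>t * (t * r)\<close> named, all comparisons
    become linear, and \<open>t2\<close> enters them only through \<open>2 * R1 \<le> R2\<close> and
    \<open>2 * r \<le> R1\<close>.\<close>
  define R1 R2 where "R1 = t * r" and "R2 = t * R1"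
  have r: "0 \<le> r" using c(4) by linarith
  have R: "0 \<le> R1" "2 * R1 \<le> R2" "2 * r \<le> R1"
    using r t2 by (simp_all add: R1_def R2_def mult_right_mono)
  have bnd: "\<bar>x * c3\<bar> \<le> t * r" "\<bar>z * c3\<bar> \<le> t * r" "\<bar>y * c4\<bar> \<le> t * (3 / 2 * r)" "\<bar>x * c4\<bar> \<le> t * (3 / 2 * r)"
    "\<bar>y * c2\<bar> \<le> t * (3 / 2 * r)" "\<bar>z * c2\<bar> \<le> t * (3 / 2 * r)"
    "\<bar>y * (y * c4)\<bar> \<le> t * (t * (3 / 2 * r))" "\<bar>z * (y * c4)\<bar> \<le> t * (t * (3 / 2 * r))"
    unfolding xyz by (rule abs_tr_mult c)+
  have e: "t * (3 / 2 * r) = 3 / 2 * R1" "t * (3 / 2 * R1) = 3 / 2 * R2" "t * r = R1"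
    "(t + 1) * r = R1 + r" "(5 * t + 9) / 4 * r = 5 / 4 * R1 + 9 / 4 * r"
    "(t + 1) * (3 / 2 * R1 + 3 / 2 * r) = 3 / 2 * R2 + 3 * R1 + 3 / 2 * r"
    "(5 * t + 9) / 4 * (3 / 2 * R1 + 3 / 2 * r) = 15 / 8 * R2 + 21 / 4 * R1 + 27 / 8 * r"
    "3 / 2 * (3 / 2 * R1 + 3 / 2 * r) = 9 / 4 * R1 + 9 / 4 * r" "3 / 2 * (t + 1) * r = 3 / 2 * R1 + 3 / 2 * r"
    by (simp_all add: R1_def R2_def field_simps)
  note c = c[unfolded e] and bnd = bnd[unfolded e]
  show "coords5 i (3 / 2 * (t + 1) * r) X"
  proof (rule coords5I[OF X'], unfold e)
    show "\<bar>c0 - x * c3\<bar> \<le> 3 / 2 * R2 + 3 * R1 + 3 / 2 * r" using c(1) bnd(1) r R by linarith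
    show "\<bar>c3 - c4\<bar> \<le> 15 / 8 * R2 + 21 / 4 * R1 + 27 / 8 * r" using c(4,5) r R by linarith
    show "\<bar>c1 + z * c3\<bar> \<le> 9 / 4 * R1 + 9 / 4 * r" using c(2) bnd(2) by linarith
    show "\<bar>c2 + y * c4\<bar> \<le> 3 / 2 * R1 + 3 / 2 * r" using c(3) bnd(3) by linarith
    show "\<bar>0\<bar> \<le> 9 / 4 * R1 + 9 / 4 * r" using r R by linarith
  qed
  have d: "y * (c2 + y * c4) = y * c2 + y * (y * c4)" "z * (c2 + y * c4) = z * c2 + z * (y * c4)"
    "x * (c3 - c4) = x * c3 - x * c4" by (simp_all add: algebra_simps)
  show "coords5 i (3 / 2 * (t + 1) * r) (X * M i)"
  proof (rule coords5I[OF X''], unfold e d)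
    show "\<bar>- (c3 - c4) - (y * c2 + y * (y * c4))\<bar> \<le> 3 / 2 * R2 + 3 * R1 + 3 / 2 * r"
      using c(4,5) bnd(5,7) r R by linarith
    show "\<bar>c0 - x * c3 + (x * c3 - x * c4) + (z * c2 + z * (y * c4))\<bar> \<le> 15 / 8 * R2 + 21 / 4 * R1 + 27 / 8 * r"
      using c(1) bnd(4,6,8) r R by linarith
    show "\<bar>c2 + y * c4\<bar> \<le> 9 / 4 * R1 + 9 / 4 * r" using c(3) bnd(3) r R by linarith
    show "\<bar>0\<bar> \<le> 3 / 2 * R1 + 3 / 2 * r" using r R by linarith
    show "\<bar>c1 + z * c3\<bar> \<le> 9 / 4 * R1 + 9 / 4 * r" using c(2) bnd(2) by linarith
  qed
qed

lemma coords5_decp: "decp M i n X \<Longrightarrow> coords5 i ((3 / 2 * (t + 1)) ^ n) X"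
proof (induction rule: decp.induct)
  case (nil i)
  have "(1::m2) = 1 *\<^sub>R 1 + 0 *\<^sub>R M i + 0 *\<^sub>R M (Suc i) + 0 *\<^sub>R (M i * M (Suc i)) + 0 *\<^sub>R (M (Suc i) * M i)" by simp
  then show ?case by (rule coords5I) (use t2 in auto)
next
  case (skip i n X)
  then show ?case using coords5_step(1)[of i "(3 / 2 * (t + 1)) ^ n" X] by simp
next
  case (take i n X)
  then show ?case using coords5_step(2)[of i "(3 / 2 * (t + 1)) ^ n" X] by simp
qed

text \<open>The factor 5 is 2 + 1 + 1 + 1, since \<open>ns 1 = 2\<close>; the 6 in
  \<open>ns_decp\<close> has one more summand, for the fifth matrix.\<close>

lemma ns_incp:
  assumes "incp M i n X" "ns (M i) \<le> s" "ns (M (Suc i)) \<le> s" "1 \<le> s"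
  shows "ns X \<le> 5 * s\<^sup>2 * (1 + t) ^ n"
proof -
  obtain c0 c1 c2 c3 where X: "X = c0 *\<^sub>R 1 + c1 *\<^sub>R M i + c2 *\<^sub>R M (Suc i) + c3 *\<^sub>R (M i * M (Suc i))"
    and c: "\<bar>c0\<bar> \<le> (1 + t) ^ n" "\<bar>c1\<bar> \<le> (1 + t) ^ n" "\<bar>c2\<bar> \<le> (1 + t) ^ n" "\<bar>c3\<bar> \<le> (1 + t) ^ n"
    using coords4_incp[OF assms(1)] unfolding coords4_def by auto
  let ?r = "(1 + t) ^ n"
  have r: "0 \<le> ?r" using c by linarith
  have s: "s \<le> s\<^sup>2" "1 \<le> s\<^sup>2" using assms(4) by (auto intro: self_le_power one_le_power)
  have m: "ns (M i * M (Suc i)) \<le> s\<^sup>2"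
    unfolding power2_eq_square using assms by (intro order.trans[OF ns_mult] mult_mono) (auto simp: ns_nonneg)
  have "ns X \<le> \<bar>c0\<bar> * 2 + \<bar>c1\<bar> * ns (M i) + \<bar>c2\<bar> * ns (M (Suc i)) + \<bar>c3\<bar> * ns (M i * M (Suc i))"
    unfolding X by (intro order.trans[OF ns_add] add_mono) (simp_all add: ns_scaleR)
  also have "\<dots> \<le> ?r * (2 * s\<^sup>2) + ?r * s\<^sup>2 + ?r * s\<^sup>2 + ?r * s\<^sup>2"
    using c assms s m r by (intro add_mono mult_mono) (auto simp: ns_nonneg)
  finally show ?thesis by (simp add: algebra_simps)
qed

lemma ns_decp:
  assumes "decp M i n X" "ns (M i) \<le> s" "ns (M (Suc i)) \<le> s" "1 \<le> s"
  shows "ns X \<le> 6 * (5 * t + 9) * s\<^sup>2 * (3 / 2 * (t + 1)) ^ n"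
proof -
  let ?r = "(3 / 2 * (t + 1)) ^ n"
  obtain c0 c1 c2 c3 c4 where X: "X = c0 *\<^sub>R 1 + c1 *\<^sub>R M i + c2 *\<^sub>R M (Suc i) + c3 *\<^sub>R (M i * M (Suc i)) + c4 *\<^sub>R (M (Suc i) * M i)"
    and c: "\<bar>c0\<bar> \<le> (t + 1) * ?r" "\<bar>c1\<bar> \<le> (5 * t + 9) / 4 * ?r" "\<bar>c2\<bar> \<le> 3 / 2 * ?r" "\<bar>c3\<bar> \<le> ?r" "\<bar>c4\<bar> \<le> 3 / 2 * ?r"
    using coords5_decp[OF assms(1)] unfolding coords5_def by auto
  define R where "R = (5 * t + 9) * ?r"
  have r: "0 \<le> ?r" using t2 by simp
  have tr: "0 \<le> t * ?r" using r t2 by simp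
  have c': "\<bar>c0\<bar> \<le> R" "\<bar>c1\<bar> \<le> R" "\<bar>c2\<bar> \<le> R" "\<bar>c3\<bar> \<le> R" "\<bar>c4\<bar> \<le> R"
    using c r tr unfolding R_def by (auto simp: algebra_simps)
  have s: "s \<le> s\<^sup>2" "1 \<le> s\<^sup>2" using assms(4) by (auto intro: self_le_power one_le_power)
  have m: "ns (M i * M (Suc i)) \<le> s\<^sup>2" "ns (M (Suc i) * M i) \<le> s\<^sup>2"
    unfolding power2_eq_square using assms by (auto intro!: order.trans[OF ns_mult] mult_mono simp: ns_nonneg)
  have R: "0 \<le> R" using c' by linarith
  have "ns X \<le> \<bar>c0\<bar> * 2 + \<bar>c1\<bar> * ns (M i) + \<bar>c2\<bar> * ns (M (Suc i)) + \<bar>c3\<bar> * ns (M i * M (Suc i)) + \<bar>c4\<bar> * ns (M (Suc i) * M i)"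
    unfolding X by (intro order.trans[OF ns_add] add_mono) (simp_all add: ns_scaleR)
  also have "\<dots> \<le> R * (2 * s\<^sup>2) + R * s\<^sup>2 + R * s\<^sup>2 + R * s\<^sup>2 + R * s\<^sup>2"
    using c' assms s m R by (intro add_mono mult_mono) (auto simp: ns_nonneg)
  finally show ?thesis by (simp add: R_def algebra_simps)
qed

end

subsection \<open>Sturmian sequences\<close>

lemma alpha0_sq: "alpha0 * alpha0 = 1 - alpha0" and alpha0_pos: "0 < alpha0" and alpha0_less_1: "alpha0 < 1"
proof -
  have s: "sqrt 5 * sqrt 5 = 5" by simp
  show "alpha0 * alpha0 = 1 - alpha0" by (simp add: alpha0_def field_simps s)
  have "2 < sqrt (5::real)" by (rule real_less_rsqrt) simp
  then show "0 < alpha0" by (simp add: alpha0_def)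
  have "sqrt (5::real) < 3" by (rule real_less_lsqrt) simp_all
  then show "alpha0 < 1" by (simp add: alpha0_def)
qed

definition sturmian :: "(int \<Rightarrow> bool) \<Rightarrow> bool" where
  "sturmian w \<longleftrightarrow> (\<exists>\<theta>. (\<forall>n. w n \<longleftrightarrow> \<lfloor>(of_int n + 1) * alpha0 + \<theta>\<rfloor> \<noteq> \<lfloor>of_int n * alpha0 + \<theta>\<rfloor>) \<or>
     (\<forall>n. w n \<longleftrightarrow> \<lceil>(of_int n + 1) * alpha0 + \<theta>\<rceil> \<noteq> \<lceil>of_int n * alpha0 + \<theta>\<rceil>))"

text \<open>\<open>c j\<close> is the position in \<open>w\<close> at which the image of letter
  \<open>j\<close> of \<open>w'\<close> begins. Both images, 10 and 1, start with 1, so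
  \<open>c\<close> enumerates the ones of \<open>w\<close>.\<close>

definition desubst :: "(int \<Rightarrow> bool) \<Rightarrow> (int \<Rightarrow> bool) \<Rightarrow> (int \<Rightarrow> int) \<Rightarrow> bool" where
  "desubst w w' c \<longleftrightarrow> (\<forall>j. w (c j) \<and> (if w' j then c (j + 1) = c j + 2 \<and> \<not> w (c j + 1) else c (j + 1) = c j + 1))"

text \<open>\<open>F\<close> counts the ones of \<open>w\<close>, and \<open>inv\<close> says that
  \<open>j + G j\<close> is the last position with count at most \<open>j\<close>, that is, the
  position of a one. The gaps between successive ones are 1 plus the increments of \<open>G\<close>,
  so \<open>G\<close> is the counting function of \<open>w'\<close>.\<close>

lemma desubst_counting:
  fixes F G c :: "int \<Rightarrow> int" and w w' :: "int \<Rightarrow> bool"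
  assumes F: "\<And>n. w n \<longleftrightarrow> F (n + 1) \<noteq> F n" "\<And>n. F (n + 1) = F n \<or> F (n + 1) = F n + 1"
    and G: "\<And>j. w' j \<longleftrightarrow> G (j + 1) \<noteq> G j" "\<And>j. G (j + 1) = G j \<or> G (j + 1) = G j + 1"
    and inv: "\<And>n j. F n \<le> j \<longleftrightarrow> n \<le> j + G j"
  shows "desubst w w' (\<lambda>j. j + G j)"
  unfolding desubst_def
proof
  fix j
  let ?c = "\<lambda>j. j + G j"
  have 1: "F (?c j) \<le> j" "\<not> F (?c j + 1) \<le> j" for j using inv by auto
  then have c: "F (?c j) = j" "F (?c j + 1) = j + 1" for j using F(2)[of "?c j"] by (smt (verit))+
  have "w (?c j)" using c F(1) by simp
  moreover have "\<not> w (?c j + 1)" if "?c (j + 1) = ?c j + 2"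
    using c(1)[of "j + 1"] c(2)[of j] that F(1)[of "?c j + 1"] by (simp add: algebra_simps)
  ultimately show "w (?c j) \<and> (if w' j then ?c (j + 1) = ?c j + 2 \<and> \<not> w (?c j + 1) else ?c (j + 1) = ?c j + 1)"
    using G[of j] by auto
qed

text \<open>The reciprocal of \<open>alpha0\<close> is \<open>1 + alpha0\<close>. Inverting the
  counting function, a rounded line of slope \<open>alpha0\<close>, therefore gives \<open>j\<close>
  plus a rounded line of the same slope.\<close>

lemma sturmian_desubst:
  assumes "sturmian w"
  shows "\<exists>w' c. sturmian w' \<and> desubst w w' c"
proof -
  obtain \<theta> where th: "(\<forall>n. w n \<longleftrightarrow> \<lfloor>(of_int n + 1) * alpha0 + \<theta>\<rfloor> \<noteq> \<lfloor>of_int n * alpha0 + \<theta>\<rfloor>) \<or>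
     (\<forall>n. w n \<longleftrightarrow> \<lceil>(of_int n + 1) * alpha0 + \<theta>\<rceil> \<noteq> \<lceil>of_int n * alpha0 + \<theta>\<rceil>)"
    using assms by (auto simp: sturmian_def)
  have fl: "\<lfloor>of_int (n + 1) * alpha0 + \<theta>\<rfloor> = \<lfloor>of_int n * alpha0 + \<theta>\<rfloor> \<or> \<lfloor>of_int (n + 1) * alpha0 + \<theta>\<rfloor> = \<lfloor>of_int n * alpha0 + \<theta>\<rfloor> + 1"
    and ce: "\<lceil>of_int (n + 1) * alpha0 + \<theta>\<rceil> = \<lceil>of_int n * alpha0 + \<theta>\<rceil> \<or> \<lceil>of_int (n + 1) * alpha0 + \<theta>\<rceil> = \<lceil>of_int n * alpha0 + \<theta>\<rceil> + 1"
    for n \<theta>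
  proof -
    have e: "of_int (n + 1) * alpha0 + \<theta> = (of_int n * alpha0 + \<theta>) + alpha0" by (simp add: algebra_simps)
    show "\<lfloor>of_int (n + 1) * alpha0 + \<theta>\<rfloor> = \<lfloor>of_int n * alpha0 + \<theta>\<rfloor> \<or> \<lfloor>of_int (n + 1) * alpha0 + \<theta>\<rfloor> = \<lfloor>of_int n * alpha0 + \<theta>\<rfloor> + 1"
      unfolding e using alpha0_pos alpha0_less_1 by linarith
    show "\<lceil>of_int (n + 1) * alpha0 + \<theta>\<rceil> = \<lceil>of_int n * alpha0 + \<theta>\<rceil> \<or> \<lceil>of_int (n + 1) * alpha0 + \<theta>\<rceil> = \<lceil>of_int n * alpha0 + \<theta>\<rceil> + 1"
      unfolding e using alpha0_pos alpha0_less_1 by linarith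
  qed
  have div: "x * alpha0 < y \<longleftrightarrow> x < y + y * alpha0" "x * alpha0 \<le> y \<longleftrightarrow> x \<le> y + y * alpha0" for x y :: real
  proof -
    have g: "alpha0 * (1 + alpha0) = 1" using alpha0_sq by (simp add: algebra_simps)
    have x: "x * alpha0 * (1 + alpha0) = x" unfolding mult.assoc g by simp
    have y: "y * (1 + alpha0) = y + y * alpha0" by (simp add: algebra_simps)
    have "0 < 1 + alpha0" using alpha0_pos by simp
    then show "x * alpha0 < y \<longleftrightarrow> x < y + y * alpha0" "x * alpha0 \<le> y \<longleftrightarrow> x \<le> y + y * alpha0"
      using mult_less_cancel_right_pos[of "1 + alpha0" "x * alpha0" y] mult_le_cancel_right_pos[of "1 + alpha0" "x * alpha0" y]
      unfolding x y by simp_all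
  qed
  from th show ?thesis
  proof
    assume w: "\<forall>n. w n \<longleftrightarrow> \<lfloor>(of_int n + 1) * alpha0 + \<theta>\<rfloor> \<noteq> \<lfloor>of_int n * alpha0 + \<theta>\<rfloor>"
    let ?F = "\<lambda>n::int. \<lfloor>of_int n * alpha0 + \<theta>\<rfloor>"
    \<comment> \<open>The new intercept is (j + 1 - \<theta>)(1 + alpha0) - j - 1 at j = 0. The
      strict inequality for the floor is what produces a ceiling for \<open>?G\<close>.\<close>
    define \<theta>' where "\<theta>' = alpha0 - \<theta> - alpha0 * \<theta>"
    let ?G = "\<lambda>n::int. \<lceil>of_int n * alpha0 + \<theta>'\<rceil>"
    have "desubst w (\<lambda>j. ?G (j + 1) \<noteq> ?G j) (\<lambda>j. j + ?G j)"
    proof (rule desubst_counting[where F = ?F])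
      fix n j :: int
      have "?F n \<le> j \<longleftrightarrow> of_int n * alpha0 < of_int j + 1 - \<theta>" by linarith
      also have "\<dots> \<longleftrightarrow> of_int n - of_int j - 1 < of_int j * alpha0 + \<theta>'"
        unfolding div(1) \<theta>'_def by (simp add: algebra_simps)
      also have "\<dots> \<longleftrightarrow> n \<le> j + ?G j" by linarith
      finally show "?F n \<le> j \<longleftrightarrow> n \<le> j + ?G j" .
    qed (use w fl ce in auto)
    moreover have "sturmian (\<lambda>j. ?G (j + 1) \<noteq> ?G j)"
      unfolding sturmian_def by (rule exI[of _ \<theta>']) simp
    ultimately show ?thesis by blast
  next
    assume w: "\<forall>n. w n \<longleftrightarrow> \<lceil>(of_int n + 1) * alpha0 + \<theta>\<rceil> \<noteq> \<lceil>of_int n * alpha0 + \<theta>\<rceil>"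
    let ?F = "\<lambda>n::int. \<lceil>of_int n * alpha0 + \<theta>\<rceil>"
    define \<theta>' where "\<theta>' = - \<theta> - alpha0 * \<theta>"
    let ?G = "\<lambda>n::int. \<lfloor>of_int n * alpha0 + \<theta>'\<rfloor>"
    have "desubst w (\<lambda>j. ?G (j + 1) \<noteq> ?G j) (\<lambda>j. j + ?G j)"
    proof (rule desubst_counting[where F = ?F])
      fix n j :: int
      have "?F n \<le> j \<longleftrightarrow> of_int n * alpha0 \<le> of_int j - \<theta>" by linarith
      also have "\<dots> \<longleftrightarrow> of_int n - of_int j \<le> of_int j * alpha0 + \<theta>'"
        unfolding div(2) \<theta>'_def by (auto simp: algebra_simps)
      also have "\<dots> \<longleftrightarrow> n \<le> j + ?G j" by linarith
      finally show "?F n \<le> j \<longleftrightarrow> n \<le> j + ?G j" .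
    qed (use w fl ce in auto)
    moreover have "sturmian (\<lambda>j. ?G (j + 1) \<noteq> ?G j)"
      unfolding sturmian_def by (rule exI[of _ \<theta>']) simp
    ultimately show ?thesis by blast
  qed
qed

lemma desubst_sequence:
  assumes "sturmian w"
  obtains W :: "nat \<Rightarrow> int \<Rightarrow> bool" and c :: "nat \<Rightarrow> int \<Rightarrow> int"
  where "W 0 = w" "\<And>i. desubst (W i) (W (Suc i)) (c i)"
proof -
  have "\<exists>f. \<forall>n. (sturmian (f n) \<and> (n = 0 \<longrightarrow> f n = w)) \<and> (\<exists>c. desubst (f n) (f (Suc n)) c)"
    by (rule dependent_nat_choice) (use assms sturmian_desubst in blast)+
  then obtain W where W: "W 0 = w" "\<And>i. \<exists>c. desubst (W i) (W (Suc i)) c" by blast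
  from W(2) obtain c where "\<And>i. desubst (W i) (W (Suc i)) (c i)" by metis
  with W(1) that show thesis by blast
qed

section \<open>Blocks of all levels and their repetitions\<close>

locale fib_hierarchy =
  fixes W :: "nat \<Rightarrow> int \<Rightarrow> bool" and c :: "nat \<Rightarrow> int \<Rightarrow> int"
  assumes desubst: "desubst (W i) (W (Suc i)) (c i)"
begin

text \<open>The site at which the block of the \<open>j\<close>-th letter of level \<open>i\<close>
  begins in the original sequence; \<open>blen\<close> gives the lengths of these blocks.\<close>

fun cut :: "nat \<Rightarrow> int \<Rightarrow> int" where
  "cut 0 j = j"
| "cut (Suc i) j = cut i (c i j)"

definition blen :: "nat \<Rightarrow> bool \<Rightarrow> nat" where
  "blen i b = (if b then fib (i + 2) else fib (i + 1))"

definition agree :: "int \<Rightarrow> int \<Rightarrow> nat \<Rightarrow> bool" where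
  "agree p p' l \<longleftrightarrow> (\<forall>k<l. W 0 (p + int k) = W 0 (p' + int k))"

lemma W_c: "W i (c i j)" and c_True: "W (Suc i) j \<Longrightarrow> c i (j + 1) = c i j + 2"
  and W_c_True: "W (Suc i) j \<Longrightarrow> \<not> W i (c i j + 1)"
  and c_False: "\<not> W (Suc i) j \<Longrightarrow> c i (j + 1) = c i j + 1"
  using desubst[of i] by (auto simp: desubst_def split: if_splits)

lemma cut_Suc: "cut i (j + 1) = cut i j + int (blen i (W i j))"
proof (induction i arbitrary: j)
  case 0 then show ?case by (simp add: blen_def)
next
  case (Suc i)
  show ?case
  proof (cases "W (Suc i) j")
    case True
    have "cut (Suc i) (j + 1) = cut i (c i j + 1 + 1)" using c_True[OF True] by (simp add: add.assoc)
    also have "\<dots> = cut i (c i j) + int (fib (i + 2)) + int (fib (i + 1))"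
      by (simp only: Suc.IH) (simp add: blen_def W_c W_c_True[OF True])
    finally show ?thesis using True by (simp add: blen_def)
  next
    case False
    then show ?thesis using c_False[OF False] Suc.IH[of "c i j"] by (simp add: blen_def W_c)
  qed
qed

lemma blen_pos: "0 < blen i b"
  by (simp add: blen_def fib_neq_0_nat)

end

lemma int_step_between:
  fixes f :: "int \<Rightarrow> int"
  assumes "\<And>j. f j + 1 \<le> f (j + 1)"
  shows "\<exists>j. f j \<le> n \<and> n < f (j + 1)"
proof (rule ccontr)
  assume "\<not> ?thesis"
  then have step: "f j \<le> n \<Longrightarrow> f (j + 1) \<le> n" for j by (meson linorder_not_le)
  have up: "f a + (b - a) \<le> f b" if "a \<le> b" for a b
    using that by (induction b rule: int_ge_induct) (use assms in \<open>smt (verit)\<close>)+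
  define a where "a = min 0 (n - f 0)"
  have a: "f a \<le> n" using up[of a 0] by (auto simp: a_def)
  have "f b \<le> n" if "a \<le> b" for b
    using that by (induction b rule: int_ge_induct) (use a step in auto)
  moreover have "n < f (a + (n - f a + 1))" using up[of a "a + (n - f a + 1)"] a by simp
  ultimately show False using a by (smt (verit))
qed

context fib_hierarchy
begin

lemma c_step: "c i j + 1 \<le> c i (j + 1)"
  using c_True[of i j] c_False[of i j] by (cases "W (Suc i) j") auto

lemma cut_step: "cut i j + 1 \<le> cut i (j + 1)"
  using cut_Suc[of i j] blen_pos[of i "W i j"] by simp

lemma locate: obtains j where "cut i j \<le> n" "n < cut i (j + 1)"
  using int_step_between[of "cut i" n] cut_step by blast

lemma strict_mono_step:
  fixes f :: "int \<Rightarrow> int"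
  assumes "\<And>j. f j + 1 \<le> f (j + 1)" and "a \<le> b"
  shows "f a + (b - a) \<le> f b"
  using assms(2) by (induction b rule: int_ge_induct) (use assms(1) in \<open>smt (verit)\<close>)+

lemma c_mono: "a \<le> b \<Longrightarrow> c i a + (b - a) \<le> c i b"
  by (rule strict_mono_step[of "c i", OF c_step])

lemma cut_mono: "a \<le> b \<Longrightarrow> cut i a + (b - a) \<le> cut i b"
  by (rule strict_mono_step[of "cut i", OF cut_step])

lemma parent:
  obtains (start) j' where "j = c i j'"
  | (middle) j' where "j = c i j' + 1" "W (Suc i) j'" "\<not> W i j" "c i (j' + 1) = j + 1"
proof -
  obtain j' where j': "c i j' \<le> j" "j < c i (j' + 1)"
    using int_step_between[of "c i" j] c_step by blast
  show thesis
  proof (cases "j = c i j'")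
    case False
    then have "W (Suc i) j'" using j' c_False[of i j'] by fastforce
    moreover from this have "c i (j' + 1) = c i j' + 2" by (rule c_True)
    ultimately show thesis using j' False middle[of j'] W_c_True[of i j']
      by (smt (verit, best))
  qed (rule start)
qed

lemma parent_True:
  assumes "W i j"
  obtains j' where "j = c i j'" "W (Suc i) j' \<longleftrightarrow> \<not> W i (j + 1)"
proof (cases j i rule: parent)
  case (start j')
  show thesis
  proof (rule that[OF start])
    show "W (Suc i) j' \<longleftrightarrow> \<not> W i (j + 1)"
      using W_c_True[of i j'] c_False[of i j'] W_c[of i "j' + 1"] start by metis
  qed
qed (use assms in auto)

lemma parent_False:
  assumes "\<not> W i j"
  obtains j' where "j = c i j' + 1" "W (Suc i) j'"
  by (cases j i rule: parent) (use assms W_c that in auto)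

lemma agree_mono: "agree p p' l \<Longrightarrow> k \<le> l \<Longrightarrow> agree p p' k"
  by (auto simp: agree_def)

lemma agree_append:
  assumes "agree p p' a" "agree (p + int a) (p' + int a) b"
  shows "agree p p' (a + b)"
  unfolding agree_def
proof (intro allI impI)
  fix k assume k: "k < a + b"
  show "W 0 (p + int k) = W 0 (p' + int k)"
  proof (cases "k < a")
    case False
    then have "k - a < b" "int k = int a + int (k - a)" using k by auto
    with assms(2) show ?thesis unfolding agree_def by (metis add.assoc)
  qed (use assms in \<open>auto simp: agree_def\<close>)
qed

lemma agree_block: "W i j = W i j' \<Longrightarrow> agree (cut i j) (cut i j') (blen i (W i j))"
proof (induction i arbitrary: j j')
  case 0 then show ?case by (simp add: agree_def blen_def)
next
  case (Suc i)
  have 1: "agree (cut i (c i j)) (cut i (c i j')) (fib (i + 2))"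
    using Suc.IH[of "c i j" "c i j'"] by (simp add: W_c blen_def)
  show ?case
  proof (cases "W (Suc i) j")
    case True
    then have "\<not> W i (c i j + 1)" "\<not> W i (c i j' + 1)" using Suc.prems W_c_True by auto
    then have "agree (cut i (c i j + 1)) (cut i (c i j' + 1)) (fib (i + 1))"
      using Suc.IH[of "c i j + 1" "c i j' + 1"] by (simp add: blen_def)
    then have "agree (cut i (c i j) + int (fib (i + 2))) (cut i (c i j') + int (fib (i + 2))) (fib (i + 1))"
      by (simp add: cut_Suc W_c blen_def)
    from agree_append[OF 1 this] show ?thesis using True by (simp add: blen_def)
  qed (use 1 in \<open>simp add: blen_def\<close>)
qed

text \<open>Concatenating Fibonacci words in different orders only affects the last two letters.\<close>

lemma agree_cuts: "agree (cut i j) (cut i j') (fib (i + 3) - 2)"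
proof (induction i arbitrary: j j')
  case 0 show ?case by (simp add: agree_def numeral_3_eq_3)
next
  case (Suc i)
  have 1: "agree (cut i (c i j)) (cut i (c i j')) (fib (i + 2))"
    using agree_block[of i "c i j" "c i j'"] by (simp add: W_c blen_def)
  have "agree (cut i (c i j) + int (fib (i + 2))) (cut i (c i j') + int (fib (i + 2))) (fib (i + 3) - 2)"
    using Suc.IH[of "c i j + 1" "c i j' + 1"] by (simp add: cut_Suc W_c blen_def)
  from agree_append[OF 1 this]
  have 2: "agree (cut (Suc i) j) (cut (Suc i) j') (fib (i + 2) + (fib (i + 3) - 2))" by simp
  have "2 \<le> fib (i + 3)" using fib_mono[of 3 "i + 3"] by (simp add: numeral_3_eq_3)
  moreover have "fib (Suc i + 3) = fib (i + 3) + fib (i + 2)" by (simp add: numeral_3_eq_3)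
  ultimately have "fib (Suc i + 3) - 2 = fib (i + 2) + (fib (i + 3) - 2)" by linarith
  with 2 show ?case by simp
qed

text \<open>Which Fibonacci word the block is. A letter 1 on level \<open>i\<close> and a letter 0
  on level \<open>i + 1\<close> have the same block, hence the same index.\<close>

definition index :: "nat \<Rightarrow> int \<Rightarrow> nat" where
  "index i j = (if W i j then i + 1 else i)"

lemma blen_index: "blen i (W i j) = fib (index i j + 1)"
  by (simp add: index_def blen_def)

lemma agree_shift:
  "agree (cut i j) (cut i j + int (fib (index i j + 1))) (fib (i + 3) - 2)"
  "W i j = W i (j + 1) \<Longrightarrow>
     agree (cut i j) (cut i j + int (fib (index i j + 1))) (fib (index i j + 1) + (fib (i + 3) - 2))"
proof -
  have e: "cut i j + int (fib (index i j + 1)) = cut i (j + 1)" by (simp add: cut_Suc blen_index)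
  show "agree (cut i j) (cut i j + int (fib (index i j + 1))) (fib (i + 3) - 2)"
    unfolding e by (rule agree_cuts)
  assume w: "W i j = W i (j + 1)"
  then have "index i (j + 1) = index i j" by (simp add: index_def)
  then have e2: "cut i (j + 1) + int (fib (index i j + 1)) = cut i (j + 1 + 1)"
    using cut_Suc[of i "j + 1"] by (simp add: blen_index)
  have 1: "agree (cut i j) (cut i (j + 1)) (fib (index i j + 1))"
    using agree_block[OF w] by (simp add: blen_index)
  have 2: "agree (cut i j + int (fib (index i j + 1))) (cut i (j + 1) + int (fib (index i j + 1))) (fib (i + 3) - 2)"
    unfolding e e2 by (rule agree_cuts)
  show "agree (cut i j) (cut i j + int (fib (index i j + 1))) (fib (index i j + 1) + (fib (i + 3) - 2))"
    unfolding e by (rule agree_append[OF 1 2])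
qed

lemma fib_values:
  "fib (i + 2) = fib (i + 1) + fib i" "fib (i + 3) = 2 * fib (i + 1) + fib i"
  "fib (i + 4) = 3 * fib (i + 1) + 2 * fib i" "fib (i + 5) = 5 * fib (i + 1) + 3 * fib i"
  "fib (i + 6) = 8 * fib (i + 1) + 5 * fib i" "0 < fib (i + 1)" "fib i \<le> fib (i + 1)"
  by (simp_all add: eval_nat_numeral fib_neq_0_nat fib_mono)

text \<open>For each of the \<rho> sites from \<open>m\<close> on, the window of length
  \<open>q = fib (index i' j + 1)\<close> starting there is repeated at once. The -1 appears because
  the last of these windows starts at \<open>m + \<rho> - 1\<close>. The agreement begins at the
  cut, not at \<open>m\<close>, so that traces can be carried from the block to the windows. All
  squares fit into \<open>fib (i + 6)\<close> sites; the last case of the proof does not fit into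
  \<open>fib (i + 5)\<close>.\<close>

lemma squares_from:
  obtains i' j \<rho> where "i \<le> index i' j" "fib i \<le> \<rho>" "\<rho> \<le> fib (index i' j + 1)"
    "2 * fib (index i' j + 1) + \<rho> \<le> fib (i + 6)" "cut i' j \<le> m"
    "agree (cut i' j) (cut i' j + int (fib (index i' j + 1))) (nat (m - cut i' j) + \<rho> + fib (index i' j + 1) - 1)"
proof -
  note F = fib_values[of i]
  obtain j where j: "cut i j \<le> m" "m < cut i (j + 1)" by (rule locate)
  then have o: "nat (m - cut i j) < fib (index i j + 1)" by (simp add: cut_Suc blen_index)
  show thesis
  proof (cases "W i j")
    case False
    then have q: "index i j = i" by (simp add: index_def)
    show thesis
      by (rule that[of i j "fib i"])
        (use j F q o agree_mono[OF agree_shift(1)[of i j, unfolded q], of "nat (m - cut i j) + fib i + fib (i + 1) - 1"]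
          in \<open>auto simp: eval_nat_numeral\<close>)
  next
    case True
    then have q: "index i j = i + 1" by (simp add: index_def)
    show thesis
    proof (cases "W i (j + 1)")
      case T2: True
      show thesis
        by (rule that[of i j "fib (i + 1)"])
          (use j F q T2 True o agree_mono[OF agree_shift(2)[of i j, unfolded q], of "nat (m - cut i j) + fib (i + 1) + fib (i + 2) - 1"]
            in \<open>auto simp: eval_nat_numeral\<close>)
    next
      \<comment> \<open>The pattern 10 has no short period to offer, but it is the image of a letter
        1 one level up, whose block starts at the same cut. The longer period of that level is used
        instead.\<close>
      case False
      obtain j' where j': "j = c i j'" "W (Suc i) j'" using parent_True[OF True] False by auto
      have q1: "index (i + 1) j' = i + 2" using j' by (simp add: index_def)
      have c1: "cut (i + 1) j' = cut i j" using j' by simp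
      show thesis
      proof (cases "W (i + 1) (j' + 1)")
        case T3: True
        have e: "fib (i + 1 + 3) = fib (i + 4)" by (simp add: eval_nat_numeral)
        have "agree (cut i j) (cut i j + int (fib (i + 3))) (fib (i + 3) + (fib (i + 4) - 2))"
          using agree_shift(2)[of "i + 1" j'] T3 j'(2) unfolding q1 c1 e by (simp add: eval_nat_numeral)
        then have "agree (cut i j) (cut i j + int (fib (i + 3))) (nat (m - cut i j) + fib (i + 2) + fib (i + 3) - 1)"
          by (rule agree_mono) (use o F in \<open>simp add: q eval_nat_numeral\<close>)
        then show thesis
          using that[of "i + 1" j' "fib (i + 2)", unfolded q1 c1] j F by (auto simp: eval_nat_numeral)
      next
        case F3: False
        obtain j'' where j'': "j' = c (Suc i) j''" "W (Suc (Suc i)) j''"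
          using parent_True[of "Suc i" j'] j'(2) F3 by auto
        have q2: "index (i + 2) j'' = i + 3" using j'' by (simp add: index_def eval_nat_numeral)
        have c2: "cut (i + 2) j'' = cut i j" using j' j'' by (simp add: eval_nat_numeral)
        have e: "fib (i + 2 + 3) = fib (i + 5)" by (simp add: eval_nat_numeral)
        \<comment> \<open>No further case split arises: the offset is at most
          \<open>fib (i + 2) - 1\<close>, and adding \<open>fib (i + 1) + fib (i + 4) - 1\<close>
          gives exactly \<open>fib (i + 5) - 2\<close>.\<close>
        have "agree (cut i j) (cut i j + int (fib (i + 4))) (fib (i + 5) - 2)"
          using agree_shift(1)[of "i + 2" j''] unfolding q2 c2 e by (simp add: eval_nat_numeral)
        then have "agree (cut i j) (cut i j + int (fib (i + 4))) (nat (m - cut i j) + fib (i + 1) + fib (i + 4) - 1)"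
          by (rule agree_mono) (use o F in \<open>simp add: q eval_nat_numeral\<close>)
        then show thesis
          using that[of "i + 2" j'' "fib (i + 1)", unfolded q2 c2] j F by (auto simp: eval_nat_numeral)
      qed
    qed
  qed
qed

text \<open>The block before the one containing \<open>n\<close> supplies the period. Agreement from
  its start up to \<open>n'\<close> makes the window ending at \<open>n'\<close> equal to the one
  starting there.\<close>

lemma centre_of_square_True:
  assumes "W i j" "cut i j \<le> n" "n < cut i (j + 1)" "1 \<le> i"
  obtains j' n' where "index i j' \<in> {i, i + 1}" "n' \<in> {n, n - 1}" "cut i j' \<le> n' - int (fib (index i j' + 1))"
    "agree (cut i j') (cut i j' + int (fib (index i j' + 1))) (nat (n' - cut i j'))"
proof -
  note F = fib_values[of i]
  have f: "1 \<le> fib i" using assms(4) by (simp add: Suc_leI fib_neq_0_nat)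
  have cj: "cut i j = cut i (j - 1) + int (fib (index i (j - 1) + 1))"
    using cut_Suc[of i "j - 1"] by (simp add: blen_index)
  have o: "n < cut i j + int (fib (i + 2))" using assms by (simp add: cut_Suc blen_def)
  show thesis
  proof (cases "W i (j - 1)")
    case True
    then have q: "index i (j - 1) = i + 1" by (simp add: index_def)
    have "agree (cut i (j - 1)) (cut i (j - 1) + int (fib (index i (j - 1) + 1))) (nat (n - cut i (j - 1)))"
      by (rule agree_mono[OF agree_shift(2)[of i "j - 1"]])
        (use True assms F o cj in \<open>auto simp: q eval_nat_numeral\<close>)
    then show thesis using that[of "j - 1" n] cj assms q by auto
  next
    case False
    then have q: "index i (j - 1) = i" by (simp add: index_def)
    define n' where "n' = (if n = cut i j + int (fib (i + 2)) - 1 then n - 1 else n)"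
    have n': "cut i j \<le> n'" "n' + 2 \<le> cut i j + int (fib (i + 2))"
      using assms(2) o F(1,6) f by (auto simp: n'_def)
    have "agree (cut i (j - 1)) (cut i (j - 1) + int (fib (index i (j - 1) + 1))) (nat (n' - cut i (j - 1)))"
      by (rule agree_mono[OF agree_shift(1)[of i "j - 1"]])
        (use n' F cj in \<open>auto simp: q\<close>)
    moreover have "n' \<in> {n, n - 1}" by (simp add: n'_def)
    ultimately show thesis using that[of "j - 1" n'] cj n' q by auto
  qed
qed

text \<open>A site in the block of a letter 0 also lies in the block of the parent letter 1, one
  level up.\<close>

lemma centre_of_square:
  assumes "1 \<le> i"
  obtains i' j n' where "index i' j \<in> {i, i + 1, i + 2}" "n' \<in> {n, n - 1}"
    "cut i' j \<le> n' - int (fib (index i' j + 1))"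
    "agree (cut i' j) (cut i' j + int (fib (index i' j + 1))) (nat (n' - cut i' j))"
proof -
  obtain j where j: "cut i j \<le> n" "n < cut i (j + 1)" by (rule locate)
  show thesis
  proof (cases "W i j")
    case True
    from centre_of_square_True[OF this j assms] that show thesis by (metis insertCI insertE)
  next
    case False
    then obtain j' where j': "j = c i j' + 1" "W (Suc i) j'" by (rule parent_False)
    have 1: "cut (Suc i) j' \<le> n" using j' j(1) cut_step[of i "c i j'"] by simp
    have "cut (Suc i) (j' + 1) = cut i (j + 1)" using c_True[OF j'(2)] j'(1) by (simp add: algebra_simps)
    then have 2: "n < cut (Suc i) (j' + 1)" using j by simp
    have "1 \<le> Suc i" by simp
    from centre_of_square_True[OF j'(2) 1 2 this] that show thesis
      by (metis Suc_eq_plus1 add_2_eq_Suc' insertCI insertE)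
  qed
qed

end

subsection \<open>Traces\<close>

text \<open>Completing the square in the invariant gives (x - ab/2)^2 = V^2 + (4 - a^2)(4 - b^2)/4.
  With P = |ab|, the inequality 2P \<le> a^2 + b^2 bounds the right side by V^2 + (2 - P/2)^2, which
  is at most (V + 2 - P/2)^2.\<close>

lemma trace_bound_from_invariant:
  fixes a b x V :: real
  assumes inv: "x\<^sup>2 + a\<^sup>2 + b\<^sup>2 - a * b * x = 4 + V\<^sup>2" and "\<bar>a\<bar> \<le> 2" "\<bar>b\<bar> \<le> 2" "0 \<le> V"
  shows "\<bar>x\<bar> \<le> 2 + V"
proof (rule ccontr)
  assume x: "\<not> \<bar>x\<bar> \<le> 2 + V"
  define P where "P = \<bar>a * b\<bar>"
  have P4: "P \<le> 4" using mult_mono[OF assms(2,3)] by (simp add: P_def abs_mult)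
  have "(\<bar>a\<bar> - \<bar>b\<bar>)\<^sup>2 \<ge> 0" by simp
  then have ab: "2 * P \<le> a\<^sup>2 + b\<^sup>2" by (simp add: P_def abs_mult power2_eq_square algebra_simps flip: abs_mult)
  have "2 + V - P / 2 < \<bar>x - a * b / 2\<bar>" using x unfolding P_def by linarith
  then have "(2 + V - P / 2)\<^sup>2 < \<bar>x - a * b / 2\<bar>\<^sup>2"
    using P4 assms(4) by (intro power_strict_mono) auto
  also have "\<dots> = V\<^sup>2 + 4 - (a\<^sup>2 + b\<^sup>2) + (a * b)\<^sup>2 / 4"
    using inv by (simp add: power2_eq_square field_simps)
  also have "\<dots> \<le> V\<^sup>2 + 4 - 2 * P + P\<^sup>2 / 4" using ab by (simp add: P_def)
  also have "\<dots> = V\<^sup>2 + (2 - P / 2)\<^sup>2" by (simp add: power2_eq_square field_simps)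
  also have "\<dots> \<le> (2 + V - P / 2)\<^sup>2"
  proof -
    have "0 \<le> V * (2 - P / 2)" using P4 assms(4) by simp
    then show ?thesis by (simp add: power2_eq_square field_simps)
  qed
  finally show False by simp
qed

text \<open>The recursion conserves the cubic expression in \<open>inv0\<close>, the Fricke-Vogt
  invariant. If no two neighbours after \<open>y 0\<close> both exceed 2 in modulus, every large
  value sits between two small ones and the invariant bounds it; otherwise products of neighbours
  dominate the subtracted term and the sequence escapes.\<close>

lemma trace_map_alternative:
  fixes y :: "nat \<Rightarrow> real"
  assumes rec: "\<And>i. y (i + 3) = y (i + 2) * y (i + 1) - y i"
    and inv0: "(y 0)\<^sup>2 + (y 1)\<^sup>2 + (y 2)\<^sup>2 - y 0 * y 1 * y 2 = 4 + V\<^sup>2"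
    and y0: "\<bar>y 0\<bar> \<le> 2" and V: "0 \<le> V"
  shows "(\<forall>i. \<bar>y i\<bar> \<le> 2 + V) \<or> (\<forall>B. \<exists>i0. \<forall>i\<ge>i0. B \<le> \<bar>y i\<bar>)"
proof (cases "\<exists>n. 2 < \<bar>y (n + 1)\<bar> \<and> 2 < \<bar>y (n + 2)\<bar>")
  case False
  have inv: "(y i)\<^sup>2 + (y (i + 1))\<^sup>2 + (y (i + 2))\<^sup>2 - y i * y (i + 1) * y (i + 2) = 4 + V\<^sup>2" for i
  proof (induction i)
    case 0 then show ?case using inv0 by (simp add: numeral_2_eq_2)
  next
    case (Suc i)
    have "Suc i = i + 1" "Suc i + 1 = i + 2" "Suc i + 2 = i + 3" by simp_all
    then show ?case unfolding \<open>Suc i + 1 = i + 2\<close> \<open>Suc i + 2 = i + 3\<close> rec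
      using Suc by (simp add: power2_eq_square algebra_simps)
  qed
  have "\<bar>y i\<bar> \<le> 2 + V" for i
  proof (cases i)
    case 0 then show ?thesis using y0 V by simp
  next
    case (Suc k)
    show ?thesis
    proof (cases "\<bar>y (k + 1)\<bar> \<le> 2")
      case True then show ?thesis using Suc V by simp
    next
      case F: False
      have "\<bar>y k\<bar> \<le> 2"
      proof (cases k)
        case (Suc l)
        then have "\<bar>y (l + 1)\<bar> \<le> 2 \<or> \<bar>y (l + 2)\<bar> \<le> 2" using False by (meson linorder_not_le)
        then show ?thesis using F Suc by simp
      qed (use y0 in simp)
      moreover have "\<bar>y (k + 2)\<bar> \<le> 2" using False F by (meson linorder_not_le)
      ultimately have "\<bar>y (k + 1)\<bar> \<le> 2 + V"
        by (intro trace_bound_from_invariant[of _ "y k" "y (k + 2)"]) (use inv[of k] V in \<open>auto simp: algebra_simps\<close>)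
      then show ?thesis using Suc by simp
    qed
  qed
  then show ?thesis by blast
next
  case True
  \<comment> \<open>Minimality makes the value just before the pair at most 2 in modulus. So
    \<open>y (n + 2)\<close> already exceeds \<open>y n\<close> in modulus, which is what
    \<open>step\<close> requires to start the escape.\<close>
  define n where "n = (LEAST n. 2 < \<bar>y (n + 1)\<bar> \<and> 2 < \<bar>y (n + 2)\<bar>)"
  have n: "2 < \<bar>y (n + 1)\<bar>" "2 < \<bar>y (n + 2)\<bar>" using LeastI_ex[OF True] by (auto simp: n_def)
  have yn: "\<bar>y n\<bar> \<le> 2"
  proof (cases n)
    case (Suc l)
    then have "\<not> (2 < \<bar>y (l + 1)\<bar> \<and> 2 < \<bar>y (l + 2)\<bar>)" using not_less_Least[of l "\<lambda>n. 2 < \<bar>y (n + 1)\<bar> \<and> 2 < \<bar>y (n + 2)\<bar>"] by (simp add: n_def)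
    then show ?thesis using n Suc by auto
  qed (use y0 in simp)
  have step: "\<bar>y (k + 2)\<bar> + \<bar>y (k + 2)\<bar> * (\<bar>y (k + 1)\<bar> - 2) < \<bar>y (k + 3)\<bar>" if "\<bar>y k\<bar> < \<bar>y (k + 2)\<bar>" for k
  proof -
    have "\<bar>y (k + 2)\<bar> * \<bar>y (k + 1)\<bar> - \<bar>y k\<bar> \<le> \<bar>y (k + 3)\<bar>"
      unfolding rec abs_mult[symmetric] by linarith
    with that show ?thesis by (simp add: algebra_simps)
  qed
  have esc: "2 < \<bar>y (n + k + 1)\<bar> \<and> 2 < \<bar>y (n + k + 2)\<bar> \<and> \<bar>y (n + k)\<bar> < \<bar>y (n + k + 2)\<bar>" for k
  proof (induction k)
    case 0 then show ?case using n yn by simp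
  next
    case (Suc k)
    let ?a = "\<bar>y (n + k + 1)\<bar>" and ?b = "\<bar>y (n + k + 2)\<bar>"
    have s: "?b + ?b * (?a - 2) < \<bar>y (n + k + 3)\<bar>" using step[of "n + k"] Suc by simp
    have "2 * (?a - 2) \<le> ?b * (?a - 2)" using Suc by (intro mult_right_mono) auto
    then have "?b + 2 * (?a - 2) < \<bar>y (n + k + 3)\<bar>" using s by linarith
    moreover from Suc have "2 < ?a" "2 < ?b" by auto
    ultimately have "2 < \<bar>y (n + k + 3)\<bar>" "?a < \<bar>y (n + k + 3)\<bar>" by simp_all
    then show ?case using Suc by (simp add: eval_nat_numeral)
  qed
  define z where "z k = \<bar>y (n + k + 1)\<bar>" for k
  have z2: "2 < z k" and zs: "z (k + 1) + z (k + 1) * (z k - 2) < z (k + 2)" for k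
    using esc[of k] step[of "n + k"] by (auto simp: z_def eval_nat_numeral)
  define d where "d = z 1 - 2"
  have d: "0 < d" using z2[of 1] by (simp add: d_def)
  have mono: "z (k + 1) \<le> z (k + 2)" for k
    using zs[of k] z2[of k] mult_nonneg_nonneg[of "z (k + 1)" "z k - 2"] z2[of "k + 1"] by linarith
  have zd: "2 + d \<le> z (k + 1)" for k
    by (induction k) (use mono in \<open>auto simp: d_def intro: order.trans\<close>)
  have grow: "2 + real k * (2 * d) \<le> z (k + 2)" for k
  proof (induction k)
    case 0 then show ?case using z2[of 2] by (simp add: eval_nat_numeral)
  next
    case (Suc k)
    have "2 * d \<le> z (k + 2) * (z (k + 1) - 2)"
      using z2[of "k + 2"] zd[of k] d by (intro mult_mono) auto
    then show ?case using Suc zs[of "k + 1"] by (simp add: algebra_simps eval_nat_numeral)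
  qed
  have "\<exists>i0. \<forall>i\<ge>i0. B \<le> \<bar>y i\<bar>" for B
  proof -
    obtain K :: nat where K: "B / (2 * d) < real K" using reals_Archimedean2 by blast
    show ?thesis
    proof (intro exI allI impI)
      fix i assume "n + K + 3 \<le> i"
      define k where "k = i - n - 3"
      have k: "K \<le> k" "i = n + (k + 2) + 1" using \<open>n + K + 3 \<le> i\<close> by (auto simp: k_def)
      have "B < real K * (2 * d)" using K d by (simp add: field_simps)
      also have "\<dots> \<le> real k * (2 * d)" using k d by (intro mult_right_mono) auto
      also have "\<dots> \<le> \<bar>y i\<bar>" using grow[of k] unfolding k z_def by simp
      finally show "B \<le> \<bar>y i\<bar>" by simp
    qed
  qed
  then show ?thesis by blast
qed

subsection \<open>Solutions of the difference equation\<close>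

text \<open>Variation of constants. The error made at site \<open>m + k\<close> is propagated from
  the next site on, so only words strictly shorter than \<open>l\<close> occur, as
  \<open>perturbed_solution_bound\<close> exploits.\<close>

lemma perturbed_solution:
  fixes U r :: "int \<Rightarrow> complex \<times> complex"
  assumes "\<And>n. U (n + 1) = act (X n) (U n) + r n"
  shows "U (m + int l) = act (fprod X m l) (U m) +
    (\<Sum>k<l. act (fprod X (m + int k + 1) (l - 1 - k)) (r (m + int k)))"
proof (induction l)
  case (Suc l)
  have "act (X (m + int l)) (\<Sum>k<l. act (fprod X (m + int k + 1) (l - 1 - k)) (r (m + int k)))
    = (\<Sum>k<l. act (fprod X (m + int k + 1) (l - k)) (r (m + int k)))"
    unfolding act_sum
  proof (rule sum.cong)
    fix k assume "k \<in> {..<l}"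
    then have "l - k = Suc (l - 1 - k)" "m + int k + 1 + int (l - 1 - k) = m + int l" by auto
    then show "act (X (m + int l)) (act (fprod X (m + int k + 1) (l - 1 - k)) (r (m + int k))) =
      act (fprod X (m + int k + 1) (l - k)) (r (m + int k))" by (simp add: act_mult)
  qed simp
  then show ?case
    using assms[of "m + int l"] Suc by (simp add: act_add act_mult add.assoc algebra_simps)
qed simp

lemma perturbed_solution_bound:
  fixes U r :: "int \<Rightarrow> complex \<times> complex"
  assumes "\<And>n. U (n + 1) = act (X n) (U n) + r n"
    and B: "\<And>m' l'. l' < l \<Longrightarrow> ns (fprod X m' l') \<le> B"
  shows "norm (U (m + int l) - act (fprod X m l) (U m)) \<le> B * (\<Sum>k<l. norm (r (m + int k)))"
proof -
  have "norm (U (m + int l) - act (fprod X m l) (U m)) =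
    norm (\<Sum>k<l. act (fprod X (m + int k + 1) (l - 1 - k)) (r (m + int k)))"
    by (simp add: perturbed_solution[of U X r, OF assms(1)])
  also have "\<dots> \<le> (\<Sum>k<l. B * norm (r (m + int k)))"
    by (intro sum_norm_le order.trans[OF norm_act] mult_right_mono B) auto
  finally show ?thesis by (simp add: sum_distrib_left)
qed

lemma act_trace:
  assumes "dt Y = 1"
  shows "tr Y *\<^sub>R p = act Y p + act (adj Y) p"
  by (simp add: adj_eq act_minus act_scaleR)

text \<open>By Cayley-Hamilton p = tr(Y) Yp - Y^2 p, so \<open>p\<close> cannot be large unless one
  of its two successors along a square is; Cauchy-Schwarz with weights \<open>t\<close> and 1 gives
  the constant.\<close>

lemma norm_square_step:
  assumes "dt Y = 1" "\<bar>tr Y\<bar> \<le> t"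
  shows "(norm p)\<^sup>2 \<le> (1 + t\<^sup>2) * ((norm (act Y p))\<^sup>2 + (norm (act Y (act Y p)))\<^sup>2)"
proof -
  let ?a = "norm (act Y p)" and ?b = "norm (act Y (act Y p))"
  have "tr Y *\<^sub>R act Y p = act Y (act Y p) + act (adj Y * Y) p"
    using act_trace[OF assms(1), of "act Y p"] by (simp add: act_mult)
  then have "p = tr Y *\<^sub>R act Y p - act Y (act Y p)"
    by (simp add: adj_mult assms(1))
  then have "norm p \<le> \<bar>tr Y\<bar> * ?a + ?b" by (metis norm_scaleR norm_triangle_ineq4)
  also have "\<dots> \<le> t * ?a + ?b" using assms(2) by (simp add: mult_right_mono)
  finally have "(norm p)\<^sup>2 \<le> (t * ?a + 1 * ?b)\<^sup>2" by (intro power_mono) auto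
  also have "\<dots> \<le> (t\<^sup>2 + 1\<^sup>2) * (?a\<^sup>2 + ?b\<^sup>2)"
  proof -
    have "0 \<le> (t * ?b - ?a)\<^sup>2" by simp
    then show ?thesis by (simp add: power2_eq_square algebra_simps)
  qed
  finally show ?thesis by (simp add: algebra_simps)
qed

section \<open>Transfer matrices along the sequence\<close>

locale transfer = fib_hierarchy +
  fixes S0 S1 :: m2
  assumes dt_S0: "dt S0 = 1" and dt_S1: "dt S1 = 1"
begin

definition X :: "int \<Rightarrow> m2" where "X n = (if W 0 n then S1 else S0)"

abbreviation M :: "nat \<Rightarrow> m2" where "M \<equiv> fibmat S0 S1"

definition XL :: "nat \<Rightarrow> int \<Rightarrow> m2" where "XL i j = M (index i j)"

lemma dt_X [simp]: "dt (X n) = 1"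
  by (simp add: X_def dt_S0 dt_S1)

lemma dt_M [simp]: "dt (M i) = 1"
  by (rule dt_fibmat[OF dt_S0 dt_S1])

lemma XL_0: "XL 0 = X"
  by (auto simp: XL_def X_def index_def)

lemma fprod_block: "fprod X (cut i j) (fib (index i j + 1)) = M (index i j)"
proof (induction i arbitrary: j)
  case 0 then show ?case by (simp add: X_def index_def)
next
  case (Suc i)
  have 1: "fprod X (cut i (c i j)) (fib (i + 2)) = M (Suc i)"
    using Suc.IH[of "c i j"] by (simp add: index_def W_c)
  show ?case
  proof (cases "W (Suc i) j")
    case True
    have "cut i (c i j + 1) = cut i (c i j) + int (fib (i + 2))" by (simp add: cut_Suc blen_def W_c)
    then have "fprod X (cut i (c i j) + int (fib (i + 2))) (fib (i + 1)) = M i"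
      using Suc.IH[of "c i j + 1"] by (simp add: index_def W_c_True[OF True])
    then have "fprod X (cut i (c i j)) (fib (i + 2) + fib (i + 1)) = M i * M (Suc i)"
      unfolding fprod_add 1 by simp
    then show ?thesis using True by (simp add: index_def)
  qed (use 1 in \<open>simp add: index_def\<close>)
qed

lemma agree_X: "agree p p' l \<Longrightarrow> k < l \<Longrightarrow> X (p + int k) = X (p' + int k)"
  by (simp add: agree_def X_def)

lemma fprod_agree: "agree p p' l \<Longrightarrow> fprod X p l = fprod X p' l"
  by (rule fprod_cong) (auto dest: agree_X)

lemma agree_drop:
  assumes "agree p p' (d + l)"
  shows "agree (p + int d) (p' + int d) l"
  using assms unfolding agree_def by (metis add.assoc add_less_cancel_left of_nat_add)

text \<open>The window is slid back to the cut. Each unit of sliding compares one letter with the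
  one a period later, so agreement is required only up to the start of the window.\<close>

lemma tr_in_run:
  assumes "cut i j \<le> m" "agree (cut i j) (cut i j + int (fib (index i j + 1))) (nat (m - cut i j))"
  shows "tr (fprod X m (fib (index i j + 1))) = tr (M (index i j))"
proof -
  have "tr (fprod X (cut i j + int (nat (m - cut i j))) (fib (index i j + 1))) =
    tr (fprod X (cut i j) (fib (index i j + 1)))"
    by (rule tr_fprod_shift) (use agree_X[OF assms(2)] in \<open>auto simp: algebra_simps\<close>)
  then show ?thesis using assms(1) by (simp only: fprod_block) simp
qed

subsection \<open>Every word is a product of few Fibonacci matrices\<close>

definition iprod :: "nat \<Rightarrow> int \<Rightarrow> int \<Rightarrow> m2" where "iprod i a b = fprod (XL i) a (nat (b - a))"

lemma iprod_append: "a \<le> b \<Longrightarrow> b \<le> e \<Longrightarrow> iprod i a e = iprod i b e * iprod i a b"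
  using fprod_add[of "XL i" a "nat (b - a)" "nat (e - b)"] by (simp add: iprod_def nat_add_distrib[symmetric])

lemma iprod_refl [simp]: "iprod i a a = 1"
  by (simp add: iprod_def)

lemma iprod_single [simp]: "iprod i a (a + 1) = XL i a"
  by (simp add: iprod_def)

lemma iprod_parent: "a \<le> b \<Longrightarrow> iprod i (c i a) (c i b) = iprod (Suc i) a b"
proof (induction b rule: int_ge_induct)
  case (step b)
  have "iprod i (c i b) (c i (b + 1)) = XL (Suc i) b"
  proof (cases "W (Suc i) b")
    case True
    have "iprod i (c i b) (c i b + 1 + 1) = iprod i (c i b + 1) (c i b + 1 + 1) * iprod i (c i b) (c i b + 1)"
      by (rule iprod_append) auto
    also have "\<dots> = M i * M (Suc i)" unfolding iprod_single
      by (simp add: XL_def index_def W_c W_c_True[OF True])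
    finally show ?thesis using True c_True[OF True] by (simp add: XL_def index_def add.assoc)
  next
    case False
    then show ?thesis using c_False[OF False] by (simp add: XL_def index_def W_c)
  qed
  then show ?case
    using step iprod_append[of "c i a" "c i b" "c i (b + 1)" i] iprod_append[of a b "b + 1" "Suc i"]
      c_mono[of a b i] c_step[of i b] by simp
qed simp

text \<open>Images are 10 or 1, so the left end can only cut off a 1, leaving a stray 0 with matrix
  \<open>M i\<close>, and the right end can only cut off a 0, leaving a stray 1 with matrix
  \<open>M (Suc i)\<close>. The facts about \<open>e\<close> record that the divided image was 10,
  so its letter just outside the window is 0.\<close>

lemma iprod_reduce:
  assumes "a < b"
  obtains k k' e f where
    "iprod i a b = (if e then M (Suc i) else 1) * iprod (Suc i) k k' * (if f then M i else 1)"
    "k \<le> k'" "a \<le> c i k" "c i k' \<le> b" "e \<Longrightarrow> W (Suc i) k'" "e \<Longrightarrow> \<not> W i b"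
proof -
  obtain k f where k: "iprod i a (c i k) = (if f then M i else 1)" "a \<le> c i k" "c i k \<le> a + 1"
  proof (cases a i rule: parent)
    case (start j')
    then show thesis by (intro that[of j' False]) auto
  next
    case (middle j')
    then show thesis using iprod_single[of i a]
      by (intro that[of "j' + 1" True]) (auto simp: XL_def index_def)
  qed
  obtain k' e where k': "iprod i (c i k') b = (if e then M (Suc i) else 1)" "c i k' \<le> b" "b < c i (k' + 1)"
    "e \<Longrightarrow> W (Suc i) k'" "e \<Longrightarrow> \<not> W i b"
  proof (cases b i rule: parent)
    case (start j')
    then show thesis using c_step[of i j'] by (intro that[of j' False]) auto
  next
    case (middle j')
    then show thesis by (intro that[of j' True]) (auto simp: XL_def index_def W_c)
  qed
  have "k \<le> k'"
  proof (rule ccontr)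
    assume "\<not> k \<le> k'"
    then have "c i (k' + 1) \<le> c i k" using c_mono[of "k' + 1" k i] by simp
    then show False using k k' assms by simp
  qed
  moreover from this have "c i k \<le> c i k'" using c_mono[of k k' i] by simp
  ultimately show thesis
    using that[of e k k' f] k k' iprod_append[of a "c i k" b i] iprod_append[of "c i k" "c i k'" b i]
      iprod_parent[of k k' i] by (simp add: mult.assoc)
qed

lemma incp_0: "incp N i 0 L \<Longrightarrow> L = 1"
  by (erule incp.cases) auto

text \<open>Each level passes its stray letters to the inner ends of \<open>L\<close> and
  \<open>R\<close>. The last disjunction keeps consecutive factors out of \<open>L\<close>: a stray
  1 on the right requires the next letter to be 0, so \<open>L\<close> has left its latest level
  empty; and after a stray 1 the next letter one level up is 1, so no stray 1 follows there.\<close>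

lemma word_decomposition:
  assumes "m \<le> n"
  shows "\<exists>L R a b. iprod 0 m n = L * iprod i a b * R \<and> a \<le> b \<and> incp M 1 i L \<and> decp M 0 i R \<and>
    (a < b \<longrightarrow> m \<le> cut i a \<and> cut i b \<le> n \<and> (W i b \<or> i = 0 \<or> incp M 1 (i - 1) L))"
proof (induction i)
  case 0
  show ?case by (rule exI[of _ 1], rule exI[of _ 1], rule exI[of _ m], rule exI[of _ n])
      (use assms in \<open>auto intro: incp.nil decp.nil\<close>)
next
  case (Suc i)
  then obtain L R a b where IH: "iprod 0 m n = L * iprod i a b * R" "a \<le> b" "incp M 1 i L" "decp M 0 i R"
    "a < b \<Longrightarrow> m \<le> cut i a \<and> cut i b \<le> n \<and> (W i b \<or> i = 0 \<or> incp M 1 (i - 1) L)" by blast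
  show ?case
  proof (cases "a < b")
    case False
    then have "iprod 0 m n = L * iprod (Suc i) a a * R" using IH by simp
    then show ?thesis using incp_extend_skip[OF IH(3)] decp_extend(1)[OF IH(4)] by blast
  next
    case True
    obtain k k' e f where k: "iprod i a b = (if e then M (Suc i) else 1) * iprod (Suc i) k k' * (if f then M i else 1)"
      "k \<le> k'" "a \<le> c i k" "c i k' \<le> b" "e \<Longrightarrow> W (Suc i) k'" "e \<Longrightarrow> \<not> W i b"
      using iprod_reduce[OF True] by metis
    note IH5 = IH(5)[OF True]
    define L' R' where "L' = L * (if e then M (Suc i) else 1)" and "R' = (if f then M i else 1) * R"
    have "iprod 0 m n = L' * iprod (Suc i) k k' * R'"
      unfolding IH(1) k(1) L'_def R'_def by (simp add: mult.assoc)
    moreover have "decp M 0 (Suc i) R'"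
      using decp_extend[OF IH(4)] by (auto simp: R'_def)
    moreover have "incp M 1 (Suc i) L'"
    proof (cases e)
      case True
      show ?thesis
      proof (cases i)
        case 0
        then have "L = 1" using IH(3) by (simp add: incp_0)
        then show ?thesis using incp.one[of M 1] True 0 by (simp add: L'_def)
      next
        case (Suc i')
        then have "incp M 1 (i - 1) L" using IH5 k(6) True by auto
        from incp_extend_take[OF this] show ?thesis using True Suc by (simp add: L'_def)
      qed
    qed (use incp_extend_skip[OF IH(3)] in \<open>simp add: L'_def\<close>)
    moreover have "m \<le> cut (Suc i) k" "cut (Suc i) k' \<le> n"
      using IH5 k cut_mono[of a "c i k" i] cut_mono[of "c i k'" b i] by auto
    moreover have "W (Suc i) k' \<or> incp M 1 (Suc i - 1) L'"
      using k(5) IH(3) by (cases e) (auto simp: L'_def)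
    ultimately show ?thesis using k(2) by blast
  qed
qed

text \<open>A block of level \<open>k\<close> has at least \<open>fib (k + 1)\<close> sites, so the
  middle product is empty.\<close>

lemma short_word:
  assumes "l < fib (k + 1)"
  obtains L R where "incp M 1 k L" "decp M 0 k R" "fprod X m l = L * R"
proof -
  obtain L R a b where *: "iprod 0 m (m + int l) = L * iprod k a b * R" "a \<le> b" "incp M 1 k L" "decp M 0 k R"
    "a < b \<longrightarrow> m \<le> cut k a \<and> cut k b \<le> m + int l"
    using word_decomposition[of m "m + int l" k] by auto
  have "\<not> a < b"
  proof
    assume ab: "a < b"
    have "cut k a + int (fib (k + 1)) \<le> cut k (a + 1)"
      using fib_mono[of "k + 1" "k + 2"] by (simp add: cut_Suc blen_def)
    also have "\<dots> \<le> cut k b" using cut_mono[of "a + 1" b k] ab by simp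
    finally show False using * ab assms by simp
  qed
  then show thesis using that[of L R] * by (simp add: iprod_def XL_0)
qed

text \<open>tr(Y) U(n) is the sum of Y U(n) and Y^-1 U(n), which are U(n + q) and U(n - q) up to the
  perturbation. The backward error is one forward error transported by the inverse, hence the term
  \<open>B * B\<close>.\<close>

lemma centre_trace_bound:
  fixes U r :: "int \<Rightarrow> complex \<times> complex"
  assumes U: "\<And>n. U (n + 1) = act (X n) (U n) + r n"
    and run: "cut i j \<le> n - int q" "agree (cut i j) (cut i j + int q) (nat (n - cut i j))" "q = fib (index i j + 1)"
    and B: "\<And>m' l'. l' \<le> q \<Longrightarrow> ns (fprod X m' l') \<le> B"
  shows "\<bar>tr (M (index i j))\<bar> * norm (U n) \<le> norm (U (n + int q)) + norm (U (n - int q))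
    + (B + B * B) * (\<Sum>k<2 * q. norm (r (n - int q + int k)))"
proof -
  let ?m = "n - int q"
  define Y where "Y = fprod X ?m q"
  have ag: "agree ?m n q"
  proof -
    have "nat (n - cut i j) = nat (?m - cut i j) + q" using run(1) by simp
    then have "agree (cut i j + int (nat (?m - cut i j))) (cut i j + int q + int (nat (?m - cut i j))) q"
      using run(2) by (intro agree_drop) simp
    then show ?thesis using run(1) by simp
  qed
  have Y': "fprod X n q = Y" using fprod_agree[OF ag] by (simp add: Y_def)
  have trY: "tr Y = tr (M (index i j))"
    unfolding Y_def run(3) by (rule tr_in_run) (use run in \<open>auto intro: agree_mono\<close>)
  have dY: "dt Y = 1" unfolding Y_def by (rule dt_fprod) simp
  have nY: "ns Y \<le> B" unfolding Y_def by (rule B) simp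
  have B0: "0 \<le> B" using nY ns_nonneg[of Y] by linarith
  let ?S1 = "\<Sum>k<q. norm (r (?m + int k))" and ?S2 = "\<Sum>k<q. norm (r (n + int k))"
  let ?e1 = "U n - act Y (U ?m)" and ?e2 = "U (n + int q) - act Y (U n)"
  have e1: "norm ?e1 \<le> B * ?S1"
    using perturbed_solution_bound[of U X r q B ?m, OF U] B by (simp add: Y_def)
  have e2: "norm ?e2 \<le> B * ?S2"
    using perturbed_solution_bound[of U X r q B n, OF U] B by (simp add: Y')
  have S: "?S1 + ?S2 = (\<Sum>k<2 * q. norm (r (?m + int k)))"
  proof -
    have "(\<Sum>k<q + q. norm (r (?m + int k))) = ?S1 + (\<Sum>k<q. norm (r (?m + int (q + k))))"
      by (simp only: sum.nat_group[symmetric] lessThan_atLeast0 sum.atLeastLessThan_concat[of 0 q "q + q", symmetric] le0 le_add1)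
        (simp add: sum.shift_bounds_nat_ivl[of _ 0 q q, simplified] add.commute)
    then show ?thesis unfolding mult_2 by (simp add: algebra_simps)
  qed
  have "tr Y *\<^sub>R U n = act Y (U n) + act (adj Y) (U n)" by (rule act_trace[OF dY])
  also have "act (adj Y) (U n) = act (adj Y * Y) (U ?m) + act (adj Y) ?e1"
    by (simp add: act_mult act_diff)
  also have "act (adj Y * Y) (U ?m) = U ?m" by (simp add: adj_mult dY)
  finally have "tr Y *\<^sub>R U n = U (n + int q) - ?e2 + (U ?m + act (adj Y) ?e1)" by simp
  then have "\<bar>tr Y\<bar> * norm (U n) = norm (U (n + int q) - ?e2 + (U ?m + act (adj Y) ?e1))"
    by (metis norm_scaleR)
  also have "\<dots> \<le> (norm (U (n + int q)) + norm ?e2) + (norm (U ?m) + norm (act (adj Y) ?e1))"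
    by (intro order.trans[OF norm_triangle_ineq] add_mono norm_triangle_ineq4 norm_triangle_ineq)
  also have "norm (act (adj Y) ?e1) \<le> B * (B * ?S1)"
    using nY e1 B0 by (intro order.trans[OF norm_act] mult_mono) auto
  finally have "\<bar>tr Y\<bar> * norm (U n) \<le> norm (U (n + int q)) + norm (U ?m) + (B * ?S2 + B * (B * ?S1))"
    using e2 by linarith
  also have "B * ?S2 + B * (B * ?S1) \<le> (B + B * B) * (?S1 + ?S2)"
    using B0 by (simp add: algebra_simps sum_nonneg)
  finally show ?thesis unfolding S trY by simp
qed

end

section \<open>Upper and lower growth bounds when traces are bounded\<close>

locale transfer_bounded = transfer + bounded_traces "fibmat S0 S1" t for t
begin

text \<open>The right end of the word costs \<open>1 + t\<close> per level and the left end
  \<open>3 / 2 * (t + 1)\<close>. The matrix \<open>M 2\<close> must be bounded too because the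
  increasing product starts at index 1.\<close>

lemma word_bound:
  assumes "l < fib (k + 1)" and s: "1 \<le> s" "ns (M 0) \<le> s" "ns (M 1) \<le> s" "ns (M 2) \<le> s"
  shows "ns (fprod X m l) \<le> 30 * (5 * t + 9) * s ^ 4 * (3 / 2 * (t + 1)\<^sup>2) ^ k"
proof -
  have s': "ns (M (Suc 0)) \<le> s" "ns (M (Suc 1)) \<le> s" using s by (simp_all add: eval_nat_numeral)
  obtain L R where LR: "incp M 1 k L" "decp M 0 k R" "fprod X m l = L * R"
    by (rule short_word[OF assms(1)])
  have "ns (fprod X m l) \<le> ns L * ns R" unfolding LR(3) by (rule ns_mult)
  also have "\<dots> \<le> (5 * s\<^sup>2 * (1 + t) ^ k) * (6 * (5 * t + 9) * s\<^sup>2 * (3 / 2 * (t + 1)) ^ k)"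
    using ns_incp[OF LR(1) s(3) s'(2) s(1)] ns_decp[OF LR(2) s(2) s'(1) s(1)] s t2
    by (intro mult_mono) (auto simp: ns_nonneg)
  also have "\<dots> = 30 * (5 * t + 9) * (s\<^sup>2 * s\<^sup>2) * ((1 + t) * (3 / 2 * (t + 1))) ^ k"
    by (simp only: power_mult_distrib mult_ac)
  also have "s\<^sup>2 * s\<^sup>2 = s ^ 4" by (simp flip: power_add)
  also have "(1 + t) * (3 / 2 * (t + 1)) = 3 / 2 * (t + 1)\<^sup>2" by (simp add: power2_eq_square algebra_simps)
  finally show ?thesis .
qed

definition mass :: "int \<Rightarrow> complex \<times> complex \<Rightarrow> nat \<Rightarrow> real" where
  "mass m p n = (\<Sum>j<n. (norm (act (fprod X m j) p))\<^sup>2)"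

lemma mass_mono: "k \<le> n \<Longrightarrow> mass m p k \<le> mass m p n"
  unfolding mass_def by (intro sum_mono2) auto

text \<open>Squares of length \<open>q\<close> transport the mass of the first \<rho> sites into the
  windows at \<open>q\<close> and \<open>2 * q\<close>. Since \<rho> \<le> q, these are disjoint
  from each other and from the first \<open>q\<close> sites, which already carry the mass of
  \<open>fib (i + 1)\<close> sites.\<close>

lemma mass_step: "mass m p (fib (i + 1)) + mass m p (fib i) / (1 + t\<^sup>2) \<le> mass m p (fib (i + 6))"
proof -
  obtain i' j \<rho> where sq: "i \<le> index i' j" "fib i \<le> \<rho>" "\<rho> \<le> fib (index i' j + 1)"
    "2 * fib (index i' j + 1) + \<rho> \<le> fib (i + 6)" "cut i' j \<le> m"
    "agree (cut i' j) (cut i' j + int (fib (index i' j + 1))) (nat (m - cut i' j) + \<rho> + fib (index i' j + 1) - 1)"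
    by (rule squares_from)
  define q where "q = fib (index i' j + 1)"
  let ?u = "\<lambda>j. (norm (act (fprod X m j) p))\<^sup>2"
  have step: "?u k \<le> (1 + t\<^sup>2) * (?u (k + q) + ?u (k + 2 * q))" if k: "k < \<rho>" for k
  proof -
    let ?x = "m + int k"
    define Y where "Y = fprod X ?x q"
    have run: "agree (cut i' j) (cut i' j + int q) (nat (?x - cut i' j) + q)"
      by (rule agree_mono[OF sq(6)[folded q_def]]) (use sq(5) k in auto)
    from agree_drop[OF run] have "agree ?x (?x + int q) q" using sq(5) by (simp add: algebra_simps)
    then have Y': "fprod X (?x + int q) q = Y" using fprod_agree by (simp add: Y_def)
    have "tr Y = tr (M (index i' j))"
      unfolding Y_def q_def
      by (rule tr_in_run) (use sq(5) agree_mono[OF run] in \<open>simp_all add: q_def\<close>)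
    then have trY: "\<bar>tr Y\<bar> \<le> t" using trace by simp
    have dY: "dt Y = 1" unfolding Y_def by (rule dt_fprod) simp
    have 1: "fprod X m (k + q) = Y * fprod X m k" by (simp add: fprod_add Y_def)
    have "fprod X m (k + q + q) = fprod X (m + int (k + q)) q * fprod X m (k + q)" by (rule fprod_add)
    moreover have "k + q + q = k + 2 * q" "m + int (k + q) = ?x + int q" by simp_all
    ultimately have 2: "fprod X m (k + 2 * q) = Y * (Y * fprod X m k)"
      by (simp only: Y' 1)
    show ?thesis unfolding 1 2 act_mult by (rule norm_square_step[OF dY trY])
  qed
  have "mass m p (fib i) \<le> mass m p \<rho>" by (rule mass_mono[OF sq(2)])
  also have "\<dots> \<le> (\<Sum>k<\<rho>. (1 + t\<^sup>2) * (?u (k + q) + ?u (k + 2 * q)))"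
    unfolding mass_def by (rule sum_mono) (use step in auto)
  also have "\<dots> = (1 + t\<^sup>2) * ((\<Sum>k<\<rho>. ?u (k + q)) + (\<Sum>k<\<rho>. ?u (k + 2 * q)))"
    by (simp add: sum_distrib_left[symmetric] sum.distrib)
  also have "\<dots> = (1 + t\<^sup>2) * (sum ?u {q..<q + \<rho>} + sum ?u {2 * q..<2 * q + \<rho>})"
    using sum.shift_bounds_nat_ivl[of ?u 0 q \<rho>] sum.shift_bounds_nat_ivl[of ?u 0 "2 * q" \<rho>]
    by (simp add: lessThan_atLeast0 add.commute)
  finally have "mass m p (fib i) / (1 + t\<^sup>2) \<le> sum ?u {q..<q + \<rho>} + sum ?u {2 * q..<2 * q + \<rho>}"
    by (simp add: divide_le_eq add_pos_nonneg mult.commute)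
  moreover have "mass m p (fib (i + 1)) \<le> sum ?u {..<q}"
    unfolding mass_def[symmetric] q_def by (rule mass_mono) (use sq(1) in \<open>auto intro: fib_mono\<close>)
  moreover have "sum ?u {..<q} + (sum ?u {q..<q + \<rho>} + sum ?u {2 * q..<2 * q + \<rho>}) \<le> mass m p (fib (i + 6))"
  proof -
    have "sum ?u {..<q} + (sum ?u {q..<q + \<rho>} + sum ?u {2 * q..<2 * q + \<rho>}) =
      sum ?u ({..<q} \<union> ({q..<q + \<rho>} \<union> {2 * q..<2 * q + \<rho>}))"
      using sq(3) unfolding q_def[symmetric] by (subst sum.union_disjoint; (subst sum.union_disjoint)?) auto
    also have "\<dots> \<le> mass m p (fib (i + 6))"
      unfolding mass_def using sq(4) unfolding q_def[symmetric] by (intro sum_mono2) auto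
    finally show ?thesis .
  qed
  ultimately show ?thesis by linarith
qed

text \<open>The hypothesis on \<Lambda> is the characteristic inequality of the recursion in
  \<open>mass_step\<close>.\<close>

lemma mass_growth:
  assumes "1 \<le> \<Lambda>" "\<Lambda> ^ 6 \<le> \<Lambda> + 1 / (1 + t\<^sup>2)"
  shows "\<Lambda> ^ (k + 1) * (norm p)\<^sup>2 \<le> \<Lambda> ^ 6 * mass m p (fib (k + 1))"
proof (induction k rule: less_induct)
  case (less k)
  show ?case
  proof (cases "k < 6")
    \<comment> \<open>The prefactor \<Lambda>^6 pays for the levels the recursion does not reach;
      there the mass at the first site suffices.\<close>
    case True
    have "0 < fib (k + 1)" by (simp add: fib_neq_0_nat)
    then have "1 \<le> fib (k + 1)" by simp
    then have "mass m p 1 \<le> mass m p (fib (k + 1))" by (rule mass_mono)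
    then have "(norm p)\<^sup>2 \<le> mass m p (fib (k + 1))" by (simp add: mass_def)
    moreover have "\<Lambda> ^ (k + 1) \<le> \<Lambda> ^ 6" using True assms(1) by (intro power_increasing) auto
    ultimately show ?thesis using assms(1) by (intro mult_mono) auto
  next
    case False
    define l where "l = k - 6"
    have k: "k = l + 6" using False by (simp add: l_def)
    have "\<Lambda> ^ (k + 1) * (norm p)\<^sup>2 = \<Lambda> ^ 6 * (\<Lambda> ^ (l + 1) * (norm p)\<^sup>2)"
      by (simp add: k power_add eval_nat_numeral mult_ac)
    also have "\<dots> \<le> (\<Lambda> + 1 / (1 + t\<^sup>2)) * (\<Lambda> ^ (l + 1) * (norm p)\<^sup>2)"
      using assms by (intro mult_right_mono) auto
    also have "\<dots> = \<Lambda> ^ (l + 1 + 1) * (norm p)\<^sup>2 + \<Lambda> ^ (l + 1) * (norm p)\<^sup>2 / (1 + t\<^sup>2)"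
      by (simp add: algebra_simps)
    also have "\<dots> \<le> \<Lambda> ^ 6 * mass m p (fib (l + 1 + 1)) + \<Lambda> ^ 6 * mass m p (fib (l + 1)) / (1 + t\<^sup>2)"
      using less.IH[of "l + 1"] less.IH[of l] k
      by (intro add_mono divide_right_mono) (auto simp: add_nonneg_nonneg)
    also have "\<dots> = \<Lambda> ^ 6 * (mass m p (fib (l + 1 + 1)) + mass m p (fib (l + 1)) / (1 + t\<^sup>2))"
      by (simp add: algebra_simps)
    also have "\<dots> \<le> \<Lambda> ^ 6 * mass m p (fib (l + 1 + 6))"
      using mass_step[of m p "l + 1"] assms(1) by (intro mult_left_mono) auto
    finally show ?thesis by (simp add: k add.commute add.left_commute)
  qed
qed

end

subsection \<open>Square-summable sequences\<close>

abbreviation sqs :: "(int \<Rightarrow> complex) \<Rightarrow> int \<Rightarrow> real" where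
  "sqs \<psi> n \<equiv> (cmod (\<psi> n))\<^sup>2"

lemma ell2_norm_nonneg: "0 \<le> ell2_norm \<psi>"
  by (simp add: ell2_norm_def infsum_nonneg)

lemma ell2_norm_sq: "(ell2_norm \<psi>)\<^sup>2 = (\<Sum>\<^sub>\<infinity>n. sqs \<psi> n)"
  by (simp add: ell2_norm_def infsum_nonneg)

lemma L2_set_le_ell2_norm:
  assumes "\<psi> \<in> ell2" "finite F"
  shows "L2_set (\<lambda>n. cmod (\<psi> n)) F \<le> ell2_norm \<psi>"
proof -
  have "(\<Sum>n\<in>F. sqs \<psi> n) \<le> (\<Sum>\<^sub>\<infinity>n. sqs \<psi> n)"
    using assms by (intro finite_sum_le_infsum) (auto simp: ell2_def)
  then show ?thesis by (simp add: L2_set_def ell2_norm_def)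
qed

text \<open>Membership and norm bound follow together from finite sections, where the inequalities
  for \<open>L2_set\<close> apply.\<close>

lemma ell2I:
  assumes "\<And>F. finite F \<Longrightarrow> L2_set (\<lambda>n. cmod (\<psi> n)) F \<le> C"
  shows "\<psi> \<in> ell2" "ell2_norm \<psi> \<le> C"
proof -
  have C: "0 \<le> C" using assms[of "{}"] by simp
  have F: "(\<Sum>n\<in>F. sqs \<psi> n) \<le> C\<^sup>2" if "finite F" for F
    using assms[OF that] C by (simp add: L2_set_def real_le_lsqrt sum_nonneg) (metis real_sqrt_le_iff real_sqrt_unique)
  have s: "sqs \<psi> summable_on UNIV"
    by (rule nonneg_bdd_above_summable_on) (auto intro!: bdd_aboveI[of _ "C\<^sup>2"] F)
  then show "\<psi> \<in> ell2" by (simp add: ell2_def)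
  have "(\<Sum>\<^sub>\<infinity>n. sqs \<psi> n) \<le> C\<^sup>2"
    using s by (rule infsum_le_finite_sums) (use F in auto)
  then show "ell2_norm \<psi> \<le> C" using C by (simp add: ell2_norm_def real_le_lsqrt infsum_nonneg)
qed

lemma cmod_le_ell2_norm: "\<psi> \<in> ell2 \<Longrightarrow> cmod (\<psi> n) \<le> ell2_norm \<psi>"
  using L2_set_le_ell2_norm[of \<psi> "{n}"] by simp

lemma ell2_norm_eq_0: "\<psi> \<in> ell2 \<Longrightarrow> ell2_norm \<psi> = 0 \<Longrightarrow> \<psi> = (\<lambda>n. 0)"
  using cmod_le_ell2_norm by fastforce

lemma ell2_add:
  assumes "\<phi> \<in> ell2" "\<psi> \<in> ell2"
  shows "(\<lambda>n. \<phi> n + \<psi> n) \<in> ell2" "ell2_norm (\<lambda>n. \<phi> n + \<psi> n) \<le> ell2_norm \<phi> + ell2_norm \<psi>"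
proof -
  have "L2_set (\<lambda>n. cmod (\<phi> n + \<psi> n)) F \<le> ell2_norm \<phi> + ell2_norm \<psi>" if "finite F" for F
  proof -
    have "L2_set (\<lambda>n. cmod (\<phi> n + \<psi> n)) F \<le> L2_set (\<lambda>n. cmod (\<phi> n) + cmod (\<psi> n)) F"
      by (intro L2_set_mono norm_triangle_ineq) auto
    also have "\<dots> \<le> L2_set (\<lambda>n. cmod (\<phi> n)) F + L2_set (\<lambda>n. cmod (\<psi> n)) F"
      by (rule L2_set_triangle_ineq)
    finally show ?thesis using L2_set_le_ell2_norm[OF assms(1) that] L2_set_le_ell2_norm[OF assms(2) that] by simp
  qed
  then show "(\<lambda>n. \<phi> n + \<psi> n) \<in> ell2" "ell2_norm (\<lambda>n. \<phi> n + \<psi> n) \<le> ell2_norm \<phi> + ell2_norm \<psi>"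
    using ell2I[of "\<lambda>n. \<phi> n + \<psi> n" "ell2_norm \<phi> + ell2_norm \<psi>"] by blast+
qed

lemma ell2_norm_cmult: "ell2_norm (\<lambda>n. c * \<psi> n) = cmod c * ell2_norm \<psi>"
  by (simp add: ell2_norm_def norm_mult power_mult_distrib infsum_cmult_right' real_sqrt_mult)

lemma ell2_dominated:
  assumes "\<psi> \<in> ell2" "\<And>n. cmod (\<phi> n) \<le> C * cmod (\<psi> n)" "0 \<le> C"
  shows "\<phi> \<in> ell2" "ell2_norm \<phi> \<le> C * ell2_norm \<psi>"
proof -
  have "L2_set (\<lambda>n. cmod (\<phi> n)) F \<le> C * ell2_norm \<psi>" if "finite F" for F
  proof -
    have "L2_set (\<lambda>n. cmod (\<phi> n)) F \<le> L2_set (\<lambda>n. C * cmod (\<psi> n)) F"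
      by (intro L2_set_mono assms) auto
    also have "\<dots> = C * L2_set (\<lambda>n. cmod (\<psi> n)) F" using assms by (simp add: L2_set_right_distrib)
    finally show ?thesis using L2_set_le_ell2_norm[OF assms(1) that] assms(3) by (meson mult_left_mono order.trans)
  qed
  then show "\<phi> \<in> ell2" "ell2_norm \<phi> \<le> C * ell2_norm \<psi>" using ell2I[of \<phi> "C * ell2_norm \<psi>"] by blast+
qed

lemma ell2_cmult: "\<psi> \<in> ell2 \<Longrightarrow> (\<lambda>n. c * \<psi> n) \<in> ell2"
  by (rule ell2_dominated(1)[of \<psi> _ "cmod c"]) (auto simp: norm_mult)

lemma ell2_diff:
  assumes "\<phi> \<in> ell2" "\<psi> \<in> ell2"
  shows "(\<lambda>n. \<phi> n - \<psi> n) \<in> ell2"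
  using ell2_add(1)[OF assms(1) ell2_cmult[OF assms(2), of "-1"]] by simp

lemma summable_shift: "(f :: int \<Rightarrow> 'a :: {topological_comm_monoid_add, t2_space}) summable_on UNIV \<Longrightarrow> (\<lambda>n. f (n + d)) summable_on UNIV"
  using summable_on_reindex_bij_betw[of "\<lambda>n. n + d" UNIV UNIV f] by (simp add: bij_plus_right)

lemma infsum_shift: "(\<Sum>\<^sub>\<infinity>n. f (n + d)) = (\<Sum>\<^sub>\<infinity>n::int. f n)"
  using infsum_reindex_bij_betw[of "\<lambda>n. n + d" UNIV UNIV f] by (simp add: bij_plus_right)

lemma ell2_shift: "\<psi> \<in> ell2 \<Longrightarrow> (\<lambda>n. \<psi> (n + d)) \<in> ell2"
  using summable_shift[of "sqs \<psi>" d] by (simp add: ell2_def)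

lemma ell2_norm_shift: "ell2_norm (\<lambda>n. \<psi> (n + d)) = ell2_norm \<psi>"
  using infsum_shift[of "sqs \<psi>" d] by (simp add: ell2_norm_def)

lemma inner_self:
  assumes "\<psi> \<in> ell2"
  shows "ell2_inner \<psi> \<psi> = of_real ((ell2_norm \<psi>)\<^sup>2)"
proof -
  have "(sqs \<psi> has_sum (ell2_norm \<psi>)\<^sup>2) UNIV"
    unfolding ell2_norm_sq using assms by (simp add: ell2_def)
  then have "((\<lambda>n. of_real (sqs \<psi> n) :: complex) has_sum of_real ((ell2_norm \<psi>)\<^sup>2)) UNIV"
    by (simp only: has_sum_of_real_iff)
  moreover have "cnj (\<psi> n) * \<psi> n = of_real (sqs \<psi> n)" for n
    by (subst complex_norm_square) (simp add: mult.commute)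
  ultimately show ?thesis
    unfolding ell2_inner_def by (simp only: infsumI)
qed

definition unit :: "int \<Rightarrow> int \<Rightarrow> complex" where "unit m = (\<lambda>n. if n = m then 1 else 0)"

lemma unit_ell2: "unit m \<in> ell2"
proof (rule ell2I(1))
  fix F :: "int set" assume "finite F"
  then have "L2_set (\<lambda>n. cmod (unit m n)) F \<le> L2_set (\<lambda>n. cmod (unit m n)) (insert m F)"
    by (auto simp: L2_set_def intro!: sum_mono2)
  also have "\<dots> \<le> 1"
    using \<open>finite F\<close> by (simp add: L2_set_insert L2_set_def unit_def sum.remove[of _ m] insert_absorb)
  finally show "L2_set (\<lambda>n. cmod (unit m n)) F \<le> 1" .
qed

lemma inner_unit: "ell2_inner (unit m) \<psi> = \<psi> m"
proof -
  have "((\<lambda>n. cnj (unit m n) * \<psi> n) has_sum (\<Sum>n\<in>{m}. cnj (unit m n) * \<psi> n)) UNIV"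
    by (rule has_sum_finite_neutralI[where B = "{m}"]) (auto simp: unit_def)
  then show ?thesis by (simp add: ell2_inner_def unit_def infsumI)
qed

subsection \<open>The Hamiltonian\<close>

definition pot :: "real \<Rightarrow> real \<Rightarrow> int \<Rightarrow> real" where
  "pot V \<omega> n = V * indicator {1 - alpha0..<1} (frac (of_int n * alpha0 + \<omega>))"

lemma fib_hamiltonian_eq: "fib_hamiltonian V \<omega> \<psi> n = \<psi> (n + 1) + \<psi> (n - 1) + of_real (pot V \<omega> n) * \<psi> n"
  by (simp add: fib_hamiltonian_def pot_def)

lemma fib_hamiltonian_linear:
  "fib_hamiltonian V \<omega> (\<lambda>n. \<phi> n + \<psi> n) = (\<lambda>n. fib_hamiltonian V \<omega> \<phi> n + fib_hamiltonian V \<omega> \<psi> n)"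
  "fib_hamiltonian V \<omega> (\<lambda>n. c * \<psi> n) = (\<lambda>n. c * fib_hamiltonian V \<omega> \<psi> n)"
  by (auto simp: fib_hamiltonian_eq algebra_simps)

lemma fib_hamiltonian_bounded:
  assumes "\<psi> \<in> ell2" "0 \<le> V"
  shows "fib_hamiltonian V \<omega> \<psi> \<in> ell2" "ell2_norm (fib_hamiltonian V \<omega> \<psi>) \<le> (2 + V) * ell2_norm \<psi>"
proof -
  have p: "(\<lambda>n. of_real (pot V \<omega> n) * \<psi> n) \<in> ell2" "ell2_norm (\<lambda>n. of_real (pot V \<omega> n) * \<psi> n) \<le> V * ell2_norm \<psi>"
    using assms by (auto intro!: ell2_dominated[of \<psi>] mult_right_mono simp: norm_mult pot_def indicator_def)
  note s = ell2_shift[OF assms(1), of 1] ell2_shift[OF assms(1), of "-1"]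
  have e: "fib_hamiltonian V \<omega> \<psi> = (\<lambda>n. (\<psi> (n + 1) + \<psi> (n + (-1))) + of_real (pot V \<omega> n) * \<psi> n)"
    by (auto simp: fib_hamiltonian_eq)
  note a = ell2_add[OF s]
  note b = ell2_add[OF a(1) p(1)]
  show "fib_hamiltonian V \<omega> \<psi> \<in> ell2" unfolding e by (rule b(1))
  have "ell2_norm (fib_hamiltonian V \<omega> \<psi>) \<le> ell2_norm (\<lambda>n. \<psi> (n + 1)) + ell2_norm (\<lambda>n. \<psi> (n + (-1))) + ell2_norm (\<lambda>n. of_real (pot V \<omega> n) * \<psi> n)"
    unfolding e using b(2) a(2) by linarith
  also have "\<dots> \<le> (2 + V) * ell2_norm \<psi>" unfolding ell2_norm_shift using p(2) by (simp add: algebra_simps)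
  finally show "ell2_norm (fib_hamiltonian V \<omega> \<psi>) \<le> (2 + V) * ell2_norm \<psi>" .
qed

text \<open>Beyond the operator norm the resolvent is given by the Neumann series. The bound puts
  the identity function among the bounded functions on the spectrum, so that the calculus may
  multiply it with indicators.\<close>

lemma real_spectrum_bounded:
  assumes V: "0 \<le> V" and x: "x \<in> real_spectrum (fib_hamiltonian V \<omega>)"
  shows "\<bar>x\<bar> \<le> 2 + V"
proof (rule ccontr)
  assume "\<not> \<bar>x\<bar> \<le> 2 + V"
  then have xV: "2 + V < \<bar>x\<bar>" by simp
  let ?T = "fib_hamiltonian V \<omega>"
  define r where "r = (2 + V) / \<bar>x\<bar>"
  have x0: "x \<noteq> 0" using xV V by auto
  have r: "0 \<le> r" "r < 1" using xV V x0 by (auto simp: r_def field_simps)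
  \<comment> \<open>The series is summed site by site. Convergence at a site follows from geometric
    decay of the norms, and the resolvent identities from telescoping.\<close>
  define b where "b \<psi> k n = ((?T ^^ k) \<psi>) n / of_real x ^ k" for \<psi> k and n :: int
  define R where "R \<psi> n = - (\<Sum>k. b \<psi> k n) / of_real x" for \<psi> and n :: int
  have pw: "(?T ^^ k) \<psi> \<in> ell2" "ell2_norm ((?T ^^ k) \<psi>) \<le> (2 + V) ^ k * ell2_norm \<psi>" if "\<psi> \<in> ell2" for k \<psi>
  proof -
    have "(?T ^^ k) \<psi> \<in> ell2 \<and> ell2_norm ((?T ^^ k) \<psi>) \<le> (2 + V) ^ k * ell2_norm \<psi>"
    proof (induction k)
      case (Suc k)
      then have "ell2_norm ((?T ^^ Suc k) \<psi>) \<le> (2 + V) * ell2_norm ((?T ^^ k) \<psi>)"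
        using fib_hamiltonian_bounded(2)[of "(?T ^^ k) \<psi>" V \<omega>] V by simp
      also have "\<dots> \<le> (2 + V) * ((2 + V) ^ k * ell2_norm \<psi>)" using Suc V by (intro mult_left_mono) auto
      finally show ?case using Suc fib_hamiltonian_bounded(1)[of "(?T ^^ k) \<psi>" V \<omega>] V by simp
    qed (use that in simp)
    then show "(?T ^^ k) \<psi> \<in> ell2" "ell2_norm ((?T ^^ k) \<psi>) \<le> (2 + V) ^ k * ell2_norm \<psi>" by auto
  qed
  have bl: "b \<psi> k \<in> ell2" "ell2_norm (b \<psi> k) \<le> r ^ k * ell2_norm \<psi>" if "\<psi> \<in> ell2" for k \<psi>
  proof -
    have e: "b \<psi> k = (\<lambda>n. (1 / of_real x ^ k) * (?T ^^ k) \<psi> n)" by (auto simp: b_def)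
    show "b \<psi> k \<in> ell2" unfolding e by (intro ell2_cmult pw that)
    have "ell2_norm (b \<psi> k) = ell2_norm ((?T ^^ k) \<psi>) / \<bar>x\<bar> ^ k"
      unfolding e ell2_norm_cmult by (simp add: norm_divide norm_power)
    also have "\<dots> \<le> ((2 + V) ^ k * ell2_norm \<psi>) / \<bar>x\<bar> ^ k" by (intro divide_right_mono pw that) auto
    finally show "ell2_norm (b \<psi> k) \<le> r ^ k * ell2_norm \<psi>" by (simp add: r_def power_divide)
  qed
  have bs: "summable (\<lambda>k. b \<psi> k n)" if "\<psi> \<in> ell2" for \<psi> n
  proof (rule summable_comparison_test)
    show "\<exists>N. \<forall>k\<ge>N. norm (b \<psi> k n) \<le> r ^ k * ell2_norm \<psi>"
      using cmod_le_ell2_norm[OF bl(1)[OF that]] bl(2)[OF that] by (meson order.trans)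
    show "summable (\<lambda>k. r ^ k * ell2_norm \<psi>)" using r by (intro summable_mult2 summable_geometric) auto
  qed
  have b0: "(\<lambda>k. b \<psi> k n) \<longlonglongrightarrow> 0" if "\<psi> \<in> ell2" for \<psi> n
    using bs[OF that] by (rule summable_LIMSEQ_zero)
  have tele: "(\<Sum>k. b \<psi> (Suc k) n - b \<psi> k n) = - \<psi> n" if "\<psi> \<in> ell2" for \<psi> n
    using telescope_sums[OF b0[OF that, of n]] by (simp add: sums_iff b_def)
  have lin: "(?T ^^ k) (\<lambda>n. \<phi> n + \<psi> n) = (\<lambda>n. (?T ^^ k) \<phi> n + (?T ^^ k) \<psi> n)"
    "(?T ^^ k) (\<lambda>n. c * \<psi> n) = (\<lambda>n. c * (?T ^^ k) \<psi> n)" for k \<phi> \<psi> c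
    by (induction k) (simp_all add: fib_hamiltonian_linear)
  have Rl: "R \<psi> \<in> ell2 \<and> ell2_norm (R \<psi>) \<le> (1 / (1 - r) / \<bar>x\<bar>) * ell2_norm \<psi>" if psi: "\<psi> \<in> ell2" for \<psi>
  proof -
    have "L2_set (\<lambda>n. cmod (R \<psi> n)) F \<le> (1 / (1 - r) / \<bar>x\<bar>) * ell2_norm \<psi>" if F: "finite F" for F
    proof -
      have part: "L2_set (\<lambda>n. cmod (\<Sum>k<N. b \<psi> k n)) F \<le> 1 / (1 - r) * ell2_norm \<psi>" for N
      proof -
        have "L2_set (\<lambda>n. cmod (\<Sum>k<N. b \<psi> k n)) F \<le> (\<Sum>k<N. r ^ k * ell2_norm \<psi>)"
        proof (induction N)
          case (Suc N)
          have "L2_set (\<lambda>n. cmod (\<Sum>k<Suc N. b \<psi> k n)) F \<le> L2_set (\<lambda>n. cmod (\<Sum>k<N. b \<psi> k n) + cmod (b \<psi> N n)) F"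
            by (intro L2_set_mono) (auto intro: norm_triangle_ineq)
          also have "\<dots> \<le> L2_set (\<lambda>n. cmod (\<Sum>k<N. b \<psi> k n)) F + L2_set (\<lambda>n. cmod (b \<psi> N n)) F"
            by (rule L2_set_triangle_ineq)
          also have "L2_set (\<lambda>n. cmod (b \<psi> N n)) F \<le> r ^ N * ell2_norm \<psi>"
            using L2_set_le_ell2_norm[OF bl(1)[OF psi] F] bl(2)[OF psi] by (rule order.trans)
          finally show ?case using Suc by simp
        qed (simp add: L2_set_def)
        also have "\<dots> = (\<Sum>k<N. r ^ k) * ell2_norm \<psi>" by (simp add: sum_distrib_right)
        also have "\<dots> \<le> 1 / (1 - r) * ell2_norm \<psi>"
          using sum_le_suminf[of "\<lambda>k. r ^ k" "{..<N}"] r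
          by (intro mult_right_mono) (auto simp: suminf_geometric ell2_norm_nonneg)
        finally show ?thesis .
      qed
      \<comment> \<open>On finite sections the norm is continuous under pointwise limits, so the
        uniform bound on partial sums passes to the limit.\<close>
      have "(\<lambda>N. L2_set (\<lambda>n. cmod (\<Sum>k<N. b \<psi> k n)) F) \<longlonglongrightarrow> L2_set (\<lambda>n. cmod (\<Sum>k. b \<psi> k n)) F"
        unfolding L2_set_def by (intro tendsto_intros summable_LIMSEQ bs psi)
      then have "L2_set (\<lambda>n. cmod (\<Sum>k. b \<psi> k n)) F \<le> 1 / (1 - r) * ell2_norm \<psi>"
        by (rule LIMSEQ_le_const2) (use part in auto)
      moreover have "L2_set (\<lambda>n. cmod (R \<psi> n)) F = L2_set (\<lambda>n. cmod (\<Sum>k. b \<psi> k n)) F / \<bar>x\<bar>"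
        using L2_set_left_distrib[of "1 / \<bar>x\<bar>" "\<lambda>n. cmod (\<Sum>k. b \<psi> k n)" F] by (simp add: R_def norm_divide)
      ultimately show ?thesis
        using divide_right_mono[of "L2_set (\<lambda>n. cmod (\<Sum>k. b \<psi> k n)) F" "1 / (1 - r) * ell2_norm \<psi>" "\<bar>x\<bar>"] by simp
    qed
    then show ?thesis using ell2I[of "R \<psi>"] by blast
  qed
  have "bounded_op R"
    unfolding bounded_op_def
  proof (intro conjI ballI allI)
    show "R \<psi> \<in> ell2" if "\<psi> \<in> ell2" for \<psi> using Rl[OF that] by simp
    show "R (\<lambda>n. \<phi> n + \<psi> n) = (\<lambda>n. R \<phi> n + R \<psi> n)" if "\<phi> \<in> ell2" "\<psi> \<in> ell2" for \<phi> \<psi>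
    proof
      fix n
      have "b (\<lambda>n. \<phi> n + \<psi> n) k n = b \<phi> k n + b \<psi> k n" for k by (simp add: b_def lin add_divide_distrib)
      then have "(\<Sum>k. b (\<lambda>n. \<phi> n + \<psi> n) k n) = (\<Sum>k. b \<phi> k n) + (\<Sum>k. b \<psi> k n)"
        using suminf_add[OF bs[OF that(1), of n] bs[OF that(2), of n]] by simp
      then show "R (\<lambda>n. \<phi> n + \<psi> n) n = R \<phi> n + R \<psi> n"
        by (simp add: R_def add_divide_distrib diff_divide_distrib)
    qed
    show "R (\<lambda>n. c * \<psi> n) = (\<lambda>n. c * R \<psi> n)" if "\<psi> \<in> ell2" for c \<psi>
    proof
      fix n
      have "b (\<lambda>n. c * \<psi> n) k n = c * b \<psi> k n" for k by (simp add: b_def lin)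
      then show "R (\<lambda>n. c * \<psi> n) n = c * R \<psi> n"
        using suminf_mult[OF bs[OF that, of n], of c] by (simp add: R_def)
    qed
    show "\<exists>C. \<forall>\<psi>\<in>ell2. ell2_norm (R \<psi>) \<le> C * ell2_norm \<psi>" using Rl by blast
  qed
  moreover have "R (\<lambda>n. ?T \<psi> n - of_real x * \<psi> n) = \<psi>" if psi: "\<psi> \<in> ell2" for \<psi>
  proof
    fix n
    have "(?T ^^ k) (\<lambda>n. ?T \<psi> n + (- of_real x) * \<psi> n) = (\<lambda>n. (?T ^^ Suc k) \<psi> n - of_real x * (?T ^^ k) \<psi> n)" for k
      unfolding lin by (simp add: funpow_swap1)
    then have "b (\<lambda>n. ?T \<psi> n - of_real x * \<psi> n) k n = of_real x * (b \<psi> (Suc k) n - b \<psi> k n)" for k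
      using x0 by (simp add: b_def field_simps)
    then show "R (\<lambda>n. ?T \<psi> n - of_real x * \<psi> n) n = \<psi> n"
      using tele[OF psi, of n] x0 suminf_mult[of "\<lambda>k. b \<psi> (Suc k) n - b \<psi> k n" "of_real x"]
        telescope_sums[OF b0[OF psi, of n]] by (simp add: R_def sums_iff)
  qed
  moreover have "(\<lambda>n. ?T (R \<psi>) n - of_real x * R \<psi> n) = \<psi>" if psi: "\<psi> \<in> ell2" for \<psi>
  proof
    fix n
    note s = bs[OF psi]
    have sS: "summable (\<lambda>k. b \<psi> (Suc k) n)"
      using s[of n] summable_Suc_iff[of "\<lambda>k. b \<psi> k n"] by simp
    have "(\<Sum>k. of_real x * b \<psi> (Suc k) n) = (\<Sum>k. b \<psi> k (n + 1) + b \<psi> k (n - 1) + of_real (pot V \<omega> n) * b \<psi> k n)"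
      using x0 by (intro suminf_cong) (simp add: b_def fib_hamiltonian_eq field_simps)
    also have "\<dots> = (\<Sum>k. b \<psi> k (n + 1)) + (\<Sum>k. b \<psi> k (n - 1)) + of_real (pot V \<omega> n) * (\<Sum>k. b \<psi> k n)"
      by (simp add: suminf_add[symmetric] suminf_mult[symmetric] summable_add summable_mult s)
    finally have 1: "of_real x * (\<Sum>k. b \<psi> (Suc k) n) = (\<Sum>k. b \<psi> k (n + 1)) + (\<Sum>k. b \<psi> k (n - 1)) + of_real (pot V \<omega> n) * (\<Sum>k. b \<psi> k n)"
      using suminf_mult[of "\<lambda>k. b \<psi> (Suc k) n" "of_real x"] s[of n] sS by simp
    have 2: "(\<Sum>k. b \<psi> (Suc k) n) - (\<Sum>k. b \<psi> k n) = - \<psi> n"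
      using tele[OF psi, of n] suminf_diff[of "\<lambda>k. b \<psi> (Suc k) n" "\<lambda>k. b \<psi> k n"] s[of n] sS by simp
    have "?T (R \<psi>) n = - ((\<Sum>k. b \<psi> k (n + 1)) + (\<Sum>k. b \<psi> k (n - 1)) + of_real (pot V \<omega> n) * (\<Sum>k. b \<psi> k n)) / of_real x"
      by (simp add: fib_hamiltonian_eq R_def add_divide_distrib diff_divide_distrib)
    also have "\<dots> = - (\<Sum>k. b \<psi> (Suc k) n)" unfolding 1[symmetric] using x0 by simp
    finally show "?T (R \<psi>) n - of_real x * R \<psi> n = \<psi> n" using 2 x0 by (simp add: R_def algebra_simps)
  qed
  ultimately have "of_real x \<in> op_resolvent_set ?T" unfolding op_resolvent_set_def by blast
  then show False using x by (simp add: real_spectrum_def op_spectrum_def)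
qed

subsection \<open>Spectral projections\<close>

locale fib_calculus =
  fixes V \<omega> :: real and \<Phi> :: "(real \<Rightarrow> complex) \<Rightarrow> (int \<Rightarrow> complex) \<Rightarrow> (int \<Rightarrow> complex)"
  assumes V: "0 < V"
    and calculus: "borel_functional_calculus (fib_hamiltonian V \<omega>) \<Phi>"
    and nonempty: "real_spectrum (fib_hamiltonian V \<omega>) \<noteq> {}"
begin

abbreviation H :: "(int \<Rightarrow> complex) \<Rightarrow> int \<Rightarrow> complex" where "H \<equiv> fib_hamiltonian V \<omega>"
abbreviation K :: "real set" where "K \<equiv> real_spectrum H"

definition P :: "real set \<Rightarrow> (int \<Rightarrow> complex) \<Rightarrow> int \<Rightarrow> complex" where "P S = \<Phi> (indicator S)"

lemma bounded_borelI:
  assumes "g \<in> borel_measurable borel" "\<And>x. x \<in> K \<Longrightarrow> cmod (g x) \<le> C"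
  shows "g \<in> bounded_borel_on K"
  unfolding bounded_borel_on_def using assms
  by (auto intro: measurable_restrict_space1 boundedI)

lemmas calculus' = calculus[unfolded borel_functional_calculus_def Let_def]

lemma Phi_ell2: "g \<in> bounded_borel_on K \<Longrightarrow> \<psi> \<in> ell2 \<Longrightarrow> \<Phi> g \<psi> \<in> ell2"
  using calculus' by (auto simp: bounded_op_def)

lemma Phi_zero: "g \<in> bounded_borel_on K \<Longrightarrow> \<Phi> g (\<lambda>n. 0) = (\<lambda>n. 0)"
proof -
  assume "g \<in> bounded_borel_on K"
  then have "\<forall>c. \<forall>\<psi>\<in>ell2. \<Phi> g (\<lambda>n. c * \<psi> n) = (\<lambda>n. c * \<Phi> g \<psi> n)"
    using calculus' by (auto simp: bounded_op_def)
  then have "\<Phi> g (\<lambda>n. 0 * unit 0 n) = (\<lambda>n. 0 * \<Phi> g (unit 0) n)" using unit_ell2 by blast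
  then show ?thesis by simp
qed

lemma Phi_add: "f \<in> bounded_borel_on K \<Longrightarrow> g \<in> bounded_borel_on K \<Longrightarrow> \<psi> \<in> ell2 \<Longrightarrow>
    \<Phi> (\<lambda>x. f x + g x) \<psi> = (\<lambda>n. \<Phi> f \<psi> n + \<Phi> g \<psi> n)"
  by (rule calculus'[THEN conjunct2, THEN conjunct1, rule_format])

lemma Phi_cmult: "g \<in> bounded_borel_on K \<Longrightarrow> \<psi> \<in> ell2 \<Longrightarrow> \<Phi> (\<lambda>x. c * g x) \<psi> = (\<lambda>n. c * \<Phi> g \<psi> n)"
  by (rule calculus'[THEN conjunct2, THEN conjunct2, THEN conjunct1, rule_format])

lemma Phi_mult: "f \<in> bounded_borel_on K \<Longrightarrow> g \<in> bounded_borel_on K \<Longrightarrow> \<psi> \<in> ell2 \<Longrightarrow>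
    \<Phi> (\<lambda>x. f x * g x) \<psi> = \<Phi> f (\<Phi> g \<psi>)"
  by (rule calculus'[THEN conjunct2, THEN conjunct2, THEN conjunct2, THEN conjunct1, rule_format])

lemma Phi_adj: "g \<in> bounded_borel_on K \<Longrightarrow> \<phi> \<in> ell2 \<Longrightarrow> \<psi> \<in> ell2 \<Longrightarrow>
    ell2_inner \<phi> (\<Phi> (\<lambda>x. cnj (g x)) \<psi>) = ell2_inner (\<Phi> g \<phi>) \<psi>"
  by (rule calculus'[THEN conjunct2, THEN conjunct2, THEN conjunct2, THEN conjunct2, THEN conjunct1, rule_format])

lemma Phi_one: "\<psi> \<in> ell2 \<Longrightarrow> \<Phi> (\<lambda>x. 1) \<psi> = \<psi>"
  by (rule calculus'[THEN conjunct2, THEN conjunct2, THEN conjunct2, THEN conjunct2, THEN conjunct2, THEN conjunct1, rule_format])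

lemma Phi_id: "\<psi> \<in> ell2 \<Longrightarrow> \<Phi> complex_of_real \<psi> = H \<psi>"
  by (rule calculus'[THEN conjunct2, THEN conjunct2, THEN conjunct2, THEN conjunct2, THEN conjunct2, THEN conjunct2, THEN conjunct1, rule_format])

lemma Phi_norm: "g \<in> bounded_borel_on K \<Longrightarrow> \<psi> \<in> ell2 \<Longrightarrow>
    ell2_norm (\<Phi> g \<psi>) \<le> (SUP x\<in>K. cmod (g x)) * ell2_norm \<psi>"
  by (rule calculus'[THEN conjunct2, THEN conjunct2, THEN conjunct2, THEN conjunct2, THEN conjunct2, THEN conjunct2, THEN conjunct2, THEN conjunct1, rule_format])

lemma Phi_cont:
  assumes "\<And>k. gs k \<in> bounded_borel_on K" "g \<in> bounded_borel_on K" "\<And>k x. x \<in> K \<Longrightarrow> cmod (gs k x) \<le> C"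
    "\<And>x. x \<in> K \<Longrightarrow> (\<lambda>k. gs k x) \<longlonglongrightarrow> g x" "\<psi> \<in> ell2"
  shows "(\<lambda>k. ell2_norm (\<lambda>n. \<Phi> (gs k) \<psi> n - \<Phi> g \<psi> n)) \<longlonglongrightarrow> 0"
  using assms by (intro calculus'[THEN conjunct2, THEN conjunct2, THEN conjunct2, THEN conjunct2, THEN conjunct2, THEN conjunct2, THEN conjunct2, THEN conjunct2, rule_format]) auto

lemma Phi_norm_le:
  assumes "g \<in> borel_measurable borel" "\<And>x. x \<in> K \<Longrightarrow> cmod (g x) \<le> C" "\<psi> \<in> ell2"
  shows "ell2_norm (\<Phi> g \<psi>) \<le> C * ell2_norm \<psi>"
proof -
  have "ell2_norm (\<Phi> g \<psi>) \<le> (SUP x\<in>K. cmod (g x)) * ell2_norm \<psi>"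
    by (intro Phi_norm bounded_borelI[of g C] assms)
  also have "\<dots> \<le> C * ell2_norm \<psi>"
    by (intro mult_right_mono cSUP_least nonempty assms ell2_norm_nonneg)
  finally show ?thesis .
qed

lemma indicator_B [simp, intro]: "S \<in> sets borel \<Longrightarrow> (indicator S :: real \<Rightarrow> complex) \<in> bounded_borel_on K"
  by (rule bounded_borelI[of _ 1]) (auto simp: indicator_def)

lemma id_B: "complex_of_real \<in> bounded_borel_on K"
  by (rule bounded_borelI[of _ "2 + V"]) (use real_spectrum_bounded[of V _ \<omega>] V in auto)

lemma P_ell2: "S \<in> sets borel \<Longrightarrow> \<psi> \<in> ell2 \<Longrightarrow> P S \<psi> \<in> ell2"
  unfolding P_def by (rule Phi_ell2) auto

lemma P_Int: "S \<in> sets borel \<Longrightarrow> S' \<in> sets borel \<Longrightarrow> \<psi> \<in> ell2 \<Longrightarrow> P (S \<inter> S') \<psi> = P S (P S' \<psi>)"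
proof -
  assume "S \<in> sets borel" "S' \<in> sets borel" "\<psi> \<in> ell2"
  moreover have "(indicator (S \<inter> S') :: real \<Rightarrow> complex) = (\<lambda>x. indicator S x * indicator S' x)"
    by (auto simp: indicator_def fun_eq_iff)
  ultimately show ?thesis by (simp add: P_def Phi_mult)
qed

lemma P_subset_zero:
  assumes "S \<subseteq> S'" "S \<in> sets borel" "S' \<in> sets borel" "\<psi> \<in> ell2" "P S' \<psi> = (\<lambda>n. 0)"
  shows "P S \<psi> = (\<lambda>n. 0)"
  using P_Int[of S S' \<psi>] assms Phi_zero[of "indicator S"] by (simp add: Int_absorb2 P_def)

lemma P_Un:
  assumes "S \<in> sets borel" "S' \<in> sets borel" "S \<inter> S' = {}" "\<psi> \<in> ell2"
  shows "P (S \<union> S') \<psi> = (\<lambda>n. P S \<psi> n + P S' \<psi> n)"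
proof -
  have "(indicator (S \<union> S') :: real \<Rightarrow> complex) = (\<lambda>x. indicator S x + indicator S' x)"
    using assms(3) by (auto simp: indicator_def fun_eq_iff)
  then show ?thesis using assms by (simp add: P_def Phi_add)
qed

lemma P_empty: "\<psi> \<in> ell2 \<Longrightarrow> P {} \<psi> = (\<lambda>n. 0)"
  using P_Un[of "{}" "{}" \<psi>] by (auto simp: fun_eq_iff)

lemma P_adj: "S \<in> sets borel \<Longrightarrow> \<phi> \<in> ell2 \<Longrightarrow> \<psi> \<in> ell2 \<Longrightarrow> ell2_inner \<phi> (P S \<psi>) = ell2_inner (P S \<phi>) \<psi>"
proof -
  assume "S \<in> sets borel" "\<phi> \<in> ell2" "\<psi> \<in> ell2"
  moreover have "(\<lambda>x. cnj (indicator S x)) = (indicator S :: real \<Rightarrow> complex)" by (auto simp: indicator_def fun_eq_iff)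
  ultimately show ?thesis using Phi_adj[of "indicator S" \<phi> \<psi>] by (simp add: P_def)
qed

lemma shifted_id:
  fixes E :: real
  assumes "\<psi> \<in> ell2"
  shows "(\<lambda>x. of_real (x - E)) \<in> bounded_borel_on K"
    "\<Phi> (\<lambda>x. of_real (x - E)) \<psi> = (\<lambda>n. H \<psi> n - of_real E * \<psi> n)"
proof -
  show "(\<lambda>x. of_real (x - E)) \<in> bounded_borel_on K"
  proof (rule bounded_borelI[of _ "2 + V + \<bar>E\<bar>"])
    fix x assume "x \<in> K"
    then have "\<bar>x\<bar> \<le> 2 + V" using real_spectrum_bounded V by auto
    then show "cmod (of_real (x - E)) \<le> 2 + V + \<bar>E\<bar>" by (simp only: norm_of_real)
  qed simp
  have one: "(\<lambda>x. 1) \<in> bounded_borel_on K" by (rule bounded_borelI[of _ 1]) auto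
  then have c: "(\<lambda>x. - of_real E * 1) \<in> bounded_borel_on K" by (intro bounded_borelI[of _ "\<bar>E\<bar>"]) auto
  have "\<Phi> (\<lambda>x. complex_of_real x + (- of_real E * 1)) \<psi> = (\<lambda>n. \<Phi> complex_of_real \<psi> n + \<Phi> (\<lambda>x. - of_real E * 1) \<psi> n)"
    by (intro Phi_add id_B c assms)
  also have "\<Phi> (\<lambda>x. - of_real E * 1) \<psi> = (\<lambda>n. - of_real E * \<psi> n)"
    using Phi_cmult[OF one assms, of "- of_real E"] Phi_one[OF assms] by simp
  finally show "\<Phi> (\<lambda>x. of_real (x - E)) \<psi> = (\<lambda>n. H \<psi> n - of_real E * \<psi> n)"
    using Phi_id[OF assms] by simp
qed

text \<open>The projected vector is fixed by the projection, so \<open>H - E\<close> acts on it as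
  multiplication by \<open>x - E\<close> cut down to \<open>S\<close>. This yields an error relative
  to the norm of \<open>P S \<psi>\<close> instead of that of \<psi>.\<close>

lemma approximate_eigenvector:
  assumes "S \<in> sets borel" "S \<subseteq> cball E \<epsilon>" "0 \<le> \<epsilon>" "\<psi> \<in> ell2"
  shows "ell2_norm (\<lambda>n. H (P S \<psi>) n - of_real E * P S \<psi> n) \<le> \<epsilon> * ell2_norm (P S \<psi>)"
proof -
  let ?\<phi> = "P S \<psi>" and ?g = "\<lambda>x::real. of_real (x - E) * indicator S x :: complex"
  have e: "?\<phi> \<in> ell2" "P S ?\<phi> = ?\<phi>" using P_ell2 P_Int[of S S \<psi>] assms by auto
  have "\<Phi> ?g ?\<phi> = \<Phi> (\<lambda>x. of_real (x - E)) (P S ?\<phi>)"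
    unfolding P_def[symmetric] using Phi_mult[OF shifted_id(1)[OF assms(4)] indicator_B[OF assms(1)] e(1)] by (simp add: P_def)
  then have "(\<lambda>n. H ?\<phi> n - of_real E * ?\<phi> n) = \<Phi> ?g ?\<phi>"
    using shifted_id(2)[OF e(1)] e(2) by simp
  moreover have "ell2_norm (\<Phi> ?g ?\<phi>) \<le> \<epsilon> * ell2_norm ?\<phi>"
  proof (rule Phi_norm_le)
    show "?g \<in> borel_measurable borel" using assms(1) by measurable
    show "cmod (?g x) \<le> \<epsilon>" for x
      using assms(2,3) by (cases "x \<in> S") (auto simp: indicator_def norm_mult dist_real_def abs_minus_commute simp del: of_real_diff)
  qed (rule e)
  ultimately show ?thesis by simp
qed

text \<open>A bounded inverse excludes approximate eigenvectors near \<open>x\<close>. Conversely,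
  where the projection of a ball vanishes, the calculus supplies the inverse. The characterization
  is open in \<open>x\<close>, which is how the spectrum is seen to be a Borel set.\<close>

lemma resolvent_iff: "x \<notin> K \<longleftrightarrow> (\<exists>\<delta>>0. \<forall>\<psi>\<in>ell2. P (ball x \<delta>) \<psi> = (\<lambda>n. 0))"
proof
  assume "x \<notin> K"
  then have "of_real x \<in> op_resolvent_set H" by (simp add: real_spectrum_def op_spectrum_def)
  then obtain R where R: "bounded_op R" "\<And>\<psi>. \<psi> \<in> ell2 \<Longrightarrow> R (\<lambda>n. H \<psi> n - of_real x * \<psi> n) = \<psi>"
    by (auto simp: op_resolvent_set_def)
  obtain C where C: "\<And>\<psi>. \<psi> \<in> ell2 \<Longrightarrow> ell2_norm (R \<psi>) \<le> C * ell2_norm \<psi>"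
    using R(1) unfolding bounded_op_def by blast
  define \<delta> where "\<delta> = 1 / (\<bar>C\<bar> + 1)"
  have d: "0 < \<delta>" "\<bar>C\<bar> * \<delta> < 1" by (auto simp: \<delta>_def field_simps)
  have "P (ball x \<delta>) \<psi> = (\<lambda>n. 0)" if psi: "\<psi> \<in> ell2" for \<psi>
  proof -
    let ?\<phi> = "P (ball x \<delta>) \<psi>" let ?r = "\<lambda>n. H ?\<phi> n - of_real x * ?\<phi> n"
    have phi: "?\<phi> \<in> ell2" by (rule P_ell2) (use psi in auto)
    have r: "?r \<in> ell2" using V by (intro ell2_diff ell2_cmult fib_hamiltonian_bounded phi) auto
    have "ell2_norm ?\<phi> \<le> C * ell2_norm ?r" using C[OF r] R(2)[OF phi] by simp
    also have "\<dots> \<le> \<bar>C\<bar> * ell2_norm ?r" by (intro mult_right_mono ell2_norm_nonneg) simp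
    also have "\<dots> \<le> \<bar>C\<bar> * (\<delta> * ell2_norm ?\<phi>)"
      by (intro mult_left_mono approximate_eigenvector psi) (use d in auto)
    finally have "(1 - \<bar>C\<bar> * \<delta>) * ell2_norm ?\<phi> \<le> 0" by (simp add: algebra_simps)
    then have "ell2_norm ?\<phi> \<le> 0" using d by (simp add: mult_le_0_iff)
    then show ?thesis using ell2_norm_eq_0[OF phi] ell2_norm_nonneg[of ?\<phi>] by simp
  qed
  then show "\<exists>\<delta>>0. \<forall>\<psi>\<in>ell2. P (ball x \<delta>) \<psi> = (\<lambda>n. 0)" using d by blast
next
  assume "\<exists>\<delta>>0. \<forall>\<psi>\<in>ell2. P (ball x \<delta>) \<psi> = (\<lambda>n. 0)"
  then obtain \<delta> where d: "0 < \<delta>" "\<And>\<psi>. \<psi> \<in> ell2 \<Longrightarrow> P (ball x \<delta>) \<psi> = (\<lambda>n. 0)" by blast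
  let ?I = "ball x \<delta>"
  \<comment> \<open>The function 1/(y - x), cut off to 0 on the ball; the singularity sits where the
    projection vanishes, so its image still inverts \<open>H - x\<close>.\<close>
  define h where "h y = indicat_real (- ?I) y / (y - x)" for y
  define g where "g y = complex_of_real (h y)" for y
  let ?l = "\<lambda>y::real. complex_of_real (y - x)"
  have far: "\<delta> \<le> \<bar>y - x\<bar>" if "y \<notin> ?I" for y
    using that by (simp add: dist_real_def abs_minus_commute)
  have g: "g \<in> bounded_borel_on K"
  proof (rule bounded_borelI)
    show "g \<in> borel_measurable borel" unfolding g_def[abs_def] h_def[abs_def] by measurable
    have "\<bar>h y\<bar> \<le> 1 / \<delta>" for y
    proof (cases "y \<in> ?I")
      case False
      then have "\<bar>h y\<bar> = 1 / \<bar>y - x\<bar>" by (simp add: h_def)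
      also have "\<dots> \<le> 1 / \<delta>" using far[OF False] d(1) by (intro frac_le) auto
      finally show ?thesis .
    qed (use d(1) in \<open>simp add: h_def\<close>)
    then show "cmod (g y) \<le> 1 / \<delta>" for y by (simp only: g_def norm_of_real)
  qed
  have c: "P (- ?I) \<psi> = \<psi>" if "\<psi> \<in> ell2" for \<psi>
  proof -
    have "P (?I \<union> - ?I) \<psi> = (\<lambda>n. P ?I \<psi> n + P (- ?I) \<psi> n)" using that by (intro P_Un) auto
    also have "\<dots> = P (- ?I) \<psi>" by (simp add: d(2)[OF that])
    finally show ?thesis using Phi_one[OF that] by (simp add: P_def)
  qed
  have "h y * (y - x) = indicat_real (- ?I) y" for y
    using far[of y] d(1) by (cases "y \<in> ?I") (auto simp: h_def)
  then have "g y * ?l y = indicator (- ?I) y" for y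
    unfolding g_def of_real_mult[symmetric] by (simp add: indicator_def)
  then have e: "(\<lambda>y. g y * ?l y) = indicator (- ?I)" "(\<lambda>y. ?l y * g y) = indicator (- ?I)"
    by (simp_all add: fun_eq_iff mult.commute)
  have "bounded_op (\<Phi> g)" by (rule calculus'[THEN conjunct1, rule_format, OF g])
  moreover have "\<Phi> g (\<lambda>n. H \<psi> n - of_real x * \<psi> n) = \<psi>" if "\<psi> \<in> ell2" for \<psi>
    using Phi_mult[OF g shifted_id(1)[OF that, of x] that] c[OF that] unfolding e(1) shifted_id(2)[OF that] P_def
    by (rule trans[OF sym])
  moreover have "(\<lambda>n. H (\<Phi> g \<psi>) n - of_real x * \<Phi> g \<psi> n) = \<psi>" if "\<psi> \<in> ell2" for \<psi>
    using Phi_mult[OF shifted_id(1)[OF that, of x] g that] c[OF that]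
    unfolding e(2) shifted_id(2)[OF Phi_ell2[OF g that]] P_def by (rule trans[OF sym])
  ultimately have "of_real x \<in> op_resolvent_set H" unfolding op_resolvent_set_def by blast
  then show "x \<notin> K" by (simp add: real_spectrum_def op_spectrum_def)
qed

lemma spectrum_borel: "K \<in> sets borel"
proof -
  have "open (- K)"
    unfolding open_contains_ball
  proof
    fix x assume "x \<in> - K"
    then obtain \<delta> where d: "0 < \<delta>" "\<And>\<psi>. \<psi> \<in> ell2 \<Longrightarrow> P (ball x \<delta>) \<psi> = (\<lambda>n. 0)"
      using resolvent_iff[of x] by blast
    have "y \<notin> K" if y: "y \<in> ball x \<delta>" for y
    proof -
      from y obtain \<delta>' where d': "0 < \<delta>'" "ball y \<delta>' \<subseteq> ball x \<delta>" by (meson open_ball open_contains_ball)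
      then have "P (ball y \<delta>') \<psi> = (\<lambda>n. 0)" if "\<psi> \<in> ell2" for \<psi>
        using P_subset_zero[OF d'(2) _ _ that d(2)[OF that]] by simp
      then show ?thesis using resolvent_iff[of y] d'(1) by blast
    qed
    then show "\<exists>e>0. ball x e \<subseteq> - K" using d(1) by blast
  qed
  then show ?thesis by (simp add: borel_closed closed_def)
qed

section \<open>Spectral measures of the unit vectors\<close>

definition nu :: "int \<Rightarrow> real measure" where
  "nu m = measure_of UNIV (sets borel) (\<lambda>S. ennreal (Re (P S (unit m) m)))"

text \<open>Idempotence and self-adjointness. Read as a statement on \<phi> =
  \<open>P S (unit m)\<close>, it makes the value at \<open>m\<close> quadratic in the norm;
  \<open>nu_holder\<close> rests on this.\<close>

lemma P_unit_diag:
  assumes "S \<in> sets borel"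
  shows "P S (unit m) m = of_real ((ell2_norm (P S (unit m)))\<^sup>2)"
proof -
  have "P S (unit m) m = ell2_inner (unit m) (P S (P S (unit m)))"
    using P_Int[OF assms assms unit_ell2] by (simp add: inner_unit)
  also have "\<dots> = ell2_inner (P S (unit m)) (P S (unit m))"
    by (intro P_adj P_ell2 unit_ell2 assms)
  finally show ?thesis using inner_self[OF P_ell2[OF assms unit_ell2]] by simp
qed

lemma space_nu [simp]: "space (nu m) = UNIV"
  by (simp add: nu_def space_measure_of_conv)

lemma sets_nu [simp]: "sets (nu m) = sets borel"
  unfolding nu_def by (subst sets_measure_of) (simp_all add: sets.sigma_sets_eq[of borel, unfolded space_borel])

lemma P_diag_sums:
  assumes A: "range A \<subseteq> sets borel" "disjoint_family A"
  shows "(\<lambda>i. Re (P (A i) (unit m) m)) sums Re (P (\<Union>i. A i) (unit m) m)"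
proof -
  let ?U = "\<lambda>n. \<Union>i<n. A i"
  have Ab: "A i \<in> sets borel" for i using A by auto
  have U: "?U n \<in> sets borel" "(\<Union>i. A i) \<in> sets borel" for n
    by (rule sets.finite_UN, simp_all add: Ab) (use sets.countable_UN[OF A(1)] in simp)
  have fin: "(\<Sum>i<n. P (A i) (unit m) m) = P (?U n) (unit m) m" for n
  proof (induction n)
    case 0
    show ?case by (simp add: P_empty unit_ell2)
  next
    case (Suc n)
    have "A n \<inter> A i = {}" if "i < n" for i
      using disjoint_family_onD[OF A(2), of n i] that by simp
    then have "A n \<inter> ?U n = {}" by blast
    then have "P (A n \<union> ?U n) (unit m) m = P (A n) (unit m) m + P (?U n) (unit m) m"
      using P_Un[OF Ab U(1) _ unit_ell2] by simp
    then show ?case using Suc by (simp add: lessThan_Suc)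
  qed
  have "(\<lambda>k. ell2_norm (\<lambda>n. \<Phi> (indicator (?U k)) (unit m) n - \<Phi> (indicator (\<Union>i. A i)) (unit m) n)) \<longlonglongrightarrow> 0"
  proof (rule Phi_cont)
    show "(\<lambda>k. indicator (?U k) x :: complex) \<longlonglongrightarrow> indicator (\<Union>i. A i) x" for x by (rule LIMSEQ_indicator_UN)
    show "cmod (indicator (?U k) x) \<le> 1" for k x by (simp add: indicator_def)
  qed (simp_all add: U unit_ell2)
  then have "(\<lambda>k. P (?U k) (unit m) m - P (\<Union>i. A i) (unit m) m) \<longlonglongrightarrow> 0"
  proof (rule Lim_null_comparison[rotated])
    show "\<forall>\<^sub>F k in sequentially. cmod (P (?U k) (unit m) m - P (\<Union>i. A i) (unit m) m) \<le>
      ell2_norm (\<lambda>n. \<Phi> (indicator (?U k)) (unit m) n - \<Phi> (indicator (\<Union>i. A i)) (unit m) n)"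
    proof (rule always_eventually, rule allI)
      fix k
      have "(\<lambda>n. P (?U k) (unit m) n - P (\<Union>i. A i) (unit m) n) \<in> ell2" by (intro ell2_diff P_ell2 U unit_ell2)
      from cmod_le_ell2_norm[OF this, of m] show "cmod (P (?U k) (unit m) m - P (\<Union>i. A i) (unit m) m) \<le>
        ell2_norm (\<lambda>n. \<Phi> (indicator (?U k)) (unit m) n - \<Phi> (indicator (\<Union>i. A i)) (unit m) n)"
        by (simp add: P_def)
    qed
  qed
  then have "(\<lambda>k. P (?U k) (unit m) m) \<longlonglongrightarrow> P (\<Union>i. A i) (unit m) m" by (simp add: LIM_zero_iff)
  then have "(\<lambda>k. Re (P (?U k) (unit m) m)) \<longlonglongrightarrow> Re (P (\<Union>i. A i) (unit m) m)" by (rule tendsto_Re)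
  then show ?thesis by (simp add: sums_def fin[symmetric])
qed

lemma emeasure_nu:
  assumes "S \<in> sets borel"
  shows "emeasure (nu m) S = ennreal ((ell2_norm (P S (unit m)))\<^sup>2)"
proof -
  have nn: "0 \<le> Re (P S (unit m) m)" if "S \<in> sets borel" for S using P_unit_diag[OF that] by simp
  have "emeasure (nu m) S = ennreal (Re (P S (unit m) m))"
    unfolding nu_def
  proof (rule emeasure_measure_of_sigma)
    show "sigma_algebra UNIV (sets (borel :: real measure))" by (metis sets.sigma_algebra_axioms space_borel)
    show "positive (sets borel) (\<lambda>S. ennreal (Re (P S (unit m) m)))"
      by (simp add: positive_def P_empty unit_ell2)
    show "countably_additive (sets borel) (\<lambda>S. ennreal (Re (P S (unit m) m)))"
      unfolding countably_additive_def
    proof (intro allI impI)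
      fix A :: "nat \<Rightarrow> real set" assume "range A \<subseteq> sets borel" "disjoint_family A"
      from P_diag_sums[OF this] show "(\<Sum>i. ennreal (Re (P (A i) (unit m) m))) = ennreal (Re (P (\<Union> (range A)) (unit m) m))"
        by (intro suminf_ennreal_eq) (use nn \<open>range A \<subseteq> sets borel\<close> in auto)
    qed
  qed (rule assms)
  then show ?thesis using P_unit_diag[OF assms] by simp
qed

text \<open>By self-adjointness every coordinate of \<open>P S \<psi>\<close> is an inner product
  with some \<open>P S (unit n)\<close>.\<close>

lemma P_eq_0_if_nu_null:
  assumes "S \<in> sets borel" "\<And>m. emeasure (nu m) S = 0" "\<psi> \<in> ell2"
  shows "P S \<psi> = (\<lambda>n. 0)"
proof
  fix n
  have "ell2_norm (P S (unit n)) = 0" using assms(2)[of n] emeasure_nu[OF assms(1)] by simp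
  then have z: "P S (unit n) = (\<lambda>n. 0)" by (intro ell2_norm_eq_0 P_ell2 assms unit_ell2)
  have "P S \<psi> n = ell2_inner (P S (unit n)) \<psi>"
    using P_adj[OF assms(1) unit_ell2 assms(3), of n] by (simp add: inner_unit)
  then show "P S \<psi> n = 0" by (simp add: z ell2_inner_def)
qed

lemma spectral_measure_null:
  assumes "sets \<mu> = sets borel" "finite_measure \<mu>" "emeasure \<mu> (- K) = 0" "\<psi> \<in> ell2"
    and int: "\<And>g. g \<in> bounded_borel_on K \<Longrightarrow> ell2_inner \<psi> (\<Phi> g \<psi>) = (LINT E:K|\<mu>. g E)"
    and S: "S \<in> sets borel" "P S \<psi> = (\<lambda>n. 0)"
  shows "emeasure \<mu> S = 0"
proof -
  interpret finite_measure \<mu> by fact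
  have KS: "K \<inter> S \<in> sets \<mu>" "S \<in> sets \<mu>" "- K \<in> sets \<mu>" using S spectrum_borel assms(1) by auto
  have "0 = (LINT E:K|\<mu>. (indicator S E :: complex))"
    using int[OF indicator_B[OF S(1)]] S(2) by (simp add: P_def ell2_inner_def)
  also have "\<dots> = (\<integral>x. complex_of_real (indicator (K \<inter> S) x) \<partial>\<mu>)"
    unfolding set_lebesgue_integral_def by (intro Bochner_Integration.integral_cong) (auto simp: indicator_def)
  also have "\<dots> = of_real (measure \<mu> (K \<inter> S))" using KS(1) by (simp add: sets.Int_space_eq2)
  finally have "measure \<mu> (K \<inter> S) = 0" by simp
  then have 0: "emeasure \<mu> (K \<inter> S) = 0" by (simp add: emeasure_eq_measure)
  have "emeasure \<mu> S \<le> emeasure \<mu> ((K \<inter> S) \<union> (- K))" using KS by (intro emeasure_mono) auto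
  also have "\<dots> \<le> emeasure \<mu> (K \<inter> S) + emeasure \<mu> (- K)" by (intro emeasure_subadditive KS)
  finally show ?thesis using 0 assms(3) by simp
qed

end

subsection \<open>The two kinds of energies\<close>

lemma sturmian_fib: "sturmian (\<lambda>n. frac (of_int n * alpha0 + \<omega>) \<in> {1 - alpha0..<1})"
proof -
  have f: "frac x \<in> {1 - alpha0..<1} \<longleftrightarrow> \<lfloor>x + alpha0\<rfloor> \<noteq> \<lfloor>x\<rfloor>" for x
    using alpha0_pos alpha0_less_1 unfolding frac_def by (auto; linarith)
  have "(of_int n + 1) * alpha0 + \<omega> = (of_int n * alpha0 + \<omega>) + alpha0" for n :: int
    by (simp add: algebra_simps)
  then have "frac (of_int n * alpha0 + \<omega>) \<in> {1 - alpha0..<1} \<longleftrightarrow>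
      \<lfloor>(of_int n + 1) * alpha0 + \<omega>\<rfloor> \<noteq> \<lfloor>of_int n * alpha0 + \<omega>\<rfloor>" for n
    by (simp only: f)
  then show ?thesis unfolding sturmian_def by blast
qed

text \<open>Each shift contributes the full sum over the integers, so summation only counts the
  shifts.\<close>

lemma infsum_le_shifts:
  fixes f g h :: "int \<Rightarrow> real"
  assumes fin: "finite D" "finite D'" and g: "g summable_on UNIV" and h: "h summable_on UNIV" and f0: "\<And>n. 0 \<le> f n"
    and le: "\<And>n. f n \<le> a * (\<Sum>d\<in>D. g (n + d)) + b * (\<Sum>d\<in>D'. h (n + d))"
  shows "infsum f UNIV \<le> a * (card D * infsum g UNIV) + b * (card D' * infsum h UNIV)"
proof -
  have S: "((\<lambda>n. \<Sum>d\<in>D. g (n + d)) has_sum (card D * infsum g UNIV)) UNIV"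
    if "finite D" "g summable_on UNIV" for D and g :: "int \<Rightarrow> real"
    using that(1)
  proof (induction D)
    case empty then show ?case by (simp add: has_sum_0)
  next
    case (insert d D)
    have "((\<lambda>n. g (n + d)) has_sum infsum g UNIV) UNIV"
      using has_sum_infsum[OF summable_shift[OF that(2), of d]] by (simp add: infsum_shift)
    from has_sum_add[OF this insert.IH] show ?case using insert.hyps by (simp add: algebra_simps)
  qed
  have R: "((\<lambda>n. a * (\<Sum>d\<in>D. g (n + d)) + b * (\<Sum>d\<in>D'. h (n + d))) has_sum
      (a * (card D * infsum g UNIV) + b * (card D' * infsum h UNIV))) UNIV"
    by (intro has_sum_add has_sum_cmult_right S fin g h)
  then have "f summable_on UNIV"
    by (intro summable_on_comparison_test[OF has_sum_imp_summable[OF R]]) (use le f0 in auto)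
  then have "(f has_sum infsum f UNIV) UNIV" by (rule has_sum_infsum)
  from has_sum_mono[OF this R] show ?thesis using le by simp
qed

lemma sum_squared_le:
  fixes f :: "'a \<Rightarrow> real"
  shows "(\<Sum>i\<in>A. f i)\<^sup>2 \<le> card A * (\<Sum>i\<in>A. (f i)\<^sup>2)"
  using Cauchy_Schwarz_ineq_sum[of "\<lambda>_. 1" f A] by simp

lemma sum_sq_le: "(a + b)\<^sup>2 \<le> 2 * (a\<^sup>2 + b\<^sup>2)" for a b :: real
proof -
  have "0 \<le> (a - b)\<^sup>2" by simp
  then show ?thesis by (simp add: power2_eq_square algebra_simps)
qed

lemma sum_sq_le_four:
  fixes a b u :: real
  assumes "a\<^sup>2 \<le> u" "b\<^sup>2 \<le> u"
  shows "(a + b)\<^sup>2 \<le> 4 * u"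
proof -
  have "(a + b)\<^sup>2 \<le> 2 * (a\<^sup>2 + b\<^sup>2)" by (rule sum_sq_le)
  also have "\<dots> \<le> 2 * (u + u)" using assms by simp
  finally show ?thesis by simp
qed

section \<open>The Hamiltonian at a fixed energy: escape or growth\<close>

locale fib_model = fib_calculus + fib_hierarchy +
  assumes W_0: "W 0 n \<longleftrightarrow> frac (of_int n * alpha0 + \<omega>) \<in> {1 - alpha0..<1}"
begin

definition S0 :: "real \<Rightarrow> m2" where "S0 E = M2 E (-1) 1 0"
definition S1 :: "real \<Rightarrow> m2" where "S1 E = M2 (E - V) (-1) 1 0"

lemma transfer_E: "transfer W c (S0 E) (S1 E)"
  by unfold_locales (simp_all add: S0_def S1_def dt_def)

abbreviation MM :: "real \<Rightarrow> nat \<Rightarrow> m2" where "MM E \<equiv> fibmat (S0 E) (S1 E)"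

lemma XE: "transfer.X W (S0 E) (S1 E) n = M2 (E - pot V \<omega> n) (-1) 1 0"
  unfolding transfer.X_def[OF transfer_E] by (simp add: S0_def S1_def pot_def W_0 indicator_def)

definition good :: "real set" where "good = {E. \<forall>i. \<bar>tr (MM E i)\<bar> \<le> 2 + V}"

definition vec :: "(int \<Rightarrow> complex) \<Rightarrow> int \<Rightarrow> complex \<times> complex" where
  "vec \<phi> n = (\<phi> n, \<phi> (n - 1))"

definition res :: "real \<Rightarrow> (int \<Rightarrow> complex) \<Rightarrow> int \<Rightarrow> complex \<times> complex" where
  "res E \<phi> n = (H \<phi> n - of_real E * \<phi> n, 0)"

lemma vec_step: "vec \<phi> (n + 1) = act (transfer.X W (S0 E) (S1 E) n) (vec \<phi> n) + res E \<phi> n"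
  by (simp add: XE vec_def res_def act_def fib_hamiltonian_eq algebra_simps)

lemma norm_vec_sq: "(norm (vec \<phi> n))\<^sup>2 = sqs \<phi> n + sqs \<phi> (n - 1)"
  by (simp add: vec_def norm_Pair)

lemma norm_res: "norm (res E \<phi> n) = cmod (H \<phi> n - of_real E * \<phi> n)"
  by (simp add: res_def norm_Pair)

lemma vec_has_sum:
  assumes "\<phi> \<in> ell2"
  shows "((\<lambda>n. (norm (vec \<phi> n))\<^sup>2) has_sum (2 * (ell2_norm \<phi>)\<^sup>2)) UNIV"
proof -
  have s: "sqs \<phi> summable_on UNIV" using assms by (simp add: ell2_def)
  have "((\<lambda>n. sqs \<phi> n + sqs \<phi> (n + (-1))) has_sum ((ell2_norm \<phi>)\<^sup>2 + (ell2_norm \<phi>)\<^sup>2)) UNIV"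
    using has_sum_infsum[OF s] has_sum_infsum[OF summable_shift[OF s, of "-1"]]
    by (intro has_sum_add) (simp_all add: ell2_norm_sq infsum_shift[of "sqs \<phi>" "-1", simplified])
  then show ?thesis by (simp add: norm_vec_sq)
qed

lemma res_has_sum:
  assumes "\<phi> \<in> ell2"
  shows "((\<lambda>n. (norm (res E \<phi> n))\<^sup>2) has_sum (ell2_norm (\<lambda>n. H \<phi> n - of_real E * \<phi> n))\<^sup>2) UNIV"
proof -
  have "(\<lambda>n. H \<phi> n - of_real E * \<phi> n) \<in> ell2"
    using V by (intro ell2_diff ell2_cmult fib_hamiltonian_bounded assms) auto
  then show ?thesis unfolding norm_res ell2_norm_sq by (intro has_sum_infsum) (simp add: ell2_def)
qed

lemma good_or_escape:
  assumes "E \<notin> good"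
  shows "\<exists>i0. \<forall>i\<ge>i0. Z \<le> \<bar>tr (MM E i)\<bar>"
proof -
  \<comment> \<open>The traces are preceded by a fictitious term 2, which extends the recursion one
    step backwards. It supplies the starting bound for \<open>trace_map_alternative\<close>, and the
    invariant becomes 4 + V^2 for every energy.\<close>
  define y where "y i = (case i of 0 \<Rightarrow> 2 | Suc j \<Rightarrow> tr (MM E j))" for i
  have d: "dt (S0 E) = 1" "dt (S1 E) = 1" by (simp_all add: S0_def S1_def dt_def)
  have y: "y 0 = 2" "y 1 = E" "y 2 = E - V" "y 3 = E * (E - V) - 2"
    by (simp_all add: y_def S0_def S1_def tr_def times_m2_def eval_nat_numeral)
  have "(\<forall>i. \<bar>y i\<bar> \<le> 2 + V) \<or> (\<forall>B. \<exists>i0. \<forall>i\<ge>i0. B \<le> \<bar>y i\<bar>)"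
  proof (rule trace_map_alternative)
    fix i
    show "y (i + 3) = y (i + 2) * y (i + 1) - y i"
    proof (cases i)
      case 0 then show ?thesis by (simp add: y(3,4)[unfolded numeral_2_eq_2 numeral_3_eq_3] y(1,2)[unfolded One_nat_def] eval_nat_numeral algebra_simps)
    next
      case (Suc j)
      then show ?thesis using tr_fibmat_rec[OF d, of j] by (simp add: y_def eval_nat_numeral)
    qed
  next
    show "(y 0)\<^sup>2 + (y 1)\<^sup>2 + (y 2)\<^sup>2 - y 0 * y 1 * y 2 = 4 + V\<^sup>2"
      unfolding y by (simp add: power2_eq_square algebra_simps)
  qed (use y V in auto)
  then show ?thesis
  proof
    assume "\<forall>i. \<bar>y i\<bar> \<le> 2 + V"
    then have "\<bar>y (Suc i)\<bar> \<le> 2 + V" for i by blast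
    then show ?thesis using assms by (simp add: y_def good_def)
  next
    assume "\<forall>B. \<exists>i0. \<forall>i\<ge>i0. B \<le> \<bar>y i\<bar>"
    then obtain i0 where i0: "\<And>i. i0 \<le> i \<Longrightarrow> Z \<le> \<bar>y i\<bar>" by blast
    have "Z \<le> \<bar>tr (MM E i)\<bar>" if "i0 \<le> i" for i using i0[of "Suc i"] that by (simp add: y_def)
    then show ?thesis by blast
  qed
qed

text \<open>The order of choices matters: \<open>Z\<close> depends only on the one-step bound
  \<open>D\<close>, the level \<open>i\<close> on \<open>Z\<close>, the word bound \<open>B\<close>
  on that level, and \<epsilon> comes last, so it may be small against all of them.\<close>

lemma escape_null:
  assumes "E \<notin> good"
  shows "\<exists>\<epsilon>>0. \<forall>\<psi>\<in>ell2. P (ball E \<epsilon>) \<psi> = (\<lambda>n. 0)"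
proof -
  interpret tf: transfer W c "S0 E" "S1 E" by (rule transfer_E)
  define D where "D = \<bar>E\<bar> + V + 2"
  have D1: "1 \<le> D" using V by (simp add: D_def)
  have nX: "ns (tf.X n) \<le> D" for n
    using V by (auto simp: XE ns_def D_def pot_def indicator_def)
  have nF: "ns (fprod tf.X m l) \<le> 2 * D ^ l" for m l
  proof (induction l)
    case (Suc l)
    have "ns (fprod tf.X m (Suc l)) \<le> D * (2 * D ^ l)"
      using nX Suc D1 by (simp add: order.trans[OF ns_mult] mult_mono ns_nonneg)
    then show ?case by simp
  qed simp
  \<comment> \<open>There are at most 12 shifts (three lengths, both directions, centre
    \<open>n\<close> or \<open>n - 1\<close>), each with weight 8 D^2. In total this is 96 D^2,
    below Z^2 because Z exceeds 10 D.\<close>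
  define Z where "Z = 10 * D + 1"
  obtain i0 where i0: "\<And>i. i0 \<le> i \<Longrightarrow> Z \<le> \<bar>tr (MM E i)\<bar>" using good_or_escape[OF assms] by blast
  define i where "i = Suc i0"
  define Q where "Q = fib (i + 3)"
  define B where "B = 2 * D ^ Q"
  have nB: "ns (fprod tf.X m l) \<le> B" if "l \<le> Q" for m l
    using nF[of m l] power_increasing[OF that D1] unfolding B_def by linarith
  have B0: "0 \<le> B" using nB[of 0 0] by simp
  define Qs :: "int set" where "Qs = {int (fib (i + 1)), int (fib (i + 2)), int (fib (i + 3))}"
  define D1s where "D1s = Qs \<union> uminus ` Qs \<union> (\<lambda>q. q - 1) ` Qs \<union> (\<lambda>q. - q - 1) ` Qs"
  define D2s where "D2s = {- int Q - 1..int Q}"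
  have fin: "finite D1s" "finite D2s" by (auto simp: D1s_def Qs_def D2s_def)
  have card1: "card D1s \<le> 12"
  proof -
    have "card Qs \<le> 3" unfolding Qs_def by (rule card_insert_le_m1; simp add: card_insert_if)+
    moreover have fQ: "finite Qs" by (simp add: Qs_def)
    ultimately have "card (f ` Qs) \<le> 3" for f :: "int \<Rightarrow> int" using card_image_le[of Qs f] by linarith
    then have c: "card (uminus ` Qs) \<le> 3" "card ((\<lambda>q. q - 1) ` Qs) \<le> 3" "card ((\<lambda>q. - q - 1) ` Qs) \<le> 3" by auto
    have "card D1s \<le> card Qs + card (uminus ` Qs) + card ((\<lambda>q. q - 1) ` Qs) + card ((\<lambda>q. - q - 1) ` Qs)"
      unfolding D1s_def by (intro order.trans[OF card_Un_le] add_mono card_Un_le order.refl)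
    then show ?thesis using c \<open>card Qs \<le> 3\<close> by linarith
  qed
  define C1 where "C1 = D * (B + B * B) + Z"
  have Z0: "0 \<le> Z" using D1 by (simp add: Z_def)
  have C10: "0 \<le> C1" unfolding C1_def using D1 B0 Z0 by (intro add_nonneg_nonneg mult_nonneg_nonneg) auto
  define C2 where "C2 = 2 * C1\<^sup>2 * card D2s"
  have pointwise: "Z\<^sup>2 * (norm (vec \<phi> n))\<^sup>2 \<le> (8 * D\<^sup>2) * (\<Sum>d\<in>D1s. (norm (vec \<phi> (n + d)))\<^sup>2)
      + C2 * (\<Sum>d\<in>D2s. (norm (res E \<phi> (n + d)))\<^sup>2)" for \<phi> n
  proof -
    obtain i' j n' where sq: "index i' j \<in> {i, i + 1, i + 2}" "n' \<in> {n, n - 1}"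
      "cut i' j \<le> n' - int (fib (index i' j + 1))"
      "agree (cut i' j) (cut i' j + int (fib (index i' j + 1))) (nat (n' - cut i' j))"
      by (rule centre_of_square[of i n]) (auto simp: i_def)
    define q where "q = fib (index i' j + 1)"
    have qQ: "int q \<in> Qs" using sq(1) by (auto simp: q_def Qs_def eval_nat_numeral)
    have qle: "q \<le> Q" unfolding q_def Q_def by (rule fib_mono) (use sq(1) in auto)
    let ?a = "\<lambda>k. norm (vec \<phi> k)" and ?e = "\<lambda>k. norm (res E \<phi> k)"
    let ?R = "\<Sum>d\<in>D2s. ?e (n + d)"
    have R0: "0 \<le> ?R" by (intro sum_nonneg) auto
    have "Z * ?a n' \<le> \<bar>tr (MM E (index i' j))\<bar> * ?a n'"
      by (intro mult_right_mono i0) (use sq(1) in \<open>auto simp: i_def\<close>)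
    also have "\<dots> \<le> ?a (n' + int q) + ?a (n' - int q) + (B + B * B) * (\<Sum>k<2 * q. ?e (n' - int q + int k))"
      by (rule tf.centre_trace_bound[where U = "vec \<phi>", OF vec_step sq(3) sq(4) refl, folded q_def]) (use nB qle in auto)
    also have "(\<Sum>k<2 * q. ?e (n' - int q + int k)) = (\<Sum>d\<in>(\<lambda>k. n' - n - int q + int k) ` {..<2 * q}. ?e (n + d))"
      by (subst sum.reindex) (auto simp: inj_on_def algebra_simps)
    also have "\<dots> \<le> ?R"
      using qle sq(2) by (intro sum_mono2 fin) (auto simp: D2s_def)
    finally have 1: "Z * ?a n' \<le> ?a (n' + int q) + ?a (n' - int q) + (B + B * B) * ?R"
      using B0 by (simp add: mult_left_mono)
    \<comment> \<open>When the centre is \<open>n - 1\<close>, one transfer step brings the estimate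
      back to \<open>n\<close>, at the cost of a factor \<open>D\<close>.\<close>
    have 2: "?a n \<le> D * ?a n' + ?e (n - 1)"
    proof (cases "n' = n")
      case True
      then show ?thesis using D1 mult_right_mono[OF D1, of "?a n"] by (simp add: add_increasing2)
    next
      case False
      then have n': "n' = n - 1" using sq(2) by auto
      have "vec \<phi> n = act (tf.X (n - 1)) (vec \<phi> (n - 1)) + res E \<phi> (n - 1)"
        using vec_step[of \<phi> "n - 1" E] by simp
      then have "?a n \<le> norm (act (tf.X (n - 1)) (vec \<phi> (n - 1))) + ?e (n - 1)" by (metis norm_triangle_ineq)
      also have "norm (act (tf.X (n - 1)) (vec \<phi> (n - 1))) \<le> D * ?a (n - 1)"
        by (rule order.trans[OF norm_act]) (simp add: mult_right_mono nX)
      finally show ?thesis by (simp add: n')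
    qed
    have e1: "?e (n - 1) \<le> ?R"
      using member_le_sum[of "-1" D2s "\<lambda>d. ?e (n + d)"] fin by (simp add: D2s_def)
    have "Z * ?a n \<le> Z * (D * ?a n' + ?e (n - 1))" using 2 Z0 by (rule mult_left_mono)
    also have "\<dots> = D * (Z * ?a n') + Z * ?e (n - 1)" by (simp add: algebra_simps)
    also have "\<dots> \<le> D * (?a (n' + int q) + ?a (n' - int q) + (B + B * B) * ?R) + Z * ?R"
      using 1 e1 D1 Z0 by (intro add_mono mult_left_mono) auto
    also have "\<dots> = D * (?a (n' + int q) + ?a (n' - int q)) + C1 * ?R"
      by (simp add: C1_def algebra_simps)
    finally have 3: "Z * ?a n \<le> D * (?a (n' + int q) + ?a (n' - int q)) + C1 * ?R" .
    let ?S = "\<Sum>d\<in>D1s. (?a (n + d))\<^sup>2"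
    have mem: "(?a (n + d))\<^sup>2 \<le> ?S" if "d \<in> D1s" for d
      using member_le_sum[of d D1s "\<lambda>d. (?a (n + d))\<^sup>2"] that fin by simp
    have "n' + int q - n \<in> D1s" "n' - int q - n \<in> D1s" using sq(2) qQ by (auto simp: D1s_def)
    from mem[OF this(1)] mem[OF this(2)]
    have 4: "(?a (n' + int q))\<^sup>2 \<le> ?S" "(?a (n' - int q))\<^sup>2 \<le> ?S" by simp_all
    have sq: "2 * ((D * x)\<^sup>2 + (C1 * y)\<^sup>2) = 2 * D\<^sup>2 * x\<^sup>2 + 2 * C1\<^sup>2 * y\<^sup>2" for x y
      by (simp add: power_mult_distrib algebra_simps)
    have "Z\<^sup>2 * (?a n)\<^sup>2 = (Z * ?a n)\<^sup>2" by (simp add: power_mult_distrib)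
    also have "\<dots> \<le> (D * (?a (n' + int q) + ?a (n' - int q)) + C1 * ?R)\<^sup>2"
      using 3 Z0 by (intro power_mono) auto
    also have "\<dots> \<le> 2 * ((D * (?a (n' + int q) + ?a (n' - int q)))\<^sup>2 + (C1 * ?R)\<^sup>2)" by (rule sum_sq_le)
    also have "\<dots> = 2 * D\<^sup>2 * (?a (n' + int q) + ?a (n' - int q))\<^sup>2 + 2 * C1\<^sup>2 * ?R\<^sup>2"
      by (rule sq)
    also have "\<dots> \<le> 2 * D\<^sup>2 * (4 * ?S) + 2 * C1\<^sup>2 * (card D2s * (\<Sum>d\<in>D2s. (?e (n + d))\<^sup>2))"
    proof (intro add_mono mult_left_mono sum_squared_le)
      show "(?a (n' + int q) + ?a (n' - int q))\<^sup>2 \<le> 4 * ?S"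
        by (rule sum_sq_le_four[OF 4])
    qed auto
    finally show ?thesis by (simp add: C2_def algebra_simps)
  qed
  define C3 where "C3 = C2 * card D2s"
  have C30: "0 \<le> C3" by (simp add: C3_def C2_def)
  define \<epsilon> where "\<epsilon> = 1 / (C3 + 1)"
  have eps: "0 < \<epsilon>" "\<epsilon> \<le> 1" "C3 * \<epsilon>\<^sup>2 < 1"
  proof -
    show "0 < \<epsilon>" "\<epsilon> \<le> 1" using C30 by (simp_all add: \<epsilon>_def)
    have "C3 * \<epsilon>\<^sup>2 \<le> C3 * \<epsilon>"
      using \<open>0 < \<epsilon>\<close> \<open>\<epsilon> \<le> 1\<close> C30 by (intro mult_left_mono) (auto simp: power2_eq_square mult_left_le_one_le)
    also have "\<dots> < 1" using C30 by (simp add: \<epsilon>_def)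
    finally show "C3 * \<epsilon>\<^sup>2 < 1" .
  qed
  have "P (ball E \<epsilon>) \<psi> = (\<lambda>n. 0)" if psi: "\<psi> \<in> ell2" for \<psi>
  proof -
    let ?\<phi> = "P (ball E \<epsilon>) \<psi>"
    have phi: "?\<phi> \<in> ell2" by (intro P_ell2 psi) auto
    let ?N = "(ell2_norm ?\<phi>)\<^sup>2" and ?r = "ell2_norm (\<lambda>n. H ?\<phi> n - of_real E * ?\<phi> n)"
    note hv = vec_has_sum[OF phi] and hr = res_has_sum[OF phi, of E]
    have "(\<Sum>\<^sub>\<infinity>n. Z\<^sup>2 * (norm (vec ?\<phi> n))\<^sup>2) \<le> (8 * D\<^sup>2) * (card D1s * (\<Sum>\<^sub>\<infinity>n. (norm (vec ?\<phi> n))\<^sup>2))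
      + C2 * (card D2s * (\<Sum>\<^sub>\<infinity>n. (norm (res E ?\<phi> n))\<^sup>2))"
      by (rule infsum_le_shifts[OF fin has_sum_imp_summable[OF hv] has_sum_imp_summable[OF hr] _ pointwise]) simp
    also have "(\<Sum>\<^sub>\<infinity>n. Z\<^sup>2 * (norm (vec ?\<phi> n))\<^sup>2) = Z\<^sup>2 * (2 * ?N)"
      by (rule infsumI) (rule has_sum_cmult_right[OF hv])
    finally have "Z\<^sup>2 * (2 * ?N) \<le> (8 * D\<^sup>2) * (card D1s * (2 * ?N)) + C3 * ?r\<^sup>2"
      by (simp add: infsumI[OF hv] infsumI[OF hr] C3_def mult.assoc)
    also have "\<dots> \<le> (8 * D\<^sup>2) * (12 * (2 * ?N)) + C3 * (\<epsilon>\<^sup>2 * ?N)"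
    proof (intro add_mono mult_left_mono mult_right_mono)
      show "real (card D1s) \<le> 12" using card1 by simp
      have "?r \<le> \<epsilon> * ell2_norm ?\<phi>" by (rule approximate_eigenvector) (use eps psi in auto)
      then have "?r\<^sup>2 \<le> (\<epsilon> * ell2_norm ?\<phi>)\<^sup>2" by (intro power_mono ell2_norm_nonneg)
      then show "?r\<^sup>2 \<le> \<epsilon>\<^sup>2 * ?N" by (simp add: power_mult_distrib)
    qed (use C30 in auto)
    finally have "(2 * Z\<^sup>2 - 192 * D\<^sup>2 - C3 * \<epsilon>\<^sup>2) * ?N \<le> 0" by (simp add: algebra_simps)
    moreover have "0 < 2 * Z\<^sup>2 - 192 * D\<^sup>2 - C3 * \<epsilon>\<^sup>2"
    proof -
      have "2 * Z\<^sup>2 - 192 * D\<^sup>2 = 8 * D\<^sup>2 + 40 * D + 2" by (simp add: Z_def power2_eq_square algebra_simps)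
      then show ?thesis using eps(3) D1 zero_le_power2[of D] by linarith
    qed
    ultimately have "?N \<le> 0" by (simp add: mult_le_0_iff)
    then show ?thesis using ell2_norm_eq_0[OF phi] by simp
  qed
  then show ?thesis using eps(1) by blast
qed

text \<open>The exact solution with the data of \<phi> at \<open>m\<close> gains mass by
  \<open>mass_growth\<close>, while on the window it stays near \<phi>, whose mass there is at most
  twice the squared norm. The factor 2 is due to \<open>vec\<close>, which counts each site
  twice.\<close>

lemma good_bound:
  fixes k :: nat
  defines "t \<equiv> 2 + V"
  defines "B \<equiv> 30 * (5 * t + 9) * ((2 * t + 2)\<^sup>2) ^ 4 * (3 / 2 * (t + 1)\<^sup>2) ^ k"
  assumes E: "E \<in> good" and L: "1 \<le> \<Lambda>" "\<Lambda> ^ 6 \<le> \<Lambda> + 1 / (1 + t\<^sup>2)"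
    and \<phi>: "\<phi> \<in> ell2" "ell2_norm (\<lambda>n. H \<phi> n - of_real E * \<phi> n) \<le> \<epsilon> * ell2_norm \<phi>"
  shows "\<Lambda> ^ (k + 1) * sqs \<phi> m \<le> \<Lambda> ^ 6 * (4 + 2 * (B * fib (k + 1) * \<epsilon>)\<^sup>2) * (ell2_norm \<phi>)\<^sup>2"
proof -
  interpret tf: transfer W c "S0 E" "S1 E" by (rule transfer_E)
  interpret tb: transfer_bounded W c "S0 E" "S1 E" t
  proof unfold_locales
    show "\<bar>tr (MM E i)\<bar> \<le> t" for i using E by (simp add: good_def t_def)
  qed (use V in \<open>auto simp: t_def\<close>)
  have "\<bar>tr (MM E 0)\<bar> \<le> t" using E unfolding good_def t_def by blast
  then have Et: "\<bar>E\<bar> \<le> t" by (simp add: S0_def tr_def)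
  define s where "s = (2 * t + 2)\<^sup>2"
  have t2: "2 \<le> t" using V by (simp add: t_def)
  have n0: "ns (MM E 0) \<le> 2 * t + 2" "ns (MM E (Suc 0)) \<le> 2 * t + 2"
    using Et V by (auto simp: S0_def S1_def ns_def t_def)
  have s1: "2 * t + 2 \<le> s" "1 \<le> s" using t2 by (auto simp: s_def intro: self_le_power one_le_power)
  have n2: "ns (MM E 2) \<le> s"
    unfolding s_def power2_eq_square numeral_2_eq_2 using n0 t2
    by (simp add: numeral_2_eq_2 order.trans[OF ns_mult] mult_mono ns_nonneg)
  have word: "ns (fprod tf.X m' l) \<le> B" if "l < fib (k + 1)" for m' l
    unfolding B_def s_def[symmetric] by (rule tb.word_bound[OF that]) (use n0 n2 s1 in auto)
  have B0: "0 \<le> B" using t2 by (simp add: B_def)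
  let ?L = "fib (k + 1)" let ?r = "\<lambda>n. norm (res E \<phi> n)"
  let ?N = "(ell2_norm \<phi>)\<^sup>2"
  have rsum: "(\<Sum>j<?L. (?r (m + int j))\<^sup>2) \<le> \<epsilon>\<^sup>2 * ?N"
  proof -
    have "(\<Sum>j<?L. (?r (m + int j))\<^sup>2) = (\<Sum>n\<in>(\<lambda>j. m + int j) ` {..<?L}. (?r n)\<^sup>2)"
      by (subst sum.reindex) (auto simp: inj_on_def)
    also have "\<dots> \<le> (ell2_norm (\<lambda>n. H \<phi> n - of_real E * \<phi> n))\<^sup>2"
      using has_sum_imp_summable[OF res_has_sum[OF \<phi>(1), of E]] infsumI[OF res_has_sum[OF \<phi>(1), of E]]
      by (metis (no_types, lifting) finite_imageI finite_lessThan finite_sum_le_infsum subset_UNIV zero_le_power2)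
    also have "\<dots> \<le> (\<epsilon> * ell2_norm \<phi>)\<^sup>2" by (intro power_mono \<phi> ell2_norm_nonneg)
    finally show ?thesis by (simp add: power_mult_distrib)
  qed
  have vsum: "(\<Sum>j<?L. (norm (vec \<phi> (m + int j)))\<^sup>2) \<le> 2 * ?N"
  proof -
    have "(\<Sum>j<?L. (norm (vec \<phi> (m + int j)))\<^sup>2) = (\<Sum>n\<in>(\<lambda>j. m + int j) ` {..<?L}. (norm (vec \<phi> n))\<^sup>2)"
      by (subst sum.reindex) (auto simp: inj_on_def)
    also have "\<dots> \<le> 2 * ?N"
      using has_sum_imp_summable[OF vec_has_sum[OF \<phi>(1)]] infsumI[OF vec_has_sum[OF \<phi>(1)]]
      by (metis (no_types, lifting) finite_imageI finite_lessThan finite_sum_le_infsum subset_UNIV zero_le_power2)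
    finally show ?thesis .
  qed
  \<comment> \<open>Cauchy-Schwarz over the window converts the summed error into
    \<open>fib (k + 1)\<close> times its square sum. Adding over the sites gives a second such
    factor, hence the square of B F \<epsilon> in the result.\<close>
  have each: "(norm (act (fprod tf.X m j) (vec \<phi> m)))\<^sup>2 \<le> 2 * (norm (vec \<phi> (m + int j)))\<^sup>2 + 2 * (B\<^sup>2 * (?L * (\<epsilon>\<^sup>2 * ?N)))"
    if j: "j < ?L" for j
  proof -
    let ?d = "vec \<phi> (m + int j) - act (fprod tf.X m j) (vec \<phi> m)"
    have "norm ?d \<le> B * (\<Sum>i<j. ?r (m + int i))"
      by (rule perturbed_solution_bound[where U = "vec \<phi>", OF vec_step]) (use word j in auto)
    also have "\<dots> \<le> B * (\<Sum>i<?L. ?r (m + int i))"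
      using B0 j by (intro mult_left_mono sum_mono2) auto
    finally have "(norm ?d)\<^sup>2 \<le> (B * (\<Sum>i<?L. ?r (m + int i)))\<^sup>2" by (intro power_mono) auto
    also have "\<dots> = B\<^sup>2 * (\<Sum>i<?L. ?r (m + int i))\<^sup>2" by (simp add: power_mult_distrib)
    also have "\<dots> \<le> B\<^sup>2 * (?L * (\<Sum>i<?L. (?r (m + int i))\<^sup>2))"
      using sum_squared_le[of "\<lambda>i. ?r (m + int i)" "{..<?L}"] by (intro mult_left_mono) auto
    also have "\<dots> \<le> B\<^sup>2 * (?L * (\<epsilon>\<^sup>2 * ?N))" using rsum by (intro mult_left_mono) auto
    finally have d: "(norm ?d)\<^sup>2 \<le> B\<^sup>2 * (?L * (\<epsilon>\<^sup>2 * ?N))" .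
    have "act (fprod tf.X m j) (vec \<phi> m) = vec \<phi> (m + int j) - ?d" by simp
    then have "norm (act (fprod tf.X m j) (vec \<phi> m)) \<le> norm (vec \<phi> (m + int j)) + norm ?d"
      by (metis norm_triangle_ineq4)
    then have "(norm (act (fprod tf.X m j) (vec \<phi> m)))\<^sup>2 \<le> (norm (vec \<phi> (m + int j)) + norm ?d)\<^sup>2"
      by (intro power_mono) auto
    also have "\<dots> \<le> 2 * ((norm (vec \<phi> (m + int j)))\<^sup>2 + (norm ?d)\<^sup>2)" by (rule sum_sq_le)
    also have "\<dots> \<le> 2 * ((norm (vec \<phi> (m + int j)))\<^sup>2 + B\<^sup>2 * (?L * (\<epsilon>\<^sup>2 * ?N)))"
      by (intro mult_left_mono add_left_mono d) simp
    finally show ?thesis by (simp only: distrib_left)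
  qed
  have "tb.mass m (vec \<phi> m) ?L \<le> (\<Sum>j<?L. 2 * (norm (vec \<phi> (m + int j)))\<^sup>2 + 2 * (B\<^sup>2 * (?L * (\<epsilon>\<^sup>2 * ?N))))"
    unfolding tb.mass_def by (rule sum_mono) (use each in auto)
  also have "\<dots> = 2 * (\<Sum>j<?L. (norm (vec \<phi> (m + int j)))\<^sup>2) + 2 * (B * ?L * \<epsilon>)\<^sup>2 * ?N"
    by (simp add: sum.distrib sum_distrib_left power_mult_distrib power2_eq_square)
  also have "\<dots> \<le> (4 + 2 * (B * ?L * \<epsilon>)\<^sup>2) * ?N" using vsum by (simp add: algebra_simps)
  finally have mass: "tb.mass m (vec \<phi> m) ?L \<le> (4 + 2 * (B * ?L * \<epsilon>)\<^sup>2) * ?N" .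
  have "\<Lambda> ^ (k + 1) * sqs \<phi> m \<le> \<Lambda> ^ (k + 1) * (norm (vec \<phi> m))\<^sup>2"
    using L(1) by (intro mult_left_mono) (auto simp: norm_vec_sq)
  also have "\<dots> \<le> \<Lambda> ^ 6 * tb.mass m (vec \<phi> m) ?L" by (rule tb.mass_growth[OF L])
  also have "\<dots> \<le> \<Lambda> ^ 6 * ((4 + 2 * (B * ?L * \<epsilon>)\<^sup>2) * ?N)"
    using mass L(1) by (intro mult_left_mono) auto
  finally show ?thesis by (simp add: mult.assoc)
qed

end

subsection \<open>Hoelder continuity\<close>

definition golden :: real where "golden = (sqrt 5 + 1) / 2"

lemma golden_sq: "golden * golden = golden + 1" and golden_gt: "8 / 5 < golden"
proof -
  have s: "sqrt 5 * sqrt 5 = (5::real)" by simp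
  show "golden * golden = golden + 1" by (simp add: golden_def field_simps s)
  have "11 / 5 < sqrt (5::real)" by (rule real_less_rsqrt) (simp add: power2_eq_square)
  then show "8 / 5 < golden" by (simp add: golden_def)
qed

lemma fib_le_golden: "real (fib (k + 1)) \<le> golden ^ k"
proof (induction k rule: fib.induct)
  case (3 k)
  have "real (fib (Suc (Suc k) + 1)) = real (fib (Suc k + 1)) + real (fib (k + 1))" by simp
  also have "\<dots> \<le> golden ^ Suc k + golden ^ k" using 3 by (intro add_mono)
  also have "\<dots> = golden ^ k * (golden * golden)" unfolding golden_sq by (simp add: algebra_simps)
  finally show ?case by (simp add: mult_ac)
qed (use golden_gt in auto)

text \<open>At the square root of 2 + V the cubic equals -1, so a root lies to its right. A lower
  bound is the useful direction, since \<open>a_root\<close> occurs in the denominator of the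
  claimed exponent.\<close>

lemma sqrt_le_a_root:
  assumes "0 < V"
  shows "sqrt (2 + V) \<le> a_root V"
proof -
  let ?t = "2 + V"
  let ?f = "\<lambda>x::real. x ^ 3 - ?t * x - 1"
  let ?R = "{x. ?f x = 0}"
  have st: "sqrt ?t * sqrt ?t = ?t" using assms by simp
  have "?f x = poly [:-1, - ?t, 0, 1:] x" for x by (simp add: algebra_simps power3_eq_cube)
  then have "?R = {x. poly [:-1, - ?t, 0, 1:] x = 0}" by simp
  then have fin: "finite ?R" using poly_roots_finite[of "[:-1, - ?t, 0, 1:]"] by simp
  have "\<exists>x. sqrt ?t \<le> x \<and> x \<le> ?t + 1 \<and> ?f x = 0"
  proof (rule IVT')
    have "sqrt ?t ^ 3 = ?t * sqrt ?t" unfolding power3_eq_cube st by simp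
    then show "?f (sqrt ?t) \<le> 0" by simp
    have "0 \<le> ?t * ?t * ?t + 2 * (?t * ?t) + 2 * ?t"
      using assms by (intro add_nonneg_nonneg mult_nonneg_nonneg) auto
    then show "0 \<le> ?f (?t + 1)" by (simp add: power3_eq_cube algebra_simps)
    have "sqrt ?t \<le> ?t" using assms by (intro real_le_lsqrt) (auto simp: power2_eq_square algebra_simps)
    then show "sqrt ?t \<le> ?t + 1" by simp
    show "continuous_on {sqrt ?t..?t + 1} ?f" by (intro continuous_intros)
  qed
  then obtain x where "sqrt ?t \<le> x" "x \<in> ?R" by blast
  with Max_ge[OF fin, of x] show ?thesis by (simp add: a_root_def)
qed

text \<open>The growth rate of transfer matrices per level of the hierarchy, the growth factor of
  solutions per level, and the resulting Hoelder exponent.\<close>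

definition word_rate :: "real \<Rightarrow> real" where "word_rate V = 3 / 2 * (3 + V)\<^sup>2"
definition mass_rate :: "real \<Rightarrow> real" where "mass_rate V = root 7 (1 + 1 / (2 + 2 * V)\<^sup>2)"
definition holder_exponent :: "real \<Rightarrow> real" where "holder_exponent V = ln (mass_rate V) / ln (golden * word_rate V)"

lemma mass_rate_gt_1: "0 < V \<Longrightarrow> 1 < mass_rate V"
  by (simp add: mass_rate_def)

lemma power7_le:
  fixes x :: real
  assumes "0 \<le> x" "x \<le> 1 / 32"
  shows "(1 + x) ^ 7 \<le> 1 + 8 * x"
proof -
  have a: "x * x \<le> x / 32" using mult_left_mono[OF assms(2,1)] by simp
  have b: "x * (x * x) \<le> x / 1024" using mult_left_mono[OF a assms(1)] a by simp
  have "(1 + x) ^ 2 = 1 + 2 * x + x * x" by (simp add: power2_eq_square algebra_simps)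
  then have "(1 + x) ^ 2 \<le> 1 + 33 / 16 * x" using a assms(1) by linarith
  then have "((1 + x) ^ 2) ^ 3 \<le> (1 + 33 / 16 * x) ^ 3" using assms by (intro power_mono) auto
  moreover have "(1 + 33 / 16 * x) ^ 3 = 1 + 99 / 16 * x + 3267 / 256 * (x * x) + 35937 / 4096 * (x * (x * x))"
    by (simp add: power3_eq_cube field_simps)
  ultimately have "((1 + x) ^ 2) ^ 3 \<le> 1 + 66 / 10 * x" using a b assms(1) by linarith
  then have "((1 + x) ^ 2) ^ 3 * (1 + x) \<le> (1 + 66 / 10 * x) * (1 + x)"
    using assms by (intro mult_right_mono) auto
  also have "(1 + 66 / 10 * x) * (1 + x) = 1 + 76 / 10 * x + 66 / 10 * (x * x)" by (simp add: field_simps)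
  also have "\<dots> \<le> 1 + 8 * x" using a assms(1) by linarith
  also have "((1 + x) ^ 2) ^ 3 * (1 + x) = (1 + x) ^ 7" by (simp add: eval_nat_numeral)
  finally show ?thesis .
qed

text \<open>With d = 1/(2 + 2V)^2 the seventh power of the rate \<Lambda> is 1 + d, so after
  multiplication by \<Lambda> the claim is 1 + d \<le> \<Lambda>^2 + c \<Lambda>, where c = 1/(1 +
  (2 + V)^2). From \<Lambda> \<ge> 1 + d/8 the square contributes d/4, and c \<ge> 3d/4 the
  rest.\<close>

lemma mass_rate_bound:
  assumes "0 < V"
  shows "mass_rate V ^ 6 \<le> mass_rate V + 1 / (1 + (2 + V)\<^sup>2)"
proof -
  define d where "d = 1 / (2 + 2 * V)\<^sup>2"
  have "4 \<le> (2 + 2 * V)\<^sup>2" using power_mono[of 2 "2 + 2 * V" 2] assms by simp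
  then have d: "0 < d" "d \<le> 1 / 4" by (auto simp: d_def divide_simps)
  have L7: "mass_rate V ^ 7 = 1 + d" using d by (simp add: mass_rate_def d_def)
  have L1: "1 < mass_rate V" by (rule mass_rate_gt_1[OF assms])
  have "(1 + d / 8) ^ 7 \<le> 1 + d" using power7_le[of "d / 8"] d by simp
  then have "(1 + d / 8) ^ 7 \<le> mass_rate V ^ 7" by (simp add: L7)
  then have L8: "1 + d / 8 \<le> mass_rate V" using L1 by (subst (asm) power_mono_iff) (use d in auto)
  define c where "c = 1 / (1 + (2 + V)\<^sup>2)"
  have c0: "0 < c" by (simp add: c_def add_pos_nonneg)
  have "3 / 4 * d \<le> c"
  proof -
    have "3 * (1 + (2 + V)\<^sup>2) \<le> 4 * (2 + 2 * V)\<^sup>2"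
      using assms mult_pos_pos[OF assms assms] by (simp add: power2_eq_square algebra_simps)
    moreover have "0 < (2 + 2 * V)\<^sup>2" "0 < 1 + (2 + V)\<^sup>2" using assms by (auto simp: add_pos_nonneg)
    ultimately show ?thesis unfolding c_def d_def by (simp add: divide_simps mult.commute)
  qed
  have "mass_rate V * mass_rate V ^ 6 = 1 + d" using L7 by (simp flip: power_Suc)
  also have "1 + d \<le> (1 + d / 8) * (1 + d / 8) + c"
  proof -
    have "(1 + d / 8) * (1 + d / 8) = 1 + d / 4 + (d / 8) * (d / 8)" by (simp add: field_simps)
    moreover have "0 \<le> (d / 8) * (d / 8)" by simp
    ultimately show ?thesis using \<open>3 / 4 * d \<le> c\<close> by linarith
  qed
  also have "\<dots> \<le> mass_rate V * mass_rate V + mass_rate V * c"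
    using L8 L1 d c0 by (intro add_mono mult_mono) auto
  finally have "mass_rate V * mass_rate V ^ 6 \<le> mass_rate V * (mass_rate V + c)" by (simp add: algebra_simps)
  then show ?thesis using L1 by (simp add: c_def)
qed

lemma golden_word_rate_gt_1: "0 < V \<Longrightarrow> 1 < golden * word_rate V"
proof -
  assume V: "0 < V"
  have "1 * 1 \<le> (3 + V) * (3 + V)" using V by (intro mult_mono) auto
  then have "1 < word_rate V" by (simp add: word_rate_def power2_eq_square)
  then have "1 * 1 < golden * word_rate V" using golden_gt by (intro mult_strict_mono) auto
  then show ?thesis by simp
qed

lemma holder_exponent_pos: "0 < V \<Longrightarrow> 0 < holder_exponent V"
  unfolding holder_exponent_def by (intro divide_pos_pos ln_gt_zero mass_rate_gt_1 golden_word_rate_gt_1)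

text \<open>Multiplying numerator and denominator by 14 turns \<open>holder_exponent\<close> into 2
  d / (14 ln(golden \<open>word_rate\<close>)) with d as in the proof. So it suffices that (golden
  \<open>word_rate\<close>)^7 is at most (golden K)^8; the spare factor golden K absorbs the
  constant by which \<open>word_rate\<close> may exceed K.\<close>

lemma target_le_holder_exponent:
  assumes V: "0 < V"
  shows "2 * ln (1 + 1 / (2 + 2 * V)\<^sup>2) /
          (ln (1 + 1 / (2 + 2 * V)\<^sup>2) + 16 * ln ((sqrt 5 + 1) / 2)
             + 16 * ln ((5 + 2 * V) powr (1 / 2) * (3 + V) * a_root V)) \<le> holder_exponent V"
proof -
  define K where "K = (5 + 2 * V) powr (1 / 2) * (3 + V) * a_root V"
  define y where "y = sqrt (5 + 2 * V) * (3 + V) * sqrt (2 + V)"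
  have "(5 + 2 * V) powr (1 / 2) = sqrt (5 + 2 * V)" using V by (simp add: powr_half_sqrt)
  then have Ky: "y \<le> K" unfolding y_def K_def using V sqrt_le_a_root[OF V]
    by (intro mult_mono) auto
  have y0: "0 < y" using V by (simp add: y_def)
  have y2: "y\<^sup>2 = (5 + 2 * V) * (3 + V)\<^sup>2 * (2 + V)"
    using V by (simp add: y_def power_mult_distrib)
  have VV: "0 < V * V" using V by simp
  \<comment> \<open>The ratio at V = 0 is 4.5 divided by the square root of 10, just below 1.43. The
    seventh power of 1.43 is below 15, the lower bound for golden K.\<close>
  have "word_rate V \<le> 143 / 100 * y"
  proof (rule power2_le_imp_le)
    have "225 / 100 * (3 + V)\<^sup>2 \<le> 20449 / 10000 * ((5 + 2 * V) * (2 + V))"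
      using V VV by (simp add: power2_eq_square algebra_simps)
    then have "225 / 100 * (3 + V)\<^sup>2 * (3 + V)\<^sup>2 \<le> 20449 / 10000 * ((5 + 2 * V) * (2 + V)) * (3 + V)\<^sup>2"
      by (rule mult_right_mono) simp
    also have "20449 / 10000 * ((5 + 2 * V) * (2 + V)) * (3 + V)\<^sup>2 = (143 / 100 * y)\<^sup>2"
      unfolding power_mult_distrib y2 by (simp add: power2_eq_square)
    also have "225 / 100 * (3 + V)\<^sup>2 * (3 + V)\<^sup>2 = (word_rate V)\<^sup>2"
      by (simp add: word_rate_def power_mult_distrib power2_eq_square[of "(3 + V)\<^sup>2"]) (simp add: power2_eq_square)
    finally show "(word_rate V)\<^sup>2 \<le> (143 / 100 * y)\<^sup>2" .
  qed (use y0 in simp)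
  then have rateK: "word_rate V \<le> 143 / 100 * K" using Ky by linarith
  have "94 / 10 \<le> y"
  proof (rule power2_le_imp_le)
    have "5 * 3\<^sup>2 * 2 \<le> (5 + 2 * V) * (3 + V)\<^sup>2 * (2 + V)"
      using V by (intro mult_mono power_mono) auto
    then show "(94 / 10)\<^sup>2 \<le> y\<^sup>2" unfolding y2 by (simp add: power2_eq_square)
  qed (use y0 in simp)
  then have K9: "94 / 10 \<le> K" using Ky by linarith
  then have gK: "15 \<le> golden * K" using mult_mono[of "8/5" golden "94/10" K] golden_gt by simp
  have rate0: "0 < word_rate V" using V by (simp add: word_rate_def)
  have g0: "0 < golden" using golden_gt by simp
  have "word_rate V ^ 7 \<le> (143 / 100 * K) ^ 7" using rateK rate0 by (intro power_mono) auto
  also have "\<dots> = (143 / 100) ^ 7 * K ^ 7" by (rule power_mult_distrib)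
  also have "\<dots> \<le> (golden * K) * K ^ 7" using gK K9 by (intro mult_right_mono) (auto simp: power_def)
  finally have "golden ^ 7 * word_rate V ^ 7 \<le> golden ^ 7 * ((golden * K) * K ^ 7)"
    using g0 by (intro mult_left_mono) auto
  also have "golden ^ 7 * ((golden * K) * K ^ 7) = (golden * K) ^ 8"
    by (simp add: power_mult_distrib eval_nat_numeral mult_ac)
  finally have "(golden * word_rate V) ^ 7 \<le> (golden * K) ^ 8" by (simp add: power_mult_distrib)
  then have "ln ((golden * word_rate V) ^ 7) \<le> ln ((golden * K) ^ 8)"
    using g0 rate0 K9 by (subst ln_le_cancel_iff) auto
  then have 7: "7 * ln (golden * word_rate V) \<le> 8 * ln (golden * K)"
    using g0 rate0 K9 by (simp add: ln_realpow)
  define d where "d = ln (1 + 1 / (2 + 2 * V)\<^sup>2)"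
  have d0: "0 < d" unfolding d_def using V by (intro ln_gt_zero) simp
  have den: "14 * ln (golden * word_rate V) \<le> d + 16 * ln ((sqrt 5 + 1) / 2) + 16 * ln K"
  proof -
    have "ln (golden * K) = ln golden + ln K" by (rule ln_mult_pos) (use g0 K9 in auto)
    with 7 d0 show ?thesis unfolding golden_def[symmetric] by linarith
  qed
  have G0: "0 < ln (golden * word_rate V)" using golden_word_rate_gt_1[OF V] by simp
  have "2 * d / (d + 16 * ln ((sqrt 5 + 1) / 2) + 16 * ln K) \<le> 2 * d / (14 * ln (golden * word_rate V))"
    using den G0 d0 by (intro divide_left_mono mult_pos_pos) auto
  also have "\<dots> = holder_exponent V"
  proof -
    have "ln (mass_rate V) = d / 7" using V by (simp add: mass_rate_def d_def ln_root add_pos_nonneg)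
    then have "d = 7 * ln (mass_rate V)" by simp
    then show ?thesis by (simp add: holder_exponent_def)
  qed
  finally show ?thesis unfolding K_def d_def .
qed

section \<open>From Hoelder continuity to Hausdorff null sets\<close>

context fib_model
begin

lemma nu_holder:
  obtains C where "0 < C" "\<And>E \<epsilon> S m. E \<in> good \<Longrightarrow> 0 < \<epsilon> \<Longrightarrow> \<epsilon> \<le> 1 \<Longrightarrow> S \<in> sets borel \<Longrightarrow> S \<subseteq> cball E \<epsilon> \<Longrightarrow>
    (ell2_norm (P S (unit m)))\<^sup>2 \<le> C * \<epsilon> powr holder_exponent V"
proof -
  define t where "t = 2 + V"
  define C0 where "C0 = 30 * (5 * t + 9) * ((2 * t + 2)\<^sup>2) ^ 4"
  define C where "C = mass_rate V ^ 6 * (4 + 2 * C0\<^sup>2)"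
  have L1: "1 < mass_rate V" by (rule mass_rate_gt_1[OF V])
  have C: "0 < C" unfolding C_def using L1 by (intro mult_pos_pos) (auto simp: add_pos_nonneg)
  let ?G = "golden * word_rate V"
  have G1: "1 < ?G" by (rule golden_word_rate_gt_1[OF V])
  have "(ell2_norm (P S (unit m)))\<^sup>2 \<le> C * \<epsilon> powr holder_exponent V"
    if E: "E \<in> good" and \<epsilon>: "0 < \<epsilon>" "\<epsilon> \<le> 1" and S: "S \<in> sets borel" "S \<subseteq> cball E \<epsilon>" for E \<epsilon> S m
  proof -
    define x where "x = 1 / \<epsilon>"
    \<comment> \<open>The largest level at which (golden \<open>word_rate\<close>)^k \<epsilon> is
      still at most 1, so that the accumulated error stays below \<open>C0\<close>.\<close>
    define k where "k = nat \<lfloor>ln x / ln ?G\<rfloor>"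
    have x1: "1 \<le> x" using \<epsilon> by (simp add: x_def)
    have lG: "0 < ln ?G" using G1 by simp
    have q0: "0 \<le> ln x / ln ?G" using x1 lG by simp
    have k: "real k \<le> ln x / ln ?G" "ln x / ln ?G \<le> real (k + 1)" using q0 by (simp_all add: k_def) linarith+
    have "?G ^ k = exp (real k * ln ?G)" using G1 by (simp add: exp_of_nat_mult)
    also have "\<dots> \<le> exp (ln x)" using k(1) lG by (simp add: field_simps)
    finally have Gk: "?G ^ k * \<epsilon> \<le> 1" using x1 \<epsilon> by (simp add: x_def field_simps)
    have "x powr holder_exponent V = exp (ln x / ln ?G * ln (mass_rate V))"
      using x1 by (simp add: powr_def holder_exponent_def mult.commute)
    also have "\<dots> \<le> exp (real (k + 1) * ln (mass_rate V))"
      using k(2) L1 by (subst exp_le_cancel_iff, intro mult_right_mono) auto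
    also have "\<dots> = mass_rate V ^ (k + 1)" using L1 by (subst exp_of_nat_mult) auto
    finally have xL: "x powr holder_exponent V \<le> mass_rate V ^ (k + 1)" .
    let ?\<phi> = "P S (unit m)" let ?N = "(ell2_norm ?\<phi>)\<^sup>2"
    let ?B = "C0 * (3 / 2 * (t + 1)\<^sup>2) ^ k"
    have phi: "?\<phi> \<in> ell2" by (intro P_ell2 S unit_ell2)
    have t3: "3 / 2 * (t + 1)\<^sup>2 = word_rate V" by (simp add: word_rate_def t_def add.commute)
    have t0: "0 \<le> t" using V by (simp add: t_def)
    have C00: "0 \<le> C0" using t0 by (simp add: C0_def)
    have "mass_rate V ^ (k + 1) * sqs ?\<phi> m \<le> mass_rate V ^ 6 * (4 + 2 * (?B * fib (k + 1) * \<epsilon>)\<^sup>2) * ?N"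
      unfolding C0_def t_def
      by (rule good_bound[OF E _ mass_rate_bound[OF V] phi approximate_eigenvector[OF S _ unit_ell2]])
        (use L1 \<epsilon> in auto)
    also have "\<dots> \<le> mass_rate V ^ 6 * (4 + 2 * C0\<^sup>2) * ?N"
    proof -
      have "?B * fib (k + 1) * \<epsilon> \<le> (C0 * word_rate V ^ k) * golden ^ k * \<epsilon>"
        unfolding t3 using \<epsilon> C00 by (intro mult_right_mono mult_left_mono fib_le_golden) (auto simp: word_rate_def)
      also have "\<dots> = C0 * (?G ^ k * \<epsilon>)" by (simp add: power_mult_distrib mult_ac)
      also have "\<dots> \<le> C0 * 1" by (intro mult_left_mono Gk C00)
      finally have "(?B * fib (k + 1) * \<epsilon>)\<^sup>2 \<le> C0\<^sup>2"
        using \<epsilon> C00 by (intro power_mono) (auto intro!: mult_nonneg_nonneg)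
      then show ?thesis using L1 by (intro mult_right_mono mult_left_mono) auto
    qed
    finally have "mass_rate V ^ (k + 1) * sqs ?\<phi> m \<le> C * ?N" by (simp add: C_def)
    \<comment> \<open>The left side of the bound is thus quadratic in \<open>?N\<close> and the
      right side linear; cancelling \<open>?N\<close> leaves the decay.\<close>
    moreover have "sqs ?\<phi> m = ?N * ?N"
      unfolding P_unit_diag[OF S(1)] norm_of_real by (simp add: power2_eq_square)
    ultimately have *: "mass_rate V ^ (k + 1) * ?N * ?N \<le> C * ?N" by (simp add: mult.assoc)
    have "mass_rate V ^ (k + 1) * ?N \<le> C"
    proof (cases "?N = 0")
      case False
      then have "0 < ?N" by (metis zero_le_power2 less_eq_real_def)
      with * show ?thesis by (simp only: mult_le_cancel_right_pos)
    qed (use C in simp)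
    then have "x powr holder_exponent V * ?N \<le> C"
      using mult_right_mono[OF xL, of ?N] by simp
    moreover have "\<epsilon> powr holder_exponent V * x powr holder_exponent V = 1"
      using \<epsilon> by (simp add: x_def powr_divide)
    ultimately have "(\<epsilon> powr holder_exponent V * x powr holder_exponent V) * ?N \<le> \<epsilon> powr holder_exponent V * C"
      unfolding mult.assoc by (intro mult_left_mono) auto
    then show ?thesis using \<open>\<epsilon> powr holder_exponent V * x powr holder_exponent V = 1\<close> by (simp add: mult.commute)
  qed
  with C that show thesis by blast
qed

lemma good_closed: "closed good"
proof -
  have "continuous_on UNIV (\<lambda>E. e11 (MM E i)) \<and> continuous_on UNIV (\<lambda>E. e12 (MM E i)) \<and>
      continuous_on UNIV (\<lambda>E. e21 (MM E i)) \<and> continuous_on UNIV (\<lambda>E. e22 (MM E i))" for i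
    by (induction i rule: fib.induct) (auto simp: S0_def S1_def times_m2_def intro!: continuous_intros)
  then have "closed {E. \<bar>tr (MM E i)\<bar> \<le> 2 + V}" for i
    unfolding tr_def by (intro closed_Collect_le continuous_intros) auto
  then show ?thesis unfolding good_def by (rule closed_Collect_all)
qed

text \<open>Each escaping energy has a null ball around it; the Lindelof property replaces this
  cover by a countable one.\<close>

lemma nu_escape: "emeasure (nu m) (- good) = 0"
proof -
  define F where "F = {ball E \<epsilon> | E \<epsilon>. 0 < \<epsilon> \<and> (\<forall>\<psi>\<in>ell2. P (ball E \<epsilon>) \<psi> = (\<lambda>n. 0))}"
  have "open B" if "B \<in> F" for B using that by (auto simp: F_def)
  from Lindelof[of F, OF this] obtain F' where F': "F' \<subseteq> F" "countable F'" "\<Union>F' = \<Union>F" by metis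
  have "B \<in> null_sets (nu m)" if "B \<in> F'" for B
  proof -
    have "B \<in> F" using that F'(1) by blast
    then obtain E \<epsilon> where B: "B = ball E \<epsilon>" "\<And>\<psi>. \<psi> \<in> ell2 \<Longrightarrow> P (ball E \<epsilon>) \<psi> = (\<lambda>n. 0)"
      unfolding F_def by blast
    have "emeasure (nu m) B = ennreal ((ell2_norm (\<lambda>n. 0))\<^sup>2)" using B(2)[OF unit_ell2, of m] by (simp add: B(1) emeasure_nu)
    then show ?thesis by (intro null_setsI) (auto simp: B(1) ell2_norm_def)
  qed
  then have "(\<Union>B\<in>F'. B) \<in> null_sets (nu m)" by (intro null_sets_UN' F')
  then have N: "\<Union>F' \<in> null_sets (nu m)" by simp
  have "- good \<subseteq> \<Union>F'"
  proof
    fix E assume "E \<in> - good"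
    then obtain \<epsilon> where "0 < \<epsilon>" "\<forall>\<psi>\<in>ell2. P (ball E \<epsilon>) \<psi> = (\<lambda>n. 0)" using escape_null[of E] by blast
    then have "ball E \<epsilon> \<in> F" "E \<in> ball E \<epsilon>" by (auto simp: F_def)
    then show "E \<in> \<Union>F'" using F'(3) by blast
  qed
  then have "emeasure (nu m) (- good) \<le> emeasure (nu m) (\<Union>F')" using N by (intro emeasure_mono) auto
  then show ?thesis using N by auto
qed

text \<open>The mass distribution principle, applied to the part of \<open>S\<close> inside
  \<open>good\<close>; \<open>nu_escape\<close> removes the rest.\<close>

lemma nu_hausdorff_null:
  assumes \<alpha>: "0 \<le> \<alpha>" "\<alpha> \<le> holder_exponent V" and S: "S \<in> sets borel" "hausdorff_measure \<alpha> S = 0"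
  shows "emeasure (nu m) S = 0"
proof -
  obtain C where C: "0 < C" "\<And>E \<epsilon> S m. E \<in> good \<Longrightarrow> 0 < \<epsilon> \<Longrightarrow> \<epsilon> \<le> 1 \<Longrightarrow> S \<in> sets borel \<Longrightarrow> S \<subseteq> cball E \<epsilon> \<Longrightarrow>
    (ell2_norm (P S (unit m)))\<^sup>2 \<le> C * \<epsilon> powr holder_exponent V" using nu_holder by metis
  have b: "0 < holder_exponent V" by (rule holder_exponent_pos[OF V])
  have small: "emeasure (nu m) (cball E d) \<le> ennreal (C * d powr holder_exponent V)" if "E \<in> good" "0 \<le> d" "d \<le> 1" for E d
  proof (cases "d = 0")
    case False
    then show ?thesis using C(2)[of E d "cball E d" m] that by (simp add: emeasure_nu ennreal_leI)
  next
    \<comment> \<open>Covers may contain sets of diameter 0, whose gauge vanishes for \<alpha> > 0,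
      so single points must be shown to have no mass. \<open>nu_holder\<close> at radius
      \<open>y powr (1 / holder_exponent V)\<close> bounds the mass by \<open>C * y\<close>.\<close>
    case True
    let ?N = "(ell2_norm (P (cball E d) (unit m)))\<^sup>2"
    have "?N = 0"
    proof (rule ccontr)
      assume "?N \<noteq> 0"
      then have N: "0 < ?N" by (metis zero_le_power2 less_eq_real_def)
      define y where "y = min 1 (?N / (2 * C))"
      have y: "0 < y" "y \<le> 1" "C * y < ?N"
      proof -
        show "0 < y" "y \<le> 1" using N C(1) by (auto simp: y_def)
        have "C * y \<le> C * (?N / (2 * C))" using C(1) by (intro mult_left_mono) (auto simp: y_def)
        also have "\<dots> < ?N" using C(1) N by (simp add: field_simps)
        finally show "C * y < ?N" .
      qed
      have "?N \<le> C * (y powr (1 / holder_exponent V)) powr holder_exponent V"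
        using y b that True by (intro C(2)) (auto simp: powr_le1)
      also have "(y powr (1 / holder_exponent V)) powr holder_exponent V = y" using y b by (simp add: powr_powr)
      finally show False using y by simp
    qed
    then show ?thesis by (simp add: emeasure_nu)
  qed
  have good_borel: "good \<in> sets borel" using good_closed by (rule borel_closed)
  have "emeasure (nu m) (S \<inter> good) \<le> 0"
  proof (rule ennreal_le_epsilon)
    fix e :: real assume e: "0 < e"
    have "hausdorff_premeasure \<alpha> 1 S \<le> hausdorff_measure \<alpha> S"
      unfolding hausdorff_measure_def by (rule SUP_upper) simp
    then have "hausdorff_premeasure \<alpha> 1 S < ennreal (e / C)" using S(2) e C(1) by simp
    then obtain A :: "nat \<Rightarrow> real set" where A: "S \<subseteq> (\<Union>i. A i)" "\<And>i. bounded (A i)" "\<And>i. diameter (A i) \<le> 1"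
      "(\<Sum>i. ennreal (hausdorff_gauge \<alpha> (A i))) < ennreal (e / C)"
      unfolding hausdorff_premeasure_def INF_less_iff by auto
    \<comment> \<open>The Hoelder bound is available only around points of \<open>good\<close>, so
      each covering set that meets \<open>S \<inter> good\<close> is enclosed in a ball centred at
      such a point, with its diameter as radius.\<close>
    define D where "D i = (if A i \<inter> (S \<inter> good) = {} then {} else cball (SOME x. x \<in> A i \<inter> (S \<inter> good)) (diameter (A i)))" for i
    have D: "A i \<inter> (S \<inter> good) \<subseteq> D i" "D i \<in> sets (nu m)"
      "emeasure (nu m) (D i) \<le> ennreal C * ennreal (hausdorff_gauge \<alpha> (A i))" for i
    proof -
      consider (empty) "D i = {}" "A i \<inter> (S \<inter> good) = {}"
        | (hit) x where "D i = cball x (diameter (A i))" "x \<in> A i \<inter> (S \<inter> good)"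
      proof (cases "A i \<inter> (S \<inter> good) = {}")
        case False
        then have "(SOME x. x \<in> A i \<inter> (S \<inter> good)) \<in> A i \<inter> (S \<inter> good)" by (simp only: some_in_eq not_False_eq_True)
        with False show ?thesis by (intro that(2)) (simp only: D_def if_False)
      qed (use that(1) in \<open>simp add: D_def\<close>)
      then have "A i \<inter> (S \<inter> good) \<subseteq> D i \<and> D i \<in> sets (nu m) \<and>
        emeasure (nu m) (D i) \<le> ennreal C * ennreal (hausdorff_gauge \<alpha> (A i))"
      proof cases
        case (hit x)
        let ?d = "diameter (A i)"
        have d0: "0 \<le> ?d" by (rule diameter_ge_0[OF A(2)])
        have "?d powr holder_exponent V \<le> hausdorff_gauge \<alpha> (A i)"
        proof (cases "\<alpha> = 0")
          case True
          then show ?thesis using hit d0 A(3)[of i] b by (auto simp: hausdorff_gauge_def powr_le1)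
        next
          case False
          then have "?d powr holder_exponent V \<le> ?d powr \<alpha>"
            using d0 A(3)[of i] \<alpha> by (cases "?d = 0") (auto intro!: powr_mono')
          then show ?thesis using hit False by (auto simp: hausdorff_gauge_def)
        qed
        then have "ennreal (C * ?d powr holder_exponent V) \<le> ennreal (C * hausdorff_gauge \<alpha> (A i))"
          using C(1) by (intro ennreal_leI mult_left_mono) auto
        also have "\<dots> = ennreal C * ennreal (hausdorff_gauge \<alpha> (A i))"
          using C(1) by (intro ennreal_mult) (auto simp: hausdorff_gauge_def)
        finally have "emeasure (nu m) (D i) \<le> ennreal C * ennreal (hausdorff_gauge \<alpha> (A i))"
          using small[of x ?d] hit d0 A(3)[of i] by (auto intro: order.trans)
        moreover have "A i \<subseteq> D i"
        proof
          fix y assume "y \<in> A i"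
          then show "y \<in> D i" using diameter_bounded_bound[OF A(2), of x i y] hit by simp
        qed
        ultimately show ?thesis using hit(1) by auto
      qed auto
      then show "A i \<inter> (S \<inter> good) \<subseteq> D i" "D i \<in> sets (nu m)"
        "emeasure (nu m) (D i) \<le> ennreal C * ennreal (hausdorff_gauge \<alpha> (A i))" by auto
    qed
    have "S \<inter> good \<subseteq> (\<Union>i. D i)" using A(1) D(1) by blast
    then have "emeasure (nu m) (S \<inter> good) \<le> emeasure (nu m) (\<Union>i. D i)"
      using D(2) by (intro emeasure_mono) auto
    also have "\<dots> \<le> (\<Sum>i. emeasure (nu m) (D i))"
      using D(2) by (intro emeasure_subadditive_countably) auto
    also have "\<dots> \<le> (\<Sum>i. ennreal C * ennreal (hausdorff_gauge \<alpha> (A i)))" by (intro suminf_le D(3)) auto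
    also have "\<dots> = ennreal C * (\<Sum>i. ennreal (hausdorff_gauge \<alpha> (A i)))" by simp
    also have "\<dots> \<le> ennreal C * ennreal (e / C)" using A(4) by (intro mult_left_mono) auto
    also have "\<dots> = ennreal e" using C(1) e by (simp add: ennreal_mult[symmetric])
    finally show "emeasure (nu m) (S \<inter> good) \<le> 0 + ennreal e" by simp
  qed
  moreover have "emeasure (nu m) S \<le> emeasure (nu m) ((S \<inter> good) \<union> (- good))"
    using S good_borel by (intro emeasure_mono) auto
  moreover have "\<dots> \<le> emeasure (nu m) (S \<inter> good) + emeasure (nu m) (- good)"
    using S good_borel by (intro emeasure_subadditive) auto
  ultimately show ?thesis using nu_escape[of m] by simp
qed

end

theorem corollary1:
  fixes V \<omega> \<alpha> :: real and \<psi> :: "int \<Rightarrow> complex" and \<mu> :: "real measure" and S :: "real set"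
  assumes "V > 0"
    and "0 \<le> \<alpha>"
    and "\<alpha> < 2 * ln (1 + 1 / (2 + 2 * V)\<^sup>2) /
          (ln (1 + 1 / (2 + 2 * V)\<^sup>2) + 16 * ln ((sqrt 5 + 1) / 2)
             + 16 * ln ((5 + 2 * V) powr (1 / 2) * (3 + V) * a_root V))"
    and "\<psi> \<in> ell2"
    and "is_spectral_measure (fib_hamiltonian V \<omega>) \<psi> \<mu>"
    and "S \<in> sets borel"
    and "hausdorff_measure \<alpha> S = 0"
  shows "emeasure \<mu> S = 0"
proof (cases "real_spectrum (fib_hamiltonian V \<omega>) = {}")
  \<comment> \<open>The norm bound of the calculus is a supremum over the spectrum and says nothing
    useful when that is empty; in this case the measure vanishes on the whole line.\<close>
  case True
  have "sets \<mu> = sets borel" "emeasure \<mu> UNIV = 0"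
    using assms(5) True by (auto simp: is_spectral_measure_def)
  moreover from this have "emeasure \<mu> S \<le> emeasure \<mu> UNIV" by (intro emeasure_mono) auto
  ultimately show ?thesis by simp
next
  case False
  obtain \<Phi> where \<Phi>: "borel_functional_calculus (fib_hamiltonian V \<omega>) \<Phi>"
    and int: "\<And>g. g \<in> bounded_borel_on (real_spectrum (fib_hamiltonian V \<omega>)) \<Longrightarrow>
      ell2_inner \<psi> (\<Phi> g \<psi>) = (LINT E:real_spectrum (fib_hamiltonian V \<omega>)|\<mu>. g E)"
    using assms(5) by (auto simp: is_spectral_measure_def)
  obtain W c where W: "W 0 = (\<lambda>n. frac (of_int n * alpha0 + \<omega>) \<in> {1 - alpha0..<1})"
    "\<And>i. desubst (W i) (W (Suc i)) (c i)"
    by (rule desubst_sequence[OF sturmian_fib]) blast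
  interpret fib_model V \<omega> \<Phi> W c
    by unfold_locales (use assms(1) \<Phi> False W in auto)
  have "\<alpha> \<le> holder_exponent V" using assms(3) target_le_holder_exponent[OF assms(1)] by linarith
  then have "emeasure (nu m) S = 0" for m
    using nu_hausdorff_null[OF assms(2) _ assms(6,7)] by blast
  then have "P S \<psi> = (\<lambda>n. 0)" by (intro P_eq_0_if_nu_null assms)
  then show ?thesis
    using assms(5) by (intro spectral_measure_null[OF _ _ _ assms(4) int assms(6)])
      (auto simp: is_spectral_measure_def)
qed

end
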